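(* Let $\mathfrak X,\mathfrak Y$ be 3-Hilbert spaces and $F\in\mathrm{Hom}(\mathfrak X\to\mathfrak Y)$, with unitary 2-adjoint $F^*$. Then $F$ is an isometry (respectively, an isometric equivalence) of 3-Hilbert spaces if and only if $\mathrm{coev}_F:\mathrm{id}_{\mathfrak X}\Rightarrow F^*F$ is an isometric equivalence in $\mathrm{End}(\mathfrak X)$ and $\mathrm{ev}_F:FF^*\Rightarrow\mathrm{id}_{\mathfrak Y}$ is an isometry (respectively, an isometric equivalence) in $\mathrm{End}(\mathfrak Y)$.
   Context: **2-Hilbert spaces.** A 2-Hilbert space is a finitely semisimple $C^*$-category $\mathcal C$ with faithful positive linear functionals $\mathrm{Tr}^{\mathcal C}_c:\mathrm{End}(c)\to\mathbb C$ such that $\mathrm{Tr}_a(gf)=\mathrm{Tr}_b(fg)$ for $f:a\to b$, $g:b\to a$. An isometric equivalence of 2-Hilbert spaces ($\cong^\dagger$) is a trace-preserving $\dagger$-equivalence. **(Pre-)3-Hilbert spaces.** A unitary 2-category is a $C^*$-2-category $\mathfrak X$ such that for all $a_1,\dots,a_n\in\mathfrak X$ the linking category $\mathcal L=\bigoplus_{i,j}\mathfrak X(a_j\to a_i)$ (matrix multiplication and composition) is a unitary multitensor category; it is finite if all $\mathcal L$ are multifusion and $\dim \mathrm{End}_{\mathcal Z(\mathcal L)}(1_{\mathcal L})$ is globally bounded ($\mathcal Z$ is the Drinfeld center). A 1-morphism $X:a\to b$ is written ${}_aX_b$, and ${}_aX\otimes_bY_c:a\to c$ is "first $X$, then $Y$".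 A unitary adjoint functor (UAF) $\vee$ is a choice for each ${}_aX_b$ of an adjoint ${}_bX^\vee_a$ with $\mathrm{ev}_X:X^\vee\otimes_aX\Rightarrow1_b$, $\mathrm{coev}_X:1_a\Rightarrow X\otimes_bX^\vee$ satisfying the zig-zag equations, such that the canonical maps $1_a^\vee\to1_a$ and $X^\vee\otimes Y^\vee\Rightarrow(Y\otimes X)^\vee$ are unitary and $(f^\vee)^\dagger=(f^\dagger)^\vee$. A spherical weight $\Psi$ is a family of faithful positive functionals $\Psi_a:\mathrm{End}(1_a)\to\mathbb C$ with $\Psi_a(\mathrm{coev}_X^\dagger(f\otimes1)\mathrm{coev}_X)=\Psi_b(\mathrm{ev}_X(1\otimes f)\mathrm{ev}_X^\dagger)=:\mathrm{Tr}_X(f)$ for all $f\in\mathrm{End}({}_aX_b)$; with these traces each $\mathfrak X(a\to b)$ is a 2-Hilbert space. A pre-3-Hilbert space is a finite unitary 2-category with a UAF and a spherical weight. A 1-morphism ${}_aX_b$ is an isometry if $\mathrm{coev}_X$ is unitary and $\mathrm{ev}_X$ is an isometry, and an isometric equivalence if both are unitary. A Hilbert direct sum of $a,b$ is an object $a\boxplus b$ with isometries $I:a\to a\boxplus b$, $J:b\to a\boxplus b$ such that $\mathrm{ev}_I\mathrm{ev}_I^\dagger+\mathrm{ev}_J\mathrm{ev}_J^\dagger=\mathrm{id}_{1_{a\boxplus b}}$. An $H^*$-monad on $a$ is an associative unital algebra $({}_aA_a,\mu,\iota)$ in $\mathfrak X(a\to a)$ such that $\mu^\dagger$ is an $A$–$A$-bimodule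 map, $\mu\mu^\dagger$ is invertible, and $\Psi_a(\iota^\dagger\mu(1\otimes f)\mu^\dagger\iota)=\Psi_a(\iota^\dagger\mu(f\otimes1)\mu^\dagger\iota)$ for all $f\in\mathrm{End}(A)$. It splits if there are ${}_aX_b$ with $\mathrm{ev}_X\mathrm{ev}_X^\dagger$ invertible and a unitary algebra isomorphism $A\cong X\otimes_bX^\vee$. A 3-Hilbert space is a pre-3-Hilbert space admitting all (finite) Hilbert direct sums and in which all $H^*$-monads split. **$\mathrm{Hom}(\mathfrak X\to\mathfrak Y)$ as a 3-Hilbert space.** Objects (1-morphisms of 3-Hilbert spaces) are linear $\dagger$-2-functors $F$ such that the canonical isomorphisms $F(X^\vee)\Rightarrow F(X)^\vee$ are unitary; 1-morphisms $\alpha:F\Rightarrow G$ are 2-natural transformations with unitary naturators $\alpha_X:F(X)\otimes\alpha_b\Rightarrow\alpha_a\otimes G(X)$; 2-morphisms are modifications, with $\dagger$ componentwise. Its UAF has $(\alpha^\vee)_a=(\alpha_a)^\vee$, $(\alpha^\vee)_X=\big[(\mathrm{ev}_{\alpha_a}\otimes1)(1\otimes\alpha_X\otimes1)(1\otimes\mathrm{coev}_{\alpha_b})\big]^\dagger$ for ${}_aX_b$, and $\mathrm{ev}_\alpha,\mathrm{coev}_\alpha$ componentwise. Two simple objects of $\mathfrak X$ lie in the same component if there is a nonzero 1-morphism between them; an ONB $\pi_0\mathfrak X$ is a choice of one simple object per component. With $\Omega_b=\mathfrak X(b\to b)$, $d_b=\Psi_b(\mathrm{id}_{1_b})$, $d_X=\mathrm{Tr}_X(\mathrm{id}_X)$,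 $D_{\Omega_b}=\sum_{X\in\mathrm{Irr}\,\Omega_b}d_X^2$, its weight is $\Psi^{\mathrm{Hom}}_F(m)=\sum_{b\in\pi_0\mathfrak X}\frac{d_b}{D_{\Omega_b}}\Psi^{\mathfrak Y}_{F(b)}(m_b)$. $\mathrm{End}(\mathfrak X)=\mathrm{Hom}(\mathfrak X\to\mathfrak X)$. **Isometries and adjoints.** $F\in\mathrm{Hom}(\mathfrak X\to\mathfrak Y)$ is an isometry of 3-Hilbert spaces if it is fully faithful (equivalences on hom categories) and preserves spherical weights; equivalently the maps $\mathfrak X(x_1\to x_2)\to\mathfrak Y(F(x_1)\to F(x_2))$ are isometric equivalences of 2-Hilbert spaces. It is an isometric equivalence if moreover it is an equivalence of 2-categories. The unitary 2-adjoint $F^*\in\mathrm{Hom}(\mathfrak Y\to\mathfrak X)$ (which exists and is essentially unique) comes with isometric equivalences $\mathfrak Y(F(x)\to y)\cong^\dagger\mathfrak X(x\to F^*(y))$ natural in $x,y$ (with unitary naturators); $\mathrm{coev}_F:\mathrm{id}_{\mathfrak X}\Rightarrow F^*F$ and $\mathrm{ev}_F:FF^*\Rightarrow\mathrm{id}_{\mathfrak Y}$ are its unit and counit. *)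

theory Defs
  imports Complex_Main "HOL-Library.FuncSet"
begin

section \<open>Linear dagger categories, \<open>C\<^sup>*\<close>-categories, 2-Hilbert spaces\<close>

record ('o, 'a) lin_cat =
  cob :: "'o set"
  carr :: "'a set"
  cdom :: "'a \<Rightarrow> 'o"
  ccod :: "'a \<Rightarrow> 'o"
  cid :: "'o \<Rightarrow> 'a"
  ccomp :: "'a \<Rightarrow> 'a \<Rightarrow> 'a"  (infixr "\<odot>\<index>" 70)
  czero :: "'o \<Rightarrow> 'o \<Rightarrow> 'a"
  cadd :: "'a \<Rightarrow> 'a \<Rightarrow> 'a"  (infixl "\<oplus>\<index>" 65)
  cscale :: "complex \<Rightarrow> 'a \<Rightarrow> 'a"
  cdag :: "'a \<Rightarrow> 'a"

text \<open>Composition is written in the order of functions: \<open>g \<odot> f\<close> is first \<open>f\<close>, then \<open>g\<close>.\<close>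

record ('o, 'a) tr_cat = "('o, 'a) lin_cat" +
  ctr :: "'o \<Rightarrow> 'a \<Rightarrow> complex"

definition chom :: "('o, 'a, 'z) lin_cat_scheme \<Rightarrow> 'o \<Rightarrow> 'o \<Rightarrow> 'a set" where
  "chom K a b = {f \<in> carr K. cdom K f = a \<and> ccod K f = b}"

locale dagger_category =
  fixes K :: "('o, 'a, 'z) lin_cat_scheme" (structure)
  assumes arr_obj: "f \<in> carr K \<Longrightarrow> cdom K f \<in> cob K \<and> ccod K f \<in> cob K"
    and id_hom: "a \<in> cob K \<Longrightarrow> cid K a \<in> chom K a a"
    and comp_hom: "f \<in> chom K a b \<Longrightarrow> g \<in> chom K b c \<Longrightarrow> g \<odot> f \<in> chom K a c"
    and comp_assoc: "f \<in> chom K a b \<Longrightarrow> g \<in> chom K b c \<Longrightarrow> h \<in> chom K c d \<Longrightarrow>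
      (h \<odot> g) \<odot> f = h \<odot> (g \<odot> f)"
    and comp_id: "f \<in> chom K a b \<Longrightarrow> f \<odot> cid K a = f \<and> cid K b \<odot> f = f"
    and zero_hom: "a \<in> cob K \<Longrightarrow> b \<in> cob K \<Longrightarrow> czero K a b \<in> chom K a b"
    and add_hom: "f \<in> chom K a b \<Longrightarrow> g \<in> chom K a b \<Longrightarrow> f \<oplus> g \<in> chom K a b"
    and scale_hom: "f \<in> chom K a b \<Longrightarrow> cscale K s f \<in> chom K a b"
    and add_comm: "f \<in> chom K a b \<Longrightarrow> g \<in> chom K a b \<Longrightarrow> f \<oplus> g = g \<oplus> f"
    and add_assoc: "f \<in> chom K a b \<Longrightarrow> g \<in> chom K a b \<Longrightarrow> h \<in> chom K a b \<Longrightarrow>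
      (f \<oplus> g) \<oplus> h = f \<oplus> (g \<oplus> h)"
    and add_zero: "f \<in> chom K a b \<Longrightarrow> f \<oplus> czero K a b = f"
    and scale_zero: "f \<in> chom K a b \<Longrightarrow> cscale K 0 f = czero K a b"
    and scale_one: "f \<in> chom K a b \<Longrightarrow> cscale K 1 f = f"
    and scale_scale: "f \<in> chom K a b \<Longrightarrow> cscale K s (cscale K t f) = cscale K (s * t) f"
    and scale_add_left: "f \<in> chom K a b \<Longrightarrow> cscale K (s + t) f = cscale K s f \<oplus> cscale K t f"
    and scale_add_right: "f \<in> chom K a b \<Longrightarrow> g \<in> chom K a b \<Longrightarrow>
      cscale K s (f \<oplus> g) = cscale K s f \<oplus> cscale K s g"
    and comp_add_left: "f \<in> chom K a b \<Longrightarrow> g \<in> chom K b c \<Longrightarrow> g' \<in> chom K b c \<Longrightarrow>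
      (g \<oplus> g') \<odot> f = (g \<odot> f) \<oplus> (g' \<odot> f)"
    and comp_add_right: "f \<in> chom K a b \<Longrightarrow> f' \<in> chom K a b \<Longrightarrow> g \<in> chom K b c \<Longrightarrow>
      g \<odot> (f \<oplus> f') = (g \<odot> f) \<oplus> (g \<odot> f')"
    and comp_scale: "f \<in> chom K a b \<Longrightarrow> g \<in> chom K b c \<Longrightarrow>
      g \<odot> cscale K s f = cscale K s (g \<odot> f) \<and> cscale K s g \<odot> f = cscale K s (g \<odot> f)"
    and dag_hom: "f \<in> chom K a b \<Longrightarrow> cdag K f \<in> chom K b a"
    and dag_dag: "f \<in> chom K a b \<Longrightarrow> cdag K (cdag K f) = f"
    and dag_comp: "f \<in> chom K a b \<Longrightarrow> g \<in> chom K b c \<Longrightarrow>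
      cdag K (g \<odot> f) = cdag K f \<odot> cdag K g"
    and dag_id: "a \<in> cob K \<Longrightarrow> cdag K (cid K a) = cid K a"
    and dag_add: "f \<in> chom K a b \<Longrightarrow> g \<in> chom K a b \<Longrightarrow> cdag K (f \<oplus> g) = cdag K f \<oplus> cdag K g"
    and dag_scale: "f \<in> chom K a b \<Longrightarrow> cdag K (cscale K s f) = cscale K (cnj s) (cdag K f)"

context
  fixes K :: "('o, 'a, 'z) lin_cat_scheme" (structure)
begin

definition cinverse :: "'a \<Rightarrow> 'a \<Rightarrow> bool" where
  "cinverse f g \<longleftrightarrow> f \<in> carr K \<and> g \<in> chom K (ccod K f) (cdom K f) \<and>
     g \<odot> f = cid K (cdom K f) \<and> f \<odot> g = cid K (ccod K f)"

definition ciso :: "'a \<Rightarrow> bool" where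
  "ciso f \<longleftrightarrow> (\<exists>g. cinverse f g)"

definition cunitary :: "'a \<Rightarrow> bool" where
  "cunitary f \<longleftrightarrow> cinverse f (cdag K f)"

definition cstar_norm :: "('a \<Rightarrow> real) \<Rightarrow> bool" where
  "cstar_norm nrm \<longleftrightarrow>
     (\<forall>f\<in>carr K. nrm f \<ge> 0) \<and>
     (\<forall>a b. \<forall>f\<in>chom K a b. nrm f = 0 \<longleftrightarrow> f = czero K a b) \<and>
     (\<forall>a b. \<forall>f\<in>chom K a b. \<forall>g\<in>chom K a b. nrm (f \<oplus> g) \<le> nrm f + nrm g) \<and>
     (\<forall>f\<in>carr K. \<forall>s. nrm (cscale K s f) = cmod s * nrm f) \<and>
     (\<forall>a b c. \<forall>f\<in>chom K a b. \<forall>g\<in>chom K b c. nrm (g \<odot> f) \<le> nrm g * nrm f) \<and>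
     (\<forall>f\<in>carr K. nrm (cdag K f \<odot> f) = (nrm f)\<^sup>2) \<and>
     (\<forall>a b. \<forall>s :: nat \<Rightarrow> 'a. (\<forall>k. s k \<in> chom K a b) \<longrightarrow>
        (\<forall>e>0. \<exists>N. \<forall>m\<ge>N. \<forall>k\<ge>N. nrm (s m \<oplus> cscale K (-1) (s k)) < e) \<longrightarrow>
        (\<exists>l\<in>chom K a b. \<forall>e>0. \<exists>N. \<forall>k\<ge>N. nrm (s k \<oplus> cscale K (-1) l) < e))"

text \<open>The norm of a \<open>C\<^sup>*\<close>-category is determined by the dagger structure, so being
  \<open>C\<^sup>*\<close> is a property. The last clause says that \<open>f\<^sup>\<dagger> f\<close> is positive in \<open>End (dom f)\<close>.\<close>

definition cstar_category :: bool where
  "cstar_category \<longleftrightarrow> dagger_category K \<and> (\<exists>nrm. cstar_norm nrm) \<and>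
     (\<forall>a b. \<forall>f\<in>chom K a b. \<exists>g\<in>chom K a a. cdag K f \<odot> f = cdag K g \<odot> g)"

primrec csum :: "'o \<Rightarrow> 'o \<Rightarrow> (nat \<Rightarrow> 'a) \<Rightarrow> nat \<Rightarrow> 'a" where
  "csum a b f 0 = czero K a b"
| "csum a b f (Suc n) = csum a b f n \<oplus> f n"

definition orth_dsum :: "nat \<Rightarrow> (nat \<Rightarrow> 'o) \<Rightarrow> 'o \<Rightarrow> (nat \<Rightarrow> 'a) \<Rightarrow> bool" where
  "orth_dsum n x s \<iota> \<longleftrightarrow> s \<in> cob K \<and> (\<forall>j<n. \<iota> j \<in> chom K (x j) s) \<and>
     (\<forall>j<n. \<forall>k<n. cdag K (\<iota> j) \<odot> \<iota> k = (if j = k then cid K (x j) else czero K (x k) (x j))) \<and>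
     csum s s (\<lambda>j. \<iota> j \<odot> cdag K (\<iota> j)) n = cid K s"

definition has_orth_dsums :: bool where
  "has_orth_dsums \<longleftrightarrow> (\<forall>n x. (\<forall>j<n. x j \<in> cob K) \<longrightarrow> (\<exists>s \<iota>. orth_dsum n x s \<iota>))"

text \<open>A fixed choice of orthogonal direct sums, unique up to a unique compatible unitary.\<close>

definition dsum_obj :: "nat \<Rightarrow> (nat \<Rightarrow> 'o) \<Rightarrow> 'o" where
  "dsum_obj n x = (SOME s. \<exists>\<iota>. orth_dsum n x s \<iota>)"

definition dsum_inc :: "nat \<Rightarrow> (nat \<Rightarrow> 'o) \<Rightarrow> nat \<Rightarrow> 'a" where
  "dsum_inc n x = (SOME \<iota>. orth_dsum n x (dsum_obj n x) \<iota>)"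

definition projections_split :: bool where
  "projections_split \<longleftrightarrow> (\<forall>c\<in>cob K. \<forall>p\<in>chom K c c. cdag K p = p \<longrightarrow> p \<odot> p = p \<longrightarrow>
     (\<exists>d\<in>cob K. \<exists>v\<in>chom K d c. cdag K v \<odot> v = cid K d \<and> v \<odot> cdag K v = p))"

definition dim_le :: "'o \<Rightarrow> 'o \<Rightarrow> 'a set \<Rightarrow> nat \<Rightarrow> bool" where
  "dim_le a b V N \<longleftrightarrow> (\<exists>v. (\<forall>i<N. v i \<in> V) \<and>
     (\<forall>f\<in>V. \<exists>s. f = csum a b (\<lambda>i. cscale K (s i) (v i)) N))"

definition simple_obj :: "'o \<Rightarrow> bool" where
  "simple_obj c \<longleftrightarrow> c \<in> cob K \<and> cid K c \<noteq> czero K c c \<and>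
     (\<forall>f\<in>chom K c c. \<exists>s. f = cscale K s (cid K c))"

definition isomorphic :: "'o \<Rightarrow> 'o \<Rightarrow> bool" where
  "isomorphic a b \<longleftrightarrow> (\<exists>f\<in>chom K a b. ciso f)"

definition irr_set :: "'o set \<Rightarrow> bool" where
  "irr_set S \<longleftrightarrow> (\<forall>s\<in>S. simple_obj s) \<and> (\<forall>c. simple_obj c \<longrightarrow> (\<exists>!s. s \<in> S \<and> isomorphic c s))"

definition Irr :: "'o set" where
  "Irr = (SOME S. irr_set S)"

definition semisimple_cstar :: bool where
  "semisimple_cstar \<longleftrightarrow> cstar_category \<and> has_orth_dsums \<and> projections_split \<and>
     (\<forall>a\<in>cob K. \<forall>b\<in>cob K. \<exists>N. dim_le a b (chom K a b) N) \<and>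
     (\<forall>c\<in>cob K. \<exists>n x \<iota>. (\<forall>j<n. simple_obj (x j)) \<and> orth_dsum n x c \<iota>)"

definition finitely_semisimple_cstar :: bool where
  "finitely_semisimple_cstar \<longleftrightarrow> semisimple_cstar \<and> (\<exists>S. finite S \<and> irr_set S)"

end

definition cat_functor ::
  "('o, 'a, 'y) lin_cat_scheme \<Rightarrow> ('p, 'b, 'z) lin_cat_scheme \<Rightarrow> ('o \<Rightarrow> 'p) \<Rightarrow> ('a \<Rightarrow> 'b) \<Rightarrow> bool" where
  "cat_functor K L P0 P1 \<longleftrightarrow>
     (\<forall>a\<in>cob K. P0 a \<in> cob L) \<and>
     (\<forall>a b. \<forall>f\<in>chom K a b. P1 f \<in> chom L (P0 a) (P0 b)) \<and>
     (\<forall>a\<in>cob K. P1 (cid K a) = cid L (P0 a)) \<and>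
     (\<forall>a b c. \<forall>f\<in>chom K a b. \<forall>g\<in>chom K b c. P1 (g \<odot>\<^bsub>K\<^esub> f) = P1 g \<odot>\<^bsub>L\<^esub> P1 f)"

definition lin_dagger_functor ::
  "('o, 'a, 'y) lin_cat_scheme \<Rightarrow> ('p, 'b, 'z) lin_cat_scheme \<Rightarrow> ('o \<Rightarrow> 'p) \<Rightarrow> ('a \<Rightarrow> 'b) \<Rightarrow> bool" where
  "lin_dagger_functor K L P0 P1 \<longleftrightarrow> cat_functor K L P0 P1 \<and>
     (\<forall>a b. \<forall>f\<in>chom K a b. \<forall>g\<in>chom K a b. P1 (f \<oplus>\<^bsub>K\<^esub> g) = P1 f \<oplus>\<^bsub>L\<^esub> P1 g) \<and>
     (\<forall>f\<in>carr K. \<forall>s. P1 (cscale K s f) = cscale L s (P1 f)) \<and>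
     (\<forall>f\<in>carr K. P1 (cdag K f) = cdag L (P1 f))"

definition nat_family ::
  "('o, 'a, 'y) lin_cat_scheme \<Rightarrow> ('p, 'b, 'z) lin_cat_scheme \<Rightarrow> ('o \<Rightarrow> 'p) \<Rightarrow> ('a \<Rightarrow> 'b) \<Rightarrow>
   ('o \<Rightarrow> 'p) \<Rightarrow> ('a \<Rightarrow> 'b) \<Rightarrow> ('o \<Rightarrow> 'b) \<Rightarrow> bool" where
  "nat_family K L P0 P1 Q0 Q1 \<eta> \<longleftrightarrow>
     (\<forall>a\<in>cob K. \<eta> a \<in> chom L (P0 a) (Q0 a)) \<and>
     (\<forall>a b. \<forall>f\<in>chom K a b. \<eta> b \<odot>\<^bsub>L\<^esub> P1 f = Q1 f \<odot>\<^bsub>L\<^esub> \<eta> a)"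

definition cat_equivalence ::
  "('o, 'a, 'y) lin_cat_scheme \<Rightarrow> ('p, 'b, 'z) lin_cat_scheme \<Rightarrow> ('o \<Rightarrow> 'p) \<Rightarrow> ('a \<Rightarrow> 'b) \<Rightarrow> bool" where
  "cat_equivalence K L P0 P1 \<longleftrightarrow> cat_functor K L P0 P1 \<and>
     (\<exists>Q0 Q1 \<eta> \<epsilon>. cat_functor L K Q0 Q1 \<and>
        nat_family K K id id (Q0 \<circ> P0) (Q1 \<circ> P1) \<eta> \<and> (\<forall>a\<in>cob K. ciso K (\<eta> a)) \<and>
        nat_family L L (P0 \<circ> Q0) (P1 \<circ> Q1) id id \<epsilon> \<and> (\<forall>b\<in>cob L. ciso L (\<epsilon> b)))"

definition dagger_equivalence ::
  "('o, 'a, 'y) lin_cat_scheme \<Rightarrow> ('p, 'b, 'z) lin_cat_scheme \<Rightarrow> ('o \<Rightarrow> 'p) \<Rightarrow> ('a \<Rightarrow> 'b) \<Rightarrow> bool" where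
  "dagger_equivalence K L P0 P1 \<longleftrightarrow> lin_dagger_functor K L P0 P1 \<and>
     (\<exists>Q0 Q1 \<eta> \<epsilon>. lin_dagger_functor L K Q0 Q1 \<and>
        nat_family K K id id (Q0 \<circ> P0) (Q1 \<circ> P1) \<eta> \<and> (\<forall>a\<in>cob K. cunitary K (\<eta> a)) \<and>
        nat_family L L (P0 \<circ> Q0) (P1 \<circ> Q1) id id \<epsilon> \<and> (\<forall>b\<in>cob L. cunitary L (\<epsilon> b)))"

definition isometric_equivalence_2Hilb ::
  "('o, 'a, 'y) tr_cat_scheme \<Rightarrow> ('p, 'b, 'z) tr_cat_scheme \<Rightarrow> ('o \<Rightarrow> 'p) \<Rightarrow> ('a \<Rightarrow> 'b) \<Rightarrow> bool" where
  "isometric_equivalence_2Hilb K L P0 P1 \<longleftrightarrow> dagger_equivalence K L P0 P1 \<and>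
     (\<forall>c\<in>cob K. \<forall>f\<in>chom K c c. ctr L (P0 c) (P1 f) = ctr K c f)"


section \<open>Dagger 2-categories (weak, with unitary associators and unitors)\<close>

text \<open>\<open>X \<otimes> Y\<close> is the composite of 1-morphisms ``first \<open>X\<close>, then \<open>Y\<close>'',
  and \<open>f \<star> g\<close> the corresponding horizontal composite of 2-morphisms;
  \<open>g \<cdot> f\<close> is the vertical composite ``first \<open>f\<close>, then \<open>g\<close>''.
  \<open>assoc X Y Z : (X \<otimes> Y) \<otimes> Z \<Rightarrow> X \<otimes> (Y \<otimes> Z)\<close>, \<open>lun X : 1 \<otimes> X \<Rightarrow> X\<close>
  and \<open>run X : X \<otimes> 1 \<Rightarrow> X\<close>; their inverses are their daggers.\<close>

record ('o, 'm, 'c) two_cat =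
  Ob :: "'o set"
  OneM :: "'m set"
  TwoM :: "'c set"
  src :: "'m \<Rightarrow> 'o"
  trg :: "'m \<Rightarrow> 'o"
  dom2 :: "'c \<Rightarrow> 'm"
  cod2 :: "'c \<Rightarrow> 'm"
  unit1 :: "'o \<Rightarrow> 'm"
  tensor :: "'m \<Rightarrow> 'm \<Rightarrow> 'm"  (infixr "\<otimes>\<index>" 75)
  id2 :: "'m \<Rightarrow> 'c"
  vcomp :: "'c \<Rightarrow> 'c \<Rightarrow> 'c"  (infixr "\<cdot>\<index>" 70)
  hcomp :: "'c \<Rightarrow> 'c \<Rightarrow> 'c"  (infixr "\<star>\<index>" 75)
  assoc :: "'m \<Rightarrow> 'm \<Rightarrow> 'm \<Rightarrow> 'c"
  lun :: "'m \<Rightarrow> 'c"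
  run :: "'m \<Rightarrow> 'c"
  zero2 :: "'m \<Rightarrow> 'm \<Rightarrow> 'c"
  add2 :: "'c \<Rightarrow> 'c \<Rightarrow> 'c"  (infixl "\<boxplus>\<index>" 65)
  scale2 :: "complex \<Rightarrow> 'c \<Rightarrow> 'c"
  dagger :: "'c \<Rightarrow> 'c"  ("_\<dagger>\<index>" [1000] 999)

context
  fixes C :: "('o, 'm, 'c, 'z) two_cat_scheme" (structure)
begin

definition hom1 :: "'o \<Rightarrow> 'o \<Rightarrow> 'm set" where
  "hom1 a b = {X \<in> OneM C. src C X = a \<and> trg C X = b}"

definition hom2 :: "'m \<Rightarrow> 'm \<Rightarrow> 'c set" where
  "hom2 X Y = {f \<in> TwoM C. dom2 C f = X \<and> cod2 C f = Y}"

definition hom_cat :: "'o \<Rightarrow> 'o \<Rightarrow> ('m, 'c) lin_cat" where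
  "hom_cat a b =
     \<lparr> cob = hom1 a b,
       carr = {f \<in> TwoM C. dom2 C f \<in> hom1 a b \<and> cod2 C f \<in> hom1 a b},
       cdom = dom2 C, ccod = cod2 C, cid = id2 C, ccomp = vcomp C,
       czero = zero2 C, cadd = add2 C, cscale = scale2 C, cdag = dagger C \<rparr>"

definition iso2 :: "'c \<Rightarrow> bool" where
  "iso2 f \<longleftrightarrow> (\<exists>g\<in>hom2 (cod2 C f) (dom2 C f). g \<cdot> f = id2 C (dom2 C f) \<and> f \<cdot> g = id2 C (cod2 C f))"

definition isometric2 :: "'c \<Rightarrow> bool" where
  "isometric2 f \<longleftrightarrow> f\<dagger> \<cdot> f = id2 C (dom2 C f)"

definition unitary2 :: "'c \<Rightarrow> bool" where
  "unitary2 f \<longleftrightarrow> f\<dagger> \<cdot> f = id2 C (dom2 C f) \<and> f \<cdot> f\<dagger> = id2 C (cod2 C f)"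

definition equivalence1 :: "'m \<Rightarrow> bool" where
  "equivalence1 X \<longleftrightarrow> X \<in> OneM C \<and> (\<exists>Y\<in>hom1 (trg C X) (src C X).
     (\<exists>f\<in>hom2 (X \<otimes> Y) (unit1 C (src C X)). iso2 f) \<and>
     (\<exists>g\<in>hom2 (Y \<otimes> X) (unit1 C (trg C X)). iso2 g))"

end

locale dagger_2category =
  fixes C :: "('o, 'm, 'c, 'z) two_cat_scheme" (structure)
  assumes one_obj: "X \<in> OneM C \<Longrightarrow> src C X \<in> Ob C \<and> trg C X \<in> Ob C"
    and two_one: "f \<in> TwoM C \<Longrightarrow> dom2 C f \<in> OneM C \<and> cod2 C f \<in> OneM C \<and>
      src C (cod2 C f) = src C (dom2 C f) \<and> trg C (cod2 C f) = trg C (dom2 C f)"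
    and hom_cat: "a \<in> Ob C \<Longrightarrow> b \<in> Ob C \<Longrightarrow> dagger_category (hom_cat C a b)"
    and unit1_hom: "a \<in> Ob C \<Longrightarrow> unit1 C a \<in> hom1 C a a"
    and tensor_hom: "X \<in> hom1 C a b \<Longrightarrow> Y \<in> hom1 C b c \<Longrightarrow> X \<otimes> Y \<in> hom1 C a c"
    and hcomp_hom: "trg C X = src C Y \<Longrightarrow> f \<in> hom2 C X X' \<Longrightarrow> g \<in> hom2 C Y Y' \<Longrightarrow>
      f \<star> g \<in> hom2 C (X \<otimes> Y) (X' \<otimes> Y')"
    and hcomp_id: "X \<in> hom1 C a b \<Longrightarrow> Y \<in> hom1 C b c \<Longrightarrow> id2 C X \<star> id2 C Y = id2 C (X \<otimes> Y)"
    and interchange: "trg C X = src C Y \<Longrightarrow> f \<in> hom2 C X X' \<Longrightarrow> f' \<in> hom2 C X' X'' \<Longrightarrow>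
      g \<in> hom2 C Y Y' \<Longrightarrow> g' \<in> hom2 C Y' Y'' \<Longrightarrow>
      (f' \<cdot> f) \<star> (g' \<cdot> g) = (f' \<star> g') \<cdot> (f \<star> g)"
    and hcomp_add_left: "trg C X = src C Y \<Longrightarrow> f \<in> hom2 C X X' \<Longrightarrow> f' \<in> hom2 C X X' \<Longrightarrow>
      g \<in> hom2 C Y Y' \<Longrightarrow> (f \<boxplus> f') \<star> g = (f \<star> g) \<boxplus> (f' \<star> g)"
    and hcomp_add_right: "trg C X = src C Y \<Longrightarrow> f \<in> hom2 C X X' \<Longrightarrow> g \<in> hom2 C Y Y' \<Longrightarrow>
      g' \<in> hom2 C Y Y' \<Longrightarrow> f \<star> (g \<boxplus> g') = (f \<star> g) \<boxplus> (f \<star> g')"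
    and hcomp_scale: "trg C X = src C Y \<Longrightarrow> f \<in> hom2 C X X' \<Longrightarrow> g \<in> hom2 C Y Y' \<Longrightarrow>
      scale2 C s f \<star> g = scale2 C s (f \<star> g) \<and> f \<star> scale2 C s g = scale2 C s (f \<star> g)"
    and hcomp_dagger: "trg C X = src C Y \<Longrightarrow> f \<in> hom2 C X X' \<Longrightarrow> g \<in> hom2 C Y Y' \<Longrightarrow>
      (f \<star> g)\<dagger> = f\<dagger> \<star> g\<dagger>"
    and assoc_hom: "X \<in> hom1 C a b \<Longrightarrow> Y \<in> hom1 C b c \<Longrightarrow> Z \<in> hom1 C c d \<Longrightarrow>
      assoc C X Y Z \<in> hom2 C ((X \<otimes> Y) \<otimes> Z) (X \<otimes> (Y \<otimes> Z)) \<and> unitary2 C (assoc C X Y Z)"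
    and lun_hom: "X \<in> hom1 C a b \<Longrightarrow>
      lun C X \<in> hom2 C (unit1 C a \<otimes> X) X \<and> unitary2 C (lun C X)"
    and run_hom: "X \<in> hom1 C a b \<Longrightarrow>
      run C X \<in> hom2 C (X \<otimes> unit1 C b) X \<and> unitary2 C (run C X)"
    and assoc_nat: "trg C X = src C Y \<Longrightarrow> trg C Y = src C Z \<Longrightarrow>
      f \<in> hom2 C X X' \<Longrightarrow> g \<in> hom2 C Y Y' \<Longrightarrow> h \<in> hom2 C Z Z' \<Longrightarrow>
      assoc C X' Y' Z' \<cdot> ((f \<star> g) \<star> h) = (f \<star> (g \<star> h)) \<cdot> assoc C X Y Z"
    and lun_nat: "f \<in> hom2 C X X' \<Longrightarrow>
      lun C X' \<cdot> (id2 C (unit1 C (src C X)) \<star> f) = f \<cdot> lun C X"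
    and run_nat: "f \<in> hom2 C X X' \<Longrightarrow>
      run C X' \<cdot> (f \<star> id2 C (unit1 C (trg C X))) = f \<cdot> run C X"
    and pentagon: "W \<in> hom1 C a b \<Longrightarrow> X \<in> hom1 C b c \<Longrightarrow> Y \<in> hom1 C c d \<Longrightarrow> Z \<in> hom1 C d e \<Longrightarrow>
      (id2 C W \<star> assoc C X Y Z) \<cdot> assoc C W (X \<otimes> Y) Z \<cdot> (assoc C W X Y \<star> id2 C Z)
      = assoc C W X (Y \<otimes> Z) \<cdot> assoc C (W \<otimes> X) Y Z"
    and triangle: "X \<in> hom1 C a b \<Longrightarrow> Y \<in> hom1 C b c \<Longrightarrow>
      (id2 C X \<star> lun C Y) \<cdot> assoc C X (unit1 C b) Y = run C X \<star> id2 C Y"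

definition cstar_2category :: "('o, 'm, 'c, 'z) two_cat_scheme \<Rightarrow> bool" where
  "cstar_2category C \<longleftrightarrow> dagger_2category C \<and>
     (\<forall>a\<in>Ob C. \<forall>b\<in>Ob C. cstar_category (hom_cat C a b))"


section \<open>Adjoints\<close>

context
  fixes C :: "('o, 'm, 'c, 'z) two_cat_scheme" (structure)
begin

text \<open>\<open>Xv\<close> is an adjoint of \<open>X : a \<rightarrow> b\<close> via \<open>e : Xv \<otimes> X \<Rightarrow> 1\<^sub>b\<close>
  and \<open>c : 1\<^sub>a \<Rightarrow> X \<otimes> Xv\<close>.\<close>

definition adjoint1 :: "'m \<Rightarrow> 'm \<Rightarrow> 'c \<Rightarrow> 'c \<Rightarrow> bool" where
  "adjoint1 X Xv e c \<longleftrightarrow> X \<in> OneM C \<and> Xv \<in> hom1 C (trg C X) (src C X) \<and>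
     e \<in> hom2 C (Xv \<otimes> X) (unit1 C (trg C X)) \<and>
     c \<in> hom2 C (unit1 C (src C X)) (X \<otimes> Xv) \<and>
     run C X \<cdot> (id2 C X \<star> e) \<cdot> assoc C X Xv X \<cdot> (c \<star> id2 C X) \<cdot> (lun C X)\<dagger> = id2 C X \<and>
     lun C Xv \<cdot> (e \<star> id2 C Xv) \<cdot> (assoc C Xv X Xv)\<dagger> \<cdot> (id2 C Xv \<star> c) \<cdot> (run C Xv)\<dagger> = id2 C Xv"

text \<open>For \<open>f : X \<Rightarrow> Z\<close>, an adjoint \<open>Zv\<close> of \<open>Z\<close> with evaluation \<open>e\<close> and an adjoint \<open>Xv\<close>
  of \<open>X\<close> with coevaluation \<open>c\<close>, the mate \<open>(e \<otimes> 1)(1 \<otimes> f \<otimes> 1)(1 \<otimes> c) : Zv \<Rightarrow> Xv\<close>.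
  For \<open>f = id\<close> it is the canonical map between two adjoints of the same 1-morphism.\<close>

definition mate :: "'m \<Rightarrow> 'c \<Rightarrow> 'c \<Rightarrow> 'm \<Rightarrow> 'c \<Rightarrow> 'c" where
  "mate Zv e f Xv c =
     lun C Xv \<cdot> (e \<star> id2 C Xv) \<cdot> (assoc C Zv (cod2 C f) Xv)\<dagger> \<cdot>
     (id2 C Zv \<star> ((f \<star> id2 C Xv) \<cdot> c)) \<cdot> (run C Zv)\<dagger>"

end


section \<open>Unitary multitensor categories, linking categories, Drinfeld centers\<close>

text \<open>A tensor category is a 2-category with one object.\<close>

definition unitary_multitensor :: "('o, 'm, 'c, 'z) two_cat_scheme \<Rightarrow> bool" where
  "unitary_multitensor L \<longleftrightarrow> cstar_2category L \<and>
     (\<exists>u. Ob L = {u} \<and> semisimple_cstar (hom_cat L u u)) \<and>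
     (\<forall>X\<in>OneM L. (\<exists>Xv e c. adjoint1 L X Xv e c) \<and> (\<exists>vX e c. adjoint1 L vX X e c))"

definition multifusion :: "('o, 'm, 'c, 'z) two_cat_scheme \<Rightarrow> bool" where
  "multifusion L \<longleftrightarrow> unitary_multitensor L \<and>
     (\<forall>u\<in>Ob L. finitely_semisimple_cstar (hom_cat L u u))"

context
  fixes L :: "('o, 'm, 'c, 'z) two_cat_scheme" (structure)
begin

text \<open>The Drinfeld center of a tensor category: its objects are pairs of a 1-morphism \<open>Z\<close>
  and a half-braiding \<open>\<beta>\<^sub>X : Z \<otimes> X \<Rightarrow> X \<otimes> Z\<close>.\<close>

definition half_braiding :: "'m \<Rightarrow> ('m \<Rightarrow> 'c) \<Rightarrow> bool" where
  "half_braiding Z \<beta> \<longleftrightarrow> Z \<in> OneM L \<and>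
     (\<forall>X\<in>OneM L. \<beta> X \<in> hom2 L (Z \<otimes> X) (X \<otimes> Z) \<and> iso2 L (\<beta> X)) \<and>
     (\<forall>X Y. \<forall>f\<in>hom2 L X Y. \<beta> Y \<cdot> (id2 L Z \<star> f) = (f \<star> id2 L Z) \<cdot> \<beta> X) \<and>
     (\<forall>u\<in>Ob L. \<beta> (unit1 L u) = (lun L Z)\<dagger> \<cdot> run L Z) \<and>
     (\<forall>X\<in>OneM L. \<forall>Y\<in>OneM L. \<beta> (X \<otimes> Y) =
        (assoc L X Y Z)\<dagger> \<cdot> (id2 L X \<star> \<beta> Y) \<cdot> assoc L X Z Y \<cdot> (\<beta> X \<star> id2 L Y) \<cdot> (assoc L Z X Y)\<dagger>)"

definition center_hom :: "'m \<times> ('m \<Rightarrow> 'c) \<Rightarrow> 'm \<times> ('m \<Rightarrow> 'c) \<Rightarrow> 'c set" where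
  "center_hom ZB WG = {f \<in> hom2 L (fst ZB) (fst WG).
     half_braiding (fst ZB) (snd ZB) \<and> half_braiding (fst WG) (snd WG) \<and>
     (\<forall>X\<in>OneM L. snd WG X \<cdot> (f \<star> id2 L X) = (id2 L X \<star> f) \<cdot> snd ZB X)}"

definition center_unit :: "'o \<Rightarrow> 'm \<times> ('m \<Rightarrow> 'c)" where
  "center_unit u = (unit1 L u, \<lambda>X. (run L X)\<dagger> \<cdot> lun L X)"

definition center_end_unit_dim_le :: "nat \<Rightarrow> bool" where
  "center_end_unit_dim_le N \<longleftrightarrow> (\<forall>u\<in>Ob L.
     dim_le (hom_cat L u u) (unit1 L u) (unit1 L u) (center_hom (center_unit u) (center_unit u)) N)"

end

definition mat :: "nat \<Rightarrow> (nat \<Rightarrow> nat \<Rightarrow> 'x) \<Rightarrow> nat \<Rightarrow> nat \<Rightarrow> 'x" where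
  "mat n f = (\<lambda>i j. if i < n \<and> j < n then f i j else undefined)"

text \<open>The linking category of a list \<open>as\<close> of objects, as a tensor category. Since \<open>X \<otimes> Y\<close> is
  ``first \<open>X\<close>, then \<open>Y\<close>'', matrix multiplication reads \<open>(X Y)\<^sub>i\<^sub>k = \<Oplus>\<^sub>j X\<^sub>i\<^sub>j \<otimes> Y\<^sub>j\<^sub>k\<close> when
  the \<open>(i, j)\<close> entry is a 1-morphism \<open>as ! i \<rightarrow> as ! j\<close>; this only transposes the indices
  of the convention in which it is \<open>as ! j \<rightarrow> as ! i\<close>.\<close>

context
  fixes C :: "('o, 'm, 'c, 'z) two_cat_scheme" (structure)
    and as :: "'o list"
begin

definition lk_hom :: "nat \<Rightarrow> nat \<Rightarrow> ('m, 'c) lin_cat" where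
  "lk_hom i j = hom_cat C (as ! i) (as ! j)"

definition lk_tensor :: "(nat \<Rightarrow> nat \<Rightarrow> 'm) \<Rightarrow> (nat \<Rightarrow> nat \<Rightarrow> 'm) \<Rightarrow> nat \<Rightarrow> nat \<Rightarrow> 'm" where
  "lk_tensor X Y = mat (length as)
     (\<lambda>i k. dsum_obj (lk_hom i k) (length as) (\<lambda>j. X i j \<otimes> Y j k))"

definition lk_inc :: "(nat \<Rightarrow> nat \<Rightarrow> 'm) \<Rightarrow> (nat \<Rightarrow> nat \<Rightarrow> 'm) \<Rightarrow> nat \<Rightarrow> nat \<Rightarrow> nat \<Rightarrow> 'c" where
  "lk_inc X Y i k = dsum_inc (lk_hom i k) (length as) (\<lambda>j. X i j \<otimes> Y j k)"

definition lk_unit :: "nat \<Rightarrow> nat \<Rightarrow> 'm" where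
  "lk_unit = mat (length as)
     (\<lambda>i j. if i = j then unit1 C (as ! i) else dsum_obj (lk_hom i j) 0 undefined)"

definition lk_dom :: "(nat \<Rightarrow> nat \<Rightarrow> 'c) \<Rightarrow> nat \<Rightarrow> nat \<Rightarrow> 'm" where
  "lk_dom f = mat (length as) (\<lambda>i j. dom2 C (f i j))"

definition lk_cod :: "(nat \<Rightarrow> nat \<Rightarrow> 'c) \<Rightarrow> nat \<Rightarrow> nat \<Rightarrow> 'm" where
  "lk_cod f = mat (length as) (\<lambda>i j. cod2 C (f i j))"

definition lk_hcomp :: "(nat \<Rightarrow> nat \<Rightarrow> 'c) \<Rightarrow> (nat \<Rightarrow> nat \<Rightarrow> 'c) \<Rightarrow> nat \<Rightarrow> nat \<Rightarrow> 'c" where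
  "lk_hcomp f g = mat (length as) (\<lambda>i k.
     csum (lk_hom i k) (lk_tensor (lk_dom f) (lk_dom g) i k) (lk_tensor (lk_cod f) (lk_cod g) i k)
       (\<lambda>j. lk_inc (lk_cod f) (lk_cod g) i k j \<cdot> (f i j \<star> g j k) \<cdot> (lk_inc (lk_dom f) (lk_dom g) i k j)\<dagger>)
       (length as))"

definition lk_assoc ::
  "(nat \<Rightarrow> nat \<Rightarrow> 'm) \<Rightarrow> (nat \<Rightarrow> nat \<Rightarrow> 'm) \<Rightarrow> (nat \<Rightarrow> nat \<Rightarrow> 'm) \<Rightarrow> nat \<Rightarrow> nat \<Rightarrow> 'c" where
  "lk_assoc X Y Z = mat (length as) (\<lambda>i l.
     let s = lk_tensor (lk_tensor X Y) Z i l; t = lk_tensor X (lk_tensor Y Z) i l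
     in csum (lk_hom i l) s t (\<lambda>j. csum (lk_hom i l) s t (\<lambda>k.
          lk_inc X (lk_tensor Y Z) i l j \<cdot> (id2 C (X i j) \<star> lk_inc Y Z j l k) \<cdot>
          assoc C (X i j) (Y j k) (Z k l) \<cdot>
          ((lk_inc X Y i k j)\<dagger> \<star> id2 C (Z k l)) \<cdot> (lk_inc (lk_tensor X Y) Z i l k)\<dagger>)
        (length as)) (length as))"

definition linking :: "(unit, nat \<Rightarrow> nat \<Rightarrow> 'm, nat \<Rightarrow> nat \<Rightarrow> 'c) two_cat" where
  "linking =
     \<lparr> Ob = {()},
       OneM = {X. X = mat (length as) X \<and>
                  (\<forall>i<length as. \<forall>j<length as. X i j \<in> hom1 C (as ! i) (as ! j))},
       TwoM = {f. f = mat (length as) f \<and>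
                  (\<forall>i<length as. \<forall>j<length as. f i j \<in> carr (lk_hom i j))},
       src = (\<lambda>_. ()), trg = (\<lambda>_. ()),
       dom2 = lk_dom, cod2 = lk_cod,
       unit1 = (\<lambda>_. lk_unit),
       tensor = lk_tensor,
       id2 = (\<lambda>X. mat (length as) (\<lambda>i j. id2 C (X i j))),
       vcomp = (\<lambda>g f. mat (length as) (\<lambda>i j. g i j \<cdot> f i j)),
       hcomp = lk_hcomp,
       assoc = lk_assoc,
       lun = (\<lambda>X. mat (length as) (\<lambda>i k. lun C (X i k) \<cdot> (lk_inc lk_unit X i k i)\<dagger>)),
       run = (\<lambda>X. mat (length as) (\<lambda>i k. run C (X i k) \<cdot> (lk_inc X lk_unit i k k)\<dagger>)),
       zero2 = (\<lambda>X Y. mat (length as) (\<lambda>i j. zero2 C (X i j) (Y i j))),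
       add2 = (\<lambda>f g. mat (length as) (\<lambda>i j. f i j \<boxplus> g i j)),
       scale2 = (\<lambda>s f. mat (length as) (\<lambda>i j. scale2 C s (f i j))),
       dagger = (\<lambda>f. mat (length as) (\<lambda>i j. (f i j)\<dagger>)) \<rparr>"

end

text \<open>The existence of direct sums of parallel 1-morphisms is what makes matrix multiplication
  in the linking categories meaningful.\<close>

definition unitary_2category :: "('o, 'm, 'c, 'z) two_cat_scheme \<Rightarrow> bool" where
  "unitary_2category C \<longleftrightarrow> cstar_2category C \<and>
     (\<forall>a\<in>Ob C. \<forall>b\<in>Ob C. has_orth_dsums (hom_cat C a b)) \<and>
     (\<forall>as. as \<noteq> [] \<and> set as \<subseteq> Ob C \<longrightarrow> unitary_multitensor (linking C as))"

definition finite_unitary_2category :: "('o, 'm, 'c, 'z) two_cat_scheme \<Rightarrow> bool" where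
  "finite_unitary_2category C \<longleftrightarrow> unitary_2category C \<and>
     (\<forall>as. as \<noteq> [] \<and> set as \<subseteq> Ob C \<longrightarrow> multifusion (linking C as)) \<and>
     (\<exists>N. \<forall>as. as \<noteq> [] \<and> set as \<subseteq> Ob C \<longrightarrow> center_end_unit_dim_le (linking C as) N)"


section \<open>Pre-3-Hilbert spaces and 3-Hilbert spaces\<close>

record ('o, 'm, 'c) pre3 = "('o, 'm, 'c) two_cat" +
  dual :: "'m \<Rightarrow> 'm"
  ev :: "'m \<Rightarrow> 'c"
  coev :: "'m \<Rightarrow> 'c"
  weight :: "'o \<Rightarrow> 'c \<Rightarrow> complex"

context
  fixes C :: "('o, 'm, 'c, 'z) pre3_scheme" (structure)
begin

definition dual2 :: "'c \<Rightarrow> 'c" where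
  "dual2 f = mate C (dual C (cod2 C f)) (ev C (cod2 C f)) f (dual C (dom2 C f)) (coev C (dom2 C f))"

text \<open>For \<open>Y : a \<rightarrow> b\<close> and \<open>X : b \<rightarrow> c\<close>, the evaluation
  \<open>(X\<^sup>\<or> \<otimes> Y\<^sup>\<or>) \<otimes> (Y \<otimes> X) \<Rightarrow> 1\<^sub>c\<close> and the canonical map \<open>X\<^sup>\<or> \<otimes> Y\<^sup>\<or> \<Rightarrow> (Y \<otimes> X)\<^sup>\<or>\<close>.\<close>

definition ev_tensor :: "'m \<Rightarrow> 'm \<Rightarrow> 'c" where
  "ev_tensor Y X =
     ev C X \<cdot> (id2 C (dual C X) \<star> lun C X) \<cdot> (id2 C (dual C X) \<star> (ev C Y \<star> id2 C X)) \<cdot>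
     (id2 C (dual C X) \<star> (assoc C (dual C Y) Y X)\<dagger>) \<cdot> assoc C (dual C X) (dual C Y) (Y \<otimes> X)"

definition dual_tensor :: "'m \<Rightarrow> 'm \<Rightarrow> 'c" where
  "dual_tensor Y X =
     mate C (dual C X \<otimes> dual C Y) (ev_tensor Y X) (id2 C (Y \<otimes> X)) (dual C (Y \<otimes> X)) (coev C (Y \<otimes> X))"

definition dual_unit :: "'o \<Rightarrow> 'c" where
  "dual_unit a = ev C (unit1 C a) \<cdot> (run C (dual C (unit1 C a)))\<dagger>"

definition unitary_adjoint_functor :: bool where
  "unitary_adjoint_functor \<longleftrightarrow>
     (\<forall>X\<in>OneM C. adjoint1 C X (dual C X) (ev C X) (coev C X)) \<and>
     (\<forall>a\<in>Ob C. unitary2 C (dual_unit a)) \<and>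
     (\<forall>a b c. \<forall>Y\<in>hom1 C a b. \<forall>X\<in>hom1 C b c. unitary2 C (dual_tensor Y X)) \<and>
     (\<forall>f\<in>TwoM C. (dual2 f)\<dagger> = dual2 (f\<dagger>))"

definition Tr :: "'m \<Rightarrow> 'c \<Rightarrow> complex" where
  "Tr X f = weight C (src C X) ((coev C X)\<dagger> \<cdot> (f \<star> id2 C (dual C X)) \<cdot> coev C X)"

definition faithful_positive_functional :: "'o \<Rightarrow> bool" where
  "faithful_positive_functional a \<longleftrightarrow> (let E = hom2 C (unit1 C a) (unit1 C a); \<psi> = weight C a in
     (\<forall>f\<in>E. \<forall>g\<in>E. \<psi> (f \<boxplus> g) = \<psi> f + \<psi> g) \<and>
     (\<forall>f\<in>E. \<forall>s. \<psi> (scale2 C s f) = s * \<psi> f) \<and>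
     (\<forall>f\<in>E. \<psi> (f\<dagger> \<cdot> f) \<in> \<real> \<and> Re (\<psi> (f\<dagger> \<cdot> f)) \<ge> 0) \<and>
     (\<forall>f\<in>E. \<psi> (f\<dagger> \<cdot> f) = 0 \<longrightarrow> f = zero2 C (unit1 C a) (unit1 C a)))"

definition spherical_weight :: bool where
  "spherical_weight \<longleftrightarrow> (\<forall>a\<in>Ob C. faithful_positive_functional a) \<and>
     (\<forall>a b. \<forall>X\<in>hom1 C a b. \<forall>f\<in>hom2 C X X.
        weight C a ((coev C X)\<dagger> \<cdot> (f \<star> id2 C (dual C X)) \<cdot> coev C X) =
        weight C b (ev C X \<cdot> (id2 C (dual C X) \<star> f) \<cdot> (ev C X)\<dagger>))"

definition pre_three_hilbert :: bool where
  "pre_three_hilbert \<longleftrightarrow> finite_unitary_2category C \<and> unitary_adjoint_functor \<and> spherical_weight"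

text \<open>The hom category \<open>C(a \<rightarrow> b)\<close> with its traces, a 2-Hilbert space when \<open>C\<close> is a pre-3-Hilbert space.\<close>

definition hom_2Hilb :: "'o \<Rightarrow> 'o \<Rightarrow> ('m, 'c) tr_cat" where
  "hom_2Hilb a b = lin_cat.extend (hom_cat C a b) \<lparr> ctr = Tr \<rparr>"

definition isometry1 :: "'m \<Rightarrow> bool" where
  "isometry1 X \<longleftrightarrow> X \<in> OneM C \<and> unitary2 C (coev C X) \<and> isometric2 C (ev C X)"

definition isometric_equivalence1 :: "'m \<Rightarrow> bool" where
  "isometric_equivalence1 X \<longleftrightarrow> X \<in> OneM C \<and> unitary2 C (coev C X) \<and> unitary2 C (ev C X)"

definition hilbert_dsum :: "'o \<Rightarrow> 'o \<Rightarrow> 'o \<Rightarrow> 'm \<Rightarrow> 'm \<Rightarrow> bool" where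
  "hilbert_dsum a b s I J \<longleftrightarrow> s \<in> Ob C \<and> I \<in> hom1 C a s \<and> J \<in> hom1 C b s \<and> isometry1 I \<and> isometry1 J \<and>
     (ev C I \<cdot> (ev C I)\<dagger>) \<boxplus> (ev C J \<cdot> (ev C J)\<dagger>) = id2 C (unit1 C s)"

text \<open>The empty Hilbert direct sum is an object \<open>z\<close> with \<open>id = 0\<close> in \<open>End(1\<^sub>z)\<close>.\<close>

definition has_hilbert_dsums :: bool where
  "has_hilbert_dsums \<longleftrightarrow>
     (\<exists>z\<in>Ob C. id2 C (unit1 C z) = zero2 C (unit1 C z) (unit1 C z)) \<and>
     (\<forall>a\<in>Ob C. \<forall>b\<in>Ob C. \<exists>s I J. hilbert_dsum a b s I J)"

definition algebra1 :: "'o \<Rightarrow> 'm \<Rightarrow> 'c \<Rightarrow> 'c \<Rightarrow> bool" where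
  "algebra1 a A \<mu> \<iota> \<longleftrightarrow> a \<in> Ob C \<and> A \<in> hom1 C a a \<and>
     \<mu> \<in> hom2 C (A \<otimes> A) A \<and> \<iota> \<in> hom2 C (unit1 C a) A \<and>
     \<mu> \<cdot> (\<mu> \<star> id2 C A) = \<mu> \<cdot> (id2 C A \<star> \<mu>) \<cdot> assoc C A A A \<and>
     \<mu> \<cdot> (\<iota> \<star> id2 C A) = lun C A \<and> \<mu> \<cdot> (id2 C A \<star> \<iota>) = run C A"

text \<open>The second and third line express that \<open>\<mu>\<^sup>\<dagger> : A \<Rightarrow> A \<otimes> A\<close> is a left and a right module map.\<close>

definition Hstar_monad :: "'o \<Rightarrow> 'm \<Rightarrow> 'c \<Rightarrow> 'c \<Rightarrow> bool" where
  "Hstar_monad a A \<mu> \<iota> \<longleftrightarrow> algebra1 a A \<mu> \<iota> \<and>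
     \<mu>\<dagger> \<cdot> \<mu> = (\<mu> \<star> id2 C A) \<cdot> (assoc C A A A)\<dagger> \<cdot> (id2 C A \<star> \<mu>\<dagger>) \<and>
     \<mu>\<dagger> \<cdot> \<mu> = (id2 C A \<star> \<mu>) \<cdot> assoc C A A A \<cdot> (\<mu>\<dagger> \<star> id2 C A) \<and>
     iso2 C (\<mu> \<cdot> \<mu>\<dagger>) \<and>
     (\<forall>f\<in>hom2 C A A.
        weight C a (\<iota>\<dagger> \<cdot> \<mu> \<cdot> (id2 C A \<star> f) \<cdot> \<mu>\<dagger> \<cdot> \<iota>) =
        weight C a (\<iota>\<dagger> \<cdot> \<mu> \<cdot> (f \<star> id2 C A) \<cdot> \<mu>\<dagger> \<cdot> \<iota>))"

text \<open>The multiplication \<open>1 \<otimes> ev \<otimes> 1\<close> of the algebra \<open>X \<otimes> X\<^sup>\<or>\<close>, whose unit is \<open>coev\<close>.\<close>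

definition pair_mult :: "'m \<Rightarrow> 'c" where
  "pair_mult X =
     (id2 C X \<star> lun C (dual C X)) \<cdot> (id2 C X \<star> (ev C X \<star> id2 C (dual C X))) \<cdot>
     (id2 C X \<star> (assoc C (dual C X) X (dual C X))\<dagger>) \<cdot> assoc C X (dual C X) (X \<otimes> dual C X)"

definition monad_splits :: "'o \<Rightarrow> 'm \<Rightarrow> 'c \<Rightarrow> 'c \<Rightarrow> bool" where
  "monad_splits a A \<mu> \<iota> \<longleftrightarrow> (\<exists>b\<in>Ob C. \<exists>X\<in>hom1 C a b. iso2 C (ev C X \<cdot> (ev C X)\<dagger>) \<and>
     (\<exists>\<theta>\<in>hom2 C A (X \<otimes> dual C X). unitary2 C \<theta> \<and>
        \<theta> \<cdot> \<mu> = pair_mult X \<cdot> (\<theta> \<star> \<theta>) \<and> \<theta> \<cdot> \<iota> = coev C X))"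

definition three_hilbert :: bool where
  "three_hilbert \<longleftrightarrow> pre_three_hilbert \<and> has_hilbert_dsums \<and>
     (\<forall>a A \<mu> \<iota>. Hstar_monad a A \<mu> \<iota> \<longrightarrow> monad_splits a A \<mu> \<iota>)"

definition simple_object :: "'o \<Rightarrow> bool" where
  "simple_object a \<longleftrightarrow> a \<in> Ob C \<and> simple_obj (hom_cat C a a) (unit1 C a)"

definition same_component :: "'o \<Rightarrow> 'o \<Rightarrow> bool" where
  "same_component a b \<longleftrightarrow> (\<exists>X\<in>hom1 C a b. id2 C X \<noteq> zero2 C X X)"

definition is_ONB :: "'o set \<Rightarrow> bool" where
  "is_ONB B \<longleftrightarrow> (\<forall>b\<in>B. simple_object b) \<and>
     (\<forall>a. simple_object a \<longrightarrow> (\<exists>!b. b \<in> B \<and> same_component a b))"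

definition ONB :: "'o set" where
  "ONB = (SOME B. is_ONB B)"

definition obj_dim :: "'o \<Rightarrow> complex" where
  "obj_dim b = weight C b (id2 C (unit1 C b))"

definition global_dim :: "'o \<Rightarrow> complex" where
  "global_dim b = (\<Sum>X\<in>Irr (hom_cat C b b). (Tr X (id2 C X))\<^sup>2)"

end


section \<open>2-functors, 2-natural transformations, modifications\<close>

text \<open>\<open>ften F X Y : F(X) \<otimes> F(Y) \<Rightarrow> F(X \<otimes> Y)\<close> and \<open>funit F a : 1 \<Rightarrow> F(1\<^sub>a)\<close>.\<close>

record ('o, 'm, 'c, 'p, 'n, 'd) two_fun =
  fob :: "'o \<Rightarrow> 'p"
  fmor :: "'m \<Rightarrow> 'n"
  fcell :: "'c \<Rightarrow> 'd"
  ften :: "'m \<Rightarrow> 'm \<Rightarrow> 'd"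
  funit :: "'o \<Rightarrow> 'd"

locale two_functor =
  fixes C :: "('o, 'm, 'c, 'y) two_cat_scheme"
    and D :: "('p, 'n, 'd, 'z) two_cat_scheme" (structure)
    and F :: "('o, 'm, 'c, 'p, 'n, 'd) two_fun"
  assumes fob_in: "a \<in> Ob C \<Longrightarrow> fob F a \<in> Ob D"
    and hom_functor: "a \<in> Ob C \<Longrightarrow> b \<in> Ob C \<Longrightarrow>
      cat_functor (hom_cat C a b) (hom_cat D (fob F a) (fob F b)) (fmor F) (fcell F)"
    and ften_hom: "X \<in> hom1 C a b \<Longrightarrow> Y \<in> hom1 C b c \<Longrightarrow>
      ften F X Y \<in> hom2 D (fmor F X \<otimes> fmor F Y) (fmor F (X \<otimes>\<^bsub>C\<^esub> Y)) \<and> iso2 D (ften F X Y)"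
    and funit_hom: "a \<in> Ob C \<Longrightarrow>
      funit F a \<in> hom2 D (unit1 D (fob F a)) (fmor F (unit1 C a)) \<and> iso2 D (funit F a)"
    and ften_nat: "trg C X = src C Y \<Longrightarrow> f \<in> hom2 C X X' \<Longrightarrow> g \<in> hom2 C Y Y' \<Longrightarrow>
      ften F X' Y' \<cdot> (fcell F f \<star> fcell F g) = fcell F (f \<star>\<^bsub>C\<^esub> g) \<cdot> ften F X Y"
    and ften_assoc: "X \<in> hom1 C a b \<Longrightarrow> Y \<in> hom1 C b c \<Longrightarrow> Z \<in> hom1 C c d \<Longrightarrow>
      fcell F (assoc C X Y Z) \<cdot> ften F (X \<otimes>\<^bsub>C\<^esub> Y) Z \<cdot> (ften F X Y \<star> id2 D (fmor F Z)) =
      ften F X (Y \<otimes>\<^bsub>C\<^esub> Z) \<cdot> (id2 D (fmor F X) \<star> ften F Y Z) \<cdot>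
      assoc D (fmor F X) (fmor F Y) (fmor F Z)"
    and ften_lun: "X \<in> hom1 C a b \<Longrightarrow>
      fcell F (lun C X) \<cdot> ften F (unit1 C a) X \<cdot> (funit F a \<star> id2 D (fmor F X)) = lun D (fmor F X)"
    and ften_run: "X \<in> hom1 C a b \<Longrightarrow>
      fcell F (run C X) \<cdot> ften F X (unit1 C b) \<cdot> (id2 D (fmor F X) \<star> funit F b) = run D (fmor F X)"

definition dagger_2functor ::
  "('o, 'm, 'c, 'y) two_cat_scheme \<Rightarrow> ('p, 'n, 'd, 'z) two_cat_scheme \<Rightarrow>
   ('o, 'm, 'c, 'p, 'n, 'd) two_fun \<Rightarrow> bool" where
  "dagger_2functor C D F \<longleftrightarrow> two_functor C D F \<and>
     (\<forall>a\<in>Ob C. \<forall>b\<in>Ob C.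
        lin_dagger_functor (hom_cat C a b) (hom_cat D (fob F a) (fob F b)) (fmor F) (fcell F)) \<and>
     (\<forall>a b c. \<forall>X\<in>hom1 C a b. \<forall>Y\<in>hom1 C b c. unitary2 D (ften F X Y)) \<and>
     (\<forall>a\<in>Ob C. unitary2 D (funit F a))"

definition two_fun_extensional ::
  "('o, 'm, 'c, 'y) two_cat_scheme \<Rightarrow> ('o, 'm, 'c, 'p, 'n, 'd) two_fun \<Rightarrow> bool" where
  "two_fun_extensional C F \<longleftrightarrow>
     fob F \<in> extensional (Ob C) \<and> fmor F \<in> extensional (OneM C) \<and> fcell F \<in> extensional (TwoM C) \<and>
     (\<forall>X Y. \<not> (X \<in> OneM C \<and> Y \<in> OneM C \<and> trg C X = src C Y) \<longrightarrow> ften F X Y = undefined) \<and>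
     funit F \<in> extensional (Ob C)"

definition id_fun :: "('o, 'm, 'c, 'z) two_cat_scheme \<Rightarrow> ('o, 'm, 'c, 'o, 'm, 'c) two_fun" where
  "id_fun C =
     \<lparr> fob = (\<lambda>a\<in>Ob C. a), fmor = (\<lambda>X\<in>OneM C. X), fcell = (\<lambda>f\<in>TwoM C. f),
       ften = (\<lambda>X Y. if X \<in> OneM C \<and> Y \<in> OneM C \<and> trg C X = src C Y
                     then id2 C (X \<otimes>\<^bsub>C\<^esub> Y) else undefined),
       funit = (\<lambda>a\<in>Ob C. id2 C (unit1 C a)) \<rparr>"

text \<open>\<open>comp_fun C E G F\<close> is \<open>G \<circ> F : C \<rightarrow> E\<close>.\<close>

definition comp_fun ::
  "('o, 'm, 'c, 'y) two_cat_scheme \<Rightarrow> ('q, 'k, 'e, 'z) two_cat_scheme \<Rightarrow>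
   ('p, 'n, 'd, 'q, 'k, 'e) two_fun \<Rightarrow> ('o, 'm, 'c, 'p, 'n, 'd) two_fun \<Rightarrow>
   ('o, 'm, 'c, 'q, 'k, 'e) two_fun" where
  "comp_fun C E G F =
     \<lparr> fob = (\<lambda>a\<in>Ob C. fob G (fob F a)),
       fmor = (\<lambda>X\<in>OneM C. fmor G (fmor F X)),
       fcell = (\<lambda>f\<in>TwoM C. fcell G (fcell F f)),
       ften = (\<lambda>X Y. if X \<in> OneM C \<and> Y \<in> OneM C \<and> trg C X = src C Y
                     then fcell G (ften F X Y) \<cdot>\<^bsub>E\<^esub> ften G (fmor F X) (fmor F Y) else undefined),
       funit = (\<lambda>a\<in>Ob C. fcell G (funit F a) \<cdot>\<^bsub>E\<^esub> funit G (fob F a)) \<rparr>"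

text \<open>\<open>nnat \<alpha> X : F(X) \<otimes> \<alpha>\<^sub>b \<Rightarrow> \<alpha>\<^sub>a \<otimes> G(X)\<close> for \<open>X : a \<rightarrow> b\<close>,
  where \<open>F = nsrc \<alpha>\<close>, \<open>G = ntrg \<alpha>\<close>.\<close>

record ('o, 'm, 'c, 'p, 'n, 'd) two_nat =
  nsrc :: "('o, 'm, 'c, 'p, 'n, 'd) two_fun"
  ntrg :: "('o, 'm, 'c, 'p, 'n, 'd) two_fun"
  ncomp :: "'o \<Rightarrow> 'n"
  nnat :: "'m \<Rightarrow> 'd"

locale two_transformation =
  fixes C :: "('o, 'm, 'c, 'y) two_cat_scheme"
    and D :: "('p, 'n, 'd, 'z) two_cat_scheme" (structure)
    and F :: "('o, 'm, 'c, 'p, 'n, 'd) two_fun"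
    and G :: "('o, 'm, 'c, 'p, 'n, 'd) two_fun"
    and c :: "'o \<Rightarrow> 'n"
    and \<alpha> :: "'m \<Rightarrow> 'd"
  assumes comp_hom: "a \<in> Ob C \<Longrightarrow> c a \<in> hom1 D (fob F a) (fob G a)"
    and nat_hom: "X \<in> hom1 C a b \<Longrightarrow>
      \<alpha> X \<in> hom2 D (fmor F X \<otimes> c b) (c a \<otimes> fmor G X) \<and> iso2 D (\<alpha> X)"
    and nat_cell: "X \<in> hom1 C a b \<Longrightarrow> f \<in> hom2 C X X' \<Longrightarrow>
      \<alpha> X' \<cdot> (fcell F f \<star> id2 D (c b)) = (id2 D (c a) \<star> fcell G f) \<cdot> \<alpha> X"
    and nat_unit: "a \<in> Ob C \<Longrightarrow>
      \<alpha> (unit1 C a) \<cdot> (funit F a \<star> id2 D (c a)) =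
      (id2 D (c a) \<star> funit G a) \<cdot> (run D (c a))\<dagger> \<cdot> lun D (c a)"
    and nat_tensor: "X \<in> hom1 C a b \<Longrightarrow> Y \<in> hom1 C b e \<Longrightarrow>
      \<alpha> (X \<otimes>\<^bsub>C\<^esub> Y) \<cdot> (ften F X Y \<star> id2 D (c e)) =
      (id2 D (c a) \<star> ften G X Y) \<cdot> assoc D (c a) (fmor G X) (fmor G Y) \<cdot>
      (\<alpha> X \<star> id2 D (fmor G Y)) \<cdot> (assoc D (fmor F X) (c b) (fmor G Y))\<dagger> \<cdot>
      (id2 D (fmor F X) \<star> \<alpha> Y) \<cdot> assoc D (fmor F X) (fmor F Y) (c e)"

text \<open>An equivalence of 2-categories, forgetting daggers and weights: there is a 2-functor in the
  other direction which is inverse up to pseudonatural equivalence.\<close>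

definition equivalence_2cat ::
  "('o, 'm, 'c, 'y) two_cat_scheme \<Rightarrow> ('p, 'n, 'd, 'z) two_cat_scheme \<Rightarrow>
   ('o, 'm, 'c, 'p, 'n, 'd) two_fun \<Rightarrow> bool" where
  "equivalence_2cat C D F \<longleftrightarrow> two_functor C D F \<and>
     (\<exists>G. two_functor D C G \<and>
        (\<exists>c \<alpha>. two_transformation C C (id_fun C) (comp_fun C C G F) c \<alpha> \<and>
           (\<forall>a\<in>Ob C. equivalence1 C (c a))) \<and>
        (\<exists>c \<alpha>. two_transformation D D (comp_fun D D F G) (id_fun D) c \<alpha> \<and>
           (\<forall>b\<in>Ob D. equivalence1 D (c b))))"

record ('o, 'm, 'c, 'p, 'n, 'd) modif =
  msrc :: "('o, 'm, 'c, 'p, 'n, 'd) two_nat"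
  mtrg :: "('o, 'm, 'c, 'p, 'n, 'd) two_nat"
  mcomp :: "'o \<Rightarrow> 'd"


section \<open>The 3-Hilbert space of 1-morphisms between two 3-Hilbert spaces\<close>

context
  fixes C :: "('o, 'm, 'c) pre3"
    and D :: "('p, 'n, 'd) pre3" (structure)
begin

text \<open>The canonical map \<open>F(X\<^sup>\<or>) \<Rightarrow> F(X)\<^sup>\<or>\<close>.\<close>

definition dual_comparison :: "('o, 'm, 'c, 'p, 'n, 'd) two_fun \<Rightarrow> 'm \<Rightarrow> 'd" where
  "dual_comparison F X =
     mate D (fmor F (dual C X)) ((funit F (trg C X))\<dagger> \<cdot> fcell F (ev C X) \<cdot> ften F (dual C X) X)
       (id2 D (fmor F X)) (dual D (fmor F X)) (coev D (fmor F X))"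

definition Hom_Ob :: "('o, 'm, 'c, 'p, 'n, 'd) two_fun set" where
  "Hom_Ob = {F. dagger_2functor C D F \<and> two_fun_extensional C F \<and>
     (\<forall>X\<in>OneM C. unitary2 D (dual_comparison F X))}"

definition Hom_OneM :: "('o, 'm, 'c, 'p, 'n, 'd) two_nat set" where
  "Hom_OneM = {\<alpha>. nsrc \<alpha> \<in> Hom_Ob \<and> ntrg \<alpha> \<in> Hom_Ob \<and>
     two_transformation C D (nsrc \<alpha>) (ntrg \<alpha>) (ncomp \<alpha>) (nnat \<alpha>) \<and>
     (\<forall>X\<in>OneM C. unitary2 D (nnat \<alpha> X)) \<and>
     ncomp \<alpha> \<in> extensional (Ob C) \<and> nnat \<alpha> \<in> extensional (OneM C)}"

definition Hom_TwoM :: "('o, 'm, 'c, 'p, 'n, 'd) modif set" where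
  "Hom_TwoM = {m. msrc m \<in> Hom_OneM \<and> mtrg m \<in> Hom_OneM \<and>
     nsrc (mtrg m) = nsrc (msrc m) \<and> ntrg (mtrg m) = ntrg (msrc m) \<and>
     mcomp m \<in> extensional (Ob C) \<and>
     (\<forall>a\<in>Ob C. mcomp m a \<in> hom2 D (ncomp (msrc m) a) (ncomp (mtrg m) a)) \<and>
     (\<forall>a b. \<forall>X\<in>hom1 C a b.
        nnat (mtrg m) X \<cdot> (id2 D (fmor (nsrc (msrc m)) X) \<star> mcomp m b) =
        (mcomp m a \<star> id2 D (fmor (ntrg (msrc m)) X)) \<cdot> nnat (msrc m) X)}"

definition Hom_unit1 :: "('o, 'm, 'c, 'p, 'n, 'd) two_fun \<Rightarrow> ('o, 'm, 'c, 'p, 'n, 'd) two_nat" where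
  "Hom_unit1 F =
     \<lparr> nsrc = F, ntrg = F,
       ncomp = (\<lambda>a\<in>Ob C. unit1 D (fob F a)),
       nnat = (\<lambda>X\<in>OneM C. (lun D (fmor F X))\<dagger> \<cdot> run D (fmor F X)) \<rparr>"

definition Hom_tensor ::
  "('o, 'm, 'c, 'p, 'n, 'd) two_nat \<Rightarrow> ('o, 'm, 'c, 'p, 'n, 'd) two_nat \<Rightarrow>
   ('o, 'm, 'c, 'p, 'n, 'd) two_nat" where
  "Hom_tensor \<alpha> \<beta> =
     \<lparr> nsrc = nsrc \<alpha>, ntrg = ntrg \<beta>,
       ncomp = (\<lambda>a\<in>Ob C. ncomp \<alpha> a \<otimes> ncomp \<beta> a),
       nnat = (\<lambda>X\<in>OneM C. let a = src C X; b = trg C X in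
         (assoc D (ncomp \<alpha> a) (ncomp \<beta> a) (fmor (ntrg \<beta>) X))\<dagger> \<cdot>
         (id2 D (ncomp \<alpha> a) \<star> nnat \<beta> X) \<cdot>
         assoc D (ncomp \<alpha> a) (fmor (ntrg \<alpha>) X) (ncomp \<beta> b) \<cdot>
         (nnat \<alpha> X \<star> id2 D (ncomp \<beta> b)) \<cdot>
         (assoc D (fmor (nsrc \<alpha>) X) (ncomp \<alpha> b) (ncomp \<beta> b))\<dagger>) \<rparr>"

text \<open>The naturator of \<open>\<alpha>\<^sup>\<or> : G \<Rightarrow> F\<close> is the dagger of
  \<open>(ev \<otimes> 1)(1 \<otimes> \<alpha>\<^sub>X \<otimes> 1)(1 \<otimes> coev) : \<alpha>\<^sub>a\<^sup>\<or> \<otimes> F(X) \<Rightarrow> G(X) \<otimes> \<alpha>\<^sub>b\<^sup>\<or>\<close>.\<close>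

definition Hom_dual :: "('o, 'm, 'c, 'p, 'n, 'd) two_nat \<Rightarrow> ('o, 'm, 'c, 'p, 'n, 'd) two_nat" where
  "Hom_dual \<alpha> =
     \<lparr> nsrc = ntrg \<alpha>, ntrg = nsrc \<alpha>,
       ncomp = (\<lambda>a\<in>Ob C. dual D (ncomp \<alpha> a)),
       nnat = (\<lambda>X\<in>OneM C.
         let A = ncomp \<alpha> (src C X); B = ncomp \<alpha> (trg C X); FX = fmor (nsrc \<alpha>) X; GX = fmor (ntrg \<alpha>) X;
             Av = dual D A; Bv = dual D B in
         (lun D (GX \<otimes> Bv) \<cdot> (ev D A \<star> id2 D (GX \<otimes> Bv)) \<cdot> (assoc D Av A (GX \<otimes> Bv))\<dagger> \<cdot>
          (id2 D Av \<star> assoc D A GX Bv) \<cdot> (id2 D Av \<star> (nnat \<alpha> X \<star> id2 D Bv)) \<cdot>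
          (id2 D Av \<star> (assoc D FX B Bv)\<dagger>) \<cdot> (id2 D Av \<star> (id2 D FX \<star> coev D B)) \<cdot>
          (id2 D Av \<star> (run D FX)\<dagger>))\<dagger>) \<rparr>"

definition Hom3 ::
  "(('o, 'm, 'c, 'p, 'n, 'd) two_fun, ('o, 'm, 'c, 'p, 'n, 'd) two_nat, ('o, 'm, 'c, 'p, 'n, 'd) modif) pre3" where
  "Hom3 =
     \<lparr> Ob = Hom_Ob, OneM = Hom_OneM, TwoM = Hom_TwoM,
       src = nsrc, trg = ntrg, dom2 = msrc, cod2 = mtrg,
       unit1 = Hom_unit1,
       tensor = Hom_tensor,
       id2 = (\<lambda>\<alpha>. \<lparr> msrc = \<alpha>, mtrg = \<alpha>, mcomp = (\<lambda>a\<in>Ob C. id2 D (ncomp \<alpha> a)) \<rparr>),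
       vcomp = (\<lambda>n m. \<lparr> msrc = msrc m, mtrg = mtrg n, mcomp = (\<lambda>a\<in>Ob C. mcomp n a \<cdot> mcomp m a) \<rparr>),
       hcomp = (\<lambda>m n. \<lparr> msrc = Hom_tensor (msrc m) (msrc n), mtrg = Hom_tensor (mtrg m) (mtrg n),
                        mcomp = (\<lambda>a\<in>Ob C. mcomp m a \<star> mcomp n a) \<rparr>),
       assoc = (\<lambda>\<alpha> \<beta> \<gamma>. \<lparr> msrc = Hom_tensor (Hom_tensor \<alpha> \<beta>) \<gamma>, mtrg = Hom_tensor \<alpha> (Hom_tensor \<beta> \<gamma>),
                          mcomp = (\<lambda>a\<in>Ob C. assoc D (ncomp \<alpha> a) (ncomp \<beta> a) (ncomp \<gamma> a)) \<rparr>),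
       lun = (\<lambda>\<alpha>. \<lparr> msrc = Hom_tensor (Hom_unit1 (nsrc \<alpha>)) \<alpha>, mtrg = \<alpha>,
                    mcomp = (\<lambda>a\<in>Ob C. lun D (ncomp \<alpha> a)) \<rparr>),
       run = (\<lambda>\<alpha>. \<lparr> msrc = Hom_tensor \<alpha> (Hom_unit1 (ntrg \<alpha>)), mtrg = \<alpha>,
                    mcomp = (\<lambda>a\<in>Ob C. run D (ncomp \<alpha> a)) \<rparr>),
       zero2 = (\<lambda>\<alpha> \<beta>. \<lparr> msrc = \<alpha>, mtrg = \<beta>, mcomp = (\<lambda>a\<in>Ob C. zero2 D (ncomp \<alpha> a) (ncomp \<beta> a)) \<rparr>),
       add2 = (\<lambda>m n. \<lparr> msrc = msrc m, mtrg = mtrg m, mcomp = (\<lambda>a\<in>Ob C. mcomp m a \<boxplus> mcomp n a) \<rparr>),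
       scale2 = (\<lambda>s m. \<lparr> msrc = msrc m, mtrg = mtrg m, mcomp = (\<lambda>a\<in>Ob C. scale2 D s (mcomp m a)) \<rparr>),
       dagger = (\<lambda>m. \<lparr> msrc = mtrg m, mtrg = msrc m, mcomp = (\<lambda>a\<in>Ob C. (mcomp m a)\<dagger>) \<rparr>),
       dual = Hom_dual,
       ev = (\<lambda>\<alpha>. \<lparr> msrc = Hom_tensor (Hom_dual \<alpha>) \<alpha>, mtrg = Hom_unit1 (ntrg \<alpha>),
                   mcomp = (\<lambda>a\<in>Ob C. ev D (ncomp \<alpha> a)) \<rparr>),
       coev = (\<lambda>\<alpha>. \<lparr> msrc = Hom_unit1 (nsrc \<alpha>), mtrg = Hom_tensor \<alpha> (Hom_dual \<alpha>),
                     mcomp = (\<lambda>a\<in>Ob C. coev D (ncomp \<alpha> a)) \<rparr>),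
       weight = (\<lambda>F m. \<Sum>b\<in>ONB C. obj_dim C b / global_dim C b * weight D (fob F b) (mcomp m b)) \<rparr>"

definition preserves_weights :: "('o, 'm, 'c, 'p, 'n, 'd) two_fun \<Rightarrow> bool" where
  "preserves_weights F \<longleftrightarrow> (\<forall>a\<in>Ob C. \<forall>f\<in>hom2 C (unit1 C a) (unit1 C a).
     weight D (fob F a) ((funit F a)\<dagger> \<cdot> fcell F f \<cdot> funit F a) = weight C a f)"

definition isometry_3Hilb :: "('o, 'm, 'c, 'p, 'n, 'd) two_fun \<Rightarrow> bool" where
  "isometry_3Hilb F \<longleftrightarrow> F \<in> Ob Hom3 \<and>
     (\<forall>a\<in>Ob C. \<forall>b\<in>Ob C.
        cat_equivalence (hom_cat C a b) (hom_cat D (fob F a) (fob F b)) (fmor F) (fcell F)) \<and>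
     preserves_weights F"

definition isometric_equivalence_3Hilb :: "('o, 'm, 'c, 'p, 'n, 'd) two_fun \<Rightarrow> bool" where
  "isometric_equivalence_3Hilb F \<longleftrightarrow> isometry_3Hilb F \<and> equivalence_2cat C D F"

end

abbreviation End3 ::
  "('o, 'm, 'c) pre3 \<Rightarrow>
   (('o, 'm, 'c, 'o, 'm, 'c) two_fun, ('o, 'm, 'c, 'o, 'm, 'c) two_nat, ('o, 'm, 'c, 'o, 'm, 'c) modif) pre3" where
  "End3 C \<equiv> Hom3 C C"


section \<open>Unitary 2-adjoints\<close>

text \<open>Isometric equivalences \<open>P : D(F(x) \<rightarrow> y) \<cong> C(x \<rightarrow> G(y))\<close>, 2-natural in \<open>x\<close> and \<open>y\<close>
  via the unitary naturators
  \<open>nx u g : P(F(u) \<otimes> g) \<Rightarrow> u \<otimes> P(g)\<close> for \<open>u : x' \<rightarrow> x\<close>, \<open>g : F(x) \<rightarrow> y\<close>, and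
  \<open>ny x g v : P(g \<otimes> v) \<Rightarrow> P(g) \<otimes> G(v)\<close> for \<open>g : F(x) \<rightarrow> y\<close>, \<open>v : y \<rightarrow> y'\<close>.\<close>

locale natural_hom_isometries =
  fixes C :: "('o, 'm, 'c) pre3" (structure)
    and D :: "('p, 'n, 'd) pre3"
    and F :: "('o, 'm, 'c, 'p, 'n, 'd) two_fun"
    and G :: "('p, 'n, 'd, 'o, 'm, 'c) two_fun"
    and P0 :: "'o \<Rightarrow> 'p \<Rightarrow> 'n \<Rightarrow> 'm"
    and P1 :: "'o \<Rightarrow> 'p \<Rightarrow> 'd \<Rightarrow> 'c"
    and nx :: "'m \<Rightarrow> 'n \<Rightarrow> 'c"
    and ny :: "'o \<Rightarrow> 'n \<Rightarrow> 'n \<Rightarrow> 'c"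
  assumes hom_isometry: "x \<in> Ob C \<Longrightarrow> y \<in> Ob D \<Longrightarrow>
      isometric_equivalence_2Hilb (hom_2Hilb D (fob F x) y) (hom_2Hilb C x (fob G y)) (P0 x y) (P1 x y)"
    and nx_hom: "x \<in> Ob C \<Longrightarrow> u \<in> hom1 C x' x \<Longrightarrow> g \<in> hom1 D (fob F x) y \<Longrightarrow>
      nx u g \<in> hom2 C (P0 x' y (fmor F u \<otimes>\<^bsub>D\<^esub> g)) (u \<otimes> P0 x y g) \<and> unitary2 C (nx u g)"
    and ny_hom: "x \<in> Ob C \<Longrightarrow> g \<in> hom1 D (fob F x) y \<Longrightarrow> v \<in> hom1 D y y' \<Longrightarrow>
      ny x g v \<in> hom2 C (P0 x y' (g \<otimes>\<^bsub>D\<^esub> v)) (P0 x y g \<otimes> fmor G v) \<and> unitary2 C (ny x g v)"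
    and nx_nat: "u \<in> hom1 C x' x \<Longrightarrow> g \<in> hom1 D (fob F x) y \<Longrightarrow>
      f \<in> hom2 C u w \<Longrightarrow> q \<in> hom2 D g h \<Longrightarrow>
      nx w h \<cdot> P1 x' y (fcell F f \<star>\<^bsub>D\<^esub> q) = (f \<star> P1 x y q) \<cdot> nx u g"
    and ny_nat: "x \<in> Ob C \<Longrightarrow> g \<in> hom1 D (fob F x) y \<Longrightarrow> v \<in> hom1 D y y' \<Longrightarrow>
      q \<in> hom2 D g h \<Longrightarrow> r \<in> hom2 D v z \<Longrightarrow>
      ny x h z \<cdot> P1 x y' (q \<star>\<^bsub>D\<^esub> r) = (P1 x y q \<star> fcell G r) \<cdot> ny x g v"
    and nx_unit: "x \<in> Ob C \<Longrightarrow> g \<in> hom1 D (fob F x) y \<Longrightarrow>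
      lun C (P0 x y g) \<cdot> nx (unit1 C x) g \<cdot> P1 x y (funit F x \<star>\<^bsub>D\<^esub> id2 D g) = P1 x y (lun D g)"
    and ny_unit: "x \<in> Ob C \<Longrightarrow> g \<in> hom1 D (fob F x) y \<Longrightarrow>
      ny x g (unit1 D y) = (id2 C (P0 x y g) \<star> funit G y) \<cdot> (run C (P0 x y g))\<dagger> \<cdot> P1 x y (run D g)"
    and nx_tensor: "u' \<in> hom1 C x'' x' \<Longrightarrow> u \<in> hom1 C x' x \<Longrightarrow> g \<in> hom1 D (fob F x) y \<Longrightarrow>
      assoc C u' u (P0 x y g) \<cdot> nx (u' \<otimes> u) g \<cdot> P1 x'' y (ften F u' u \<star>\<^bsub>D\<^esub> id2 D g) =
      (id2 C u' \<star> nx u g) \<cdot> nx u' (fmor F u \<otimes>\<^bsub>D\<^esub> g) \<cdot> P1 x'' y (assoc D (fmor F u') (fmor F u) g)"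
    and ny_tensor: "x \<in> Ob C \<Longrightarrow> g \<in> hom1 D (fob F x) y \<Longrightarrow> v \<in> hom1 D y y' \<Longrightarrow> v' \<in> hom1 D y' y'' \<Longrightarrow>
      ny x g (v \<otimes>\<^bsub>D\<^esub> v') \<cdot> P1 x y'' (assoc D g v v') =
      (id2 C (P0 x y g) \<star> ften G v v') \<cdot> assoc C (P0 x y g) (fmor G v) (fmor G v') \<cdot>
      (ny x g v \<star> id2 C (fmor G v')) \<cdot> ny x (g \<otimes>\<^bsub>D\<^esub> v) v'"
    and nx_ny: "u \<in> hom1 C x' x \<Longrightarrow> g \<in> hom1 D (fob F x) y \<Longrightarrow> v \<in> hom1 D y y' \<Longrightarrow>
      assoc C u (P0 x y g) (fmor G v) \<cdot> (nx u g \<star> id2 C (fmor G v)) \<cdot> ny x' (fmor F u \<otimes>\<^bsub>D\<^esub> g) v =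
      (id2 C u \<star> ny x g v) \<cdot> nx u (g \<otimes>\<^bsub>D\<^esub> v) \<cdot> P1 x' y' (assoc D (fmor F u) g v)"

context
  fixes C :: "('o, 'm, 'c) pre3" (structure)
    and D :: "('p, 'n, 'd) pre3"
    and F :: "('o, 'm, 'c, 'p, 'n, 'd) two_fun"
    and G :: "('p, 'n, 'd, 'o, 'm, 'c) two_fun"
    and P0 :: "'o \<Rightarrow> 'p \<Rightarrow> 'n \<Rightarrow> 'm"
    and P1 :: "'o \<Rightarrow> 'p \<Rightarrow> 'd \<Rightarrow> 'c"
    and nx :: "'m \<Rightarrow> 'n \<Rightarrow> 'c"
    and ny :: "'o \<Rightarrow> 'n \<Rightarrow> 'n \<Rightarrow> 'c"
begin

text \<open>The unit has components \<open>P(1\<^bsub>F(x)\<^esub>) : x \<rightarrow> G(F(x))\<close>, with the naturator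
  \<open>X \<otimes> P(1) \<cong> P(F(X) \<otimes> 1) \<cong> P(1 \<otimes> F(X)) \<cong> P(1) \<otimes> G(F(X))\<close>; it is determined up to
  a unitary modification \<open>\<theta>\<close>. The counit has components corresponding to \<open>1\<^bsub>G(y)\<^esub>\<close> under \<open>P\<close>, up to
  unitaries \<open>\<theta>\<close>, with the naturator determined in the same way because \<open>P\<close> is fully faithful.\<close>

definition is_unit :: "('o, 'm, 'c, 'o, 'm, 'c) two_nat \<Rightarrow> bool" where
  "is_unit \<eta> \<longleftrightarrow> \<eta> \<in> hom1 (End3 C) (id_fun C) (comp_fun C C G F) \<and>
     (\<exists>\<theta>. (\<forall>x\<in>Ob C. \<theta> x \<in> hom2 C (P0 x (fob F x) (unit1 D (fob F x))) (ncomp \<eta> x) \<and> unitary2 C (\<theta> x)) \<and>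
        (\<forall>a b. \<forall>X\<in>hom1 C a b.
           nnat \<eta> X \<cdot> (id2 C X \<star> \<theta> b) \<cdot> nx X (unit1 D (fob F b)) =
           (\<theta> a \<star> id2 C (fmor G (fmor F X))) \<cdot> ny a (unit1 D (fob F a)) (fmor F X) \<cdot>
           P1 a (fob F b) ((lun D (fmor F X))\<dagger>\<^bsub>D\<^esub> \<cdot>\<^bsub>D\<^esub> run D (fmor F X))))"

definition is_counit :: "('p, 'n, 'd, 'p, 'n, 'd) two_nat \<Rightarrow> bool" where
  "is_counit \<epsilon> \<longleftrightarrow> \<epsilon> \<in> hom1 (End3 D) (comp_fun D D F G) (id_fun D) \<and>
     (\<exists>\<theta>. (\<forall>y\<in>Ob D. \<theta> y \<in> hom2 C (P0 (fob G y) y (ncomp \<epsilon> y)) (unit1 C (fob G y)) \<and> unitary2 C (\<theta> y)) \<and>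
        (\<forall>y y'. \<forall>Y\<in>hom1 D y y'.
           lun C (fmor G Y) \<cdot> (\<theta> y \<star> id2 C (fmor G Y)) \<cdot> ny (fob G y) (ncomp \<epsilon> y) Y \<cdot>
             P1 (fob G y) y' (nnat \<epsilon> Y) =
           run C (fmor G Y) \<cdot> (id2 C (fmor G Y) \<star> \<theta> y') \<cdot> nx (fmor G Y) (ncomp \<epsilon> y')))"

end

text \<open>\<open>Fs\<close> is the unitary 2-adjoint of \<open>F\<close>, with unit \<open>coevF\<close> and counit \<open>evF\<close>.\<close>

definition unitary_2adjoint ::
  "('o, 'm, 'c) pre3 \<Rightarrow> ('p, 'n, 'd) pre3 \<Rightarrow>
   ('o, 'm, 'c, 'p, 'n, 'd) two_fun \<Rightarrow> ('p, 'n, 'd, 'o, 'm, 'c) two_fun \<Rightarrow>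
   ('o, 'm, 'c, 'o, 'm, 'c) two_nat \<Rightarrow> ('p, 'n, 'd, 'p, 'n, 'd) two_nat \<Rightarrow> bool" where
  "unitary_2adjoint C D F Fs coevF evF \<longleftrightarrow> F \<in> Ob (Hom3 C D) \<and> Fs \<in> Ob (Hom3 D C) \<and>
     (\<exists>P0 P1 nx ny. natural_hom_isometries C D F Fs P0 P1 nx ny \<and>
        is_unit C D F Fs P0 P1 nx ny coevF \<and> is_counit C D F Fs P0 P1 nx ny evF)"

end

theory Submission
  imports Defs
begin

text \<open>
  Let \<open>G\<close> be the adjoint of \<open>F : C \<rightarrow> D\<close>, with unit \<open>\<eta>\<close>, counit \<open>\<epsilon>\<close> and hom equivalences
  \<open>P : D(F(x) \<rightarrow> y) \<rightarrow> C(x \<rightarrow> G(y))\<close>. Call \<open>g : F(b) \<rightarrow> y\<close> and \<open>m : b \<rightarrow> G(y)\<close> a transposed pair if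
  \<open>P(g)\<close> is unitarily isomorphic to \<open>m\<close>. Naturality in \<open>x\<close> turns this into unitary isomorphisms
  \<open>P(F(X) \<otimes> g) \<cong> X \<otimes> m\<close>, natural in \<open>X : a \<rightarrow> b\<close>: up to the isometric equivalence \<open>P\<close>, the functor
  \<open>F(-) \<otimes> g\<close> is \<open>- \<otimes> m\<close>. Hence one of these is an equivalence iff the other is
  (\<open>ff_ess_surj_transfer\<close>), and comparing the traces of \<open>f \<otimes> 1\<close> on both sides for \<open>f\<close> in \<open>End(1\<^sub>b)\<close>
  yields \<open>\<Psi>(coev\<^sub>m\<^sup>\<dagger> coev\<^sub>m f) = \<Psi>(coev\<^sub>g\<^sup>\<dagger> coev\<^sub>g F(f))\<close> (\<open>weight_transfer\<close>). The unit is the case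
  \<open>g = 1\<close>, \<open>m = \<eta>\<^sub>b\<close>, the counit the case \<open>g = \<epsilon>\<^sub>y\<close>, \<open>m = 1\<close>.

  For the unit, \<open>F\<close> is therefore fully faithful iff every \<open>- \<otimes> \<eta>\<^sub>b\<close> is an equivalence, and, weights
  being faithful, \<open>F\<close> preserves weights iff every \<open>coev\<close> of \<open>\<eta>\<^sub>b\<close> is isometric. By the theory of adjunctions,
  \<open>coev\<^sub>X\<close> is invertible when \<open>- \<otimes> X\<close> is fully faithful (\<open>fully_faithful_imp_coev_unitary\<close>); once it is
  unitary, \<open>ev\<^sub>X\<close> is isometric, and it is unitary as soon as \<open>X\<close> has a left inverse
  (\<open>coev_unitary_imp_ev_unitary\<close>). Conversely, if both are unitary, \<open>- \<otimes> X\<close> is an equivalence. So \<open>F\<close> is an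
  isometry iff all components of \<open>\<eta>\<close> are isometric equivalences (\<open>isometry_iff_unit\<close>).

  For the counit, \<open>F(-) \<otimes> \<epsilon>\<^sub>y\<close> corresponds to \<open>- \<otimes> 1\<close> and so is an equivalence. If \<open>F\<close> is an isometry,
  it follows that \<open>- \<otimes> \<epsilon>\<^sub>y\<close> is fully faithful on \<open>D(FG(y) \<rightarrow> FG(y))\<close> and that \<open>coev\<close> of \<open>\<epsilon>\<^sub>y\<close> is isometric,
  hence that \<open>\<epsilon>\<^sub>y\<close> is an isometry (\<open>isometry_imp_counit\<close>). If \<open>F\<close> is moreover an equivalence, there is an
  equivalence \<open>c : F(a) \<rightarrow> y\<close>; it is of the form \<open>F(u) \<otimes> \<epsilon>\<^sub>y\<close>, which provides a left inverse of \<open>\<epsilon>\<^sub>y\<close>, so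
  that \<open>\<epsilon>\<^sub>y\<close> is an isometric equivalence (\<open>equivalence_imp_counit\<close>). Conversely, if the components of
  \<open>\<eta>\<close> and \<open>\<epsilon>\<close> are isometric equivalences, \<open>G\<close> is inverse to \<open>F\<close>.
\<close>

section \<open>Equivalences of categories\<close>

text \<open>Fully faithful and essentially surjective functors. Unlike \<open>cat_equivalence\<close>, this form needs no
  choice of a quasi-inverse, so the 2-out-of-3 arguments below reduce to bijections of hom sets.\<close>

definition ff_ess_surj ::
  "('o, 'a, 'y) lin_cat_scheme \<Rightarrow> ('p, 'b, 'z) lin_cat_scheme \<Rightarrow> ('o \<Rightarrow> 'p) \<Rightarrow> ('a \<Rightarrow> 'b) \<Rightarrow> bool" where
  "ff_ess_surj K L P0 P1 \<longleftrightarrow> cat_functor K L P0 P1 \<and>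
     (\<forall>a\<in>cob K. \<forall>b\<in>cob K. bij_betw P1 (chom K a b) (chom L (P0 a) (P0 b))) \<and>
     (\<forall>d\<in>cob L. \<exists>a\<in>cob K. isomorphic L (P0 a) d)"

lemma bij_betw_hit: "bij_betw f A B \<Longrightarrow> y \<in> B \<Longrightarrow> \<exists>x\<in>A. f x = y"
  unfolding bij_betw_def by blast

lemma cat_functorD:
  assumes "cat_functor K L P0 P1"
  shows "a \<in> cob K \<Longrightarrow> P0 a \<in> cob L"
    and "f \<in> chom K a b \<Longrightarrow> P1 f \<in> chom L (P0 a) (P0 b)"
    and "a \<in> cob K \<Longrightarrow> P1 (cid K a) = cid L (P0 a)"
    and "f \<in> chom K a b \<Longrightarrow> g \<in> chom K b c \<Longrightarrow> P1 (g \<odot>\<^bsub>K\<^esub> f) = P1 g \<odot>\<^bsub>L\<^esub> P1 f"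
  using assms unfolding cat_functor_def by blast+

lemma ff_ess_surjD:
  assumes "ff_ess_surj K L P0 P1"
  shows "cat_functor K L P0 P1"
    and "a \<in> cob K \<Longrightarrow> b \<in> cob K \<Longrightarrow> bij_betw P1 (chom K a b) (chom L (P0 a) (P0 b))"
    and "d \<in> cob L \<Longrightarrow> \<exists>a\<in>cob K. isomorphic L (P0 a) d"
  using assms unfolding ff_ess_surj_def by simp_all

context dagger_category
begin

lemma chom_obj: "f \<in> chom K a b \<Longrightarrow> a \<in> cob K \<and> b \<in> cob K"
  using arr_obj unfolding chom_def by auto

lemma cisoI:
  "f \<in> chom K a b \<Longrightarrow> g \<in> chom K b a \<Longrightarrow> g \<odot> f = cid K a \<Longrightarrow> f \<odot> g = cid K b \<Longrightarrow> ciso K f"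
  unfolding ciso_def cinverse_def chom_def by auto

lemma cisoE:
  assumes "ciso K f" "f \<in> chom K a b"
  obtains g where "g \<in> chom K b a" "g \<odot> f = cid K a" "f \<odot> g = cid K b"
  using assms unfolding ciso_def cinverse_def chom_def by auto

lemma iso_cancel_left:
  assumes "ciso K h" "h \<in> chom K b c" "f \<in> chom K a b" "g \<in> chom K a b" "h \<odot> f = h \<odot> g"
  shows "f = g"
proof -
  obtain k where k: "k \<in> chom K c b" "k \<odot> h = cid K b" using cisoE[OF assms(1,2)] by blast
  have "(k \<odot> h) \<odot> f = (k \<odot> h) \<odot> g"
    using assms(5) comp_assoc[OF assms(3,2) k(1)] comp_assoc[OF assms(4,2) k(1)] by simp
  then show ?thesis using comp_id[OF assms(3)] comp_id[OF assms(4)] k(2) by simp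
qed

lemma iso_cancel_right:
  assumes "ciso K h" "h \<in> chom K a b" "f \<in> chom K b c" "g \<in> chom K b c" "f \<odot> h = g \<odot> h"
  shows "f = g"
proof -
  obtain k where k: "k \<in> chom K b a" "h \<odot> k = cid K b" using cisoE[OF assms(1,2)] by blast
  have "f \<odot> (h \<odot> k) = g \<odot> (h \<odot> k)"
    using assms(5) comp_assoc[OF k(1) assms(2,3)] comp_assoc[OF k(1) assms(2,4)] by simp
  then show ?thesis using comp_id[OF assms(3)] comp_id[OF assms(4)] k(2) by simp
qed

lemma ciso_comp:
  assumes "ciso K f" "ciso K g" "f \<in> chom K a b" "g \<in> chom K b c"
  shows "ciso K (g \<odot> f)"
proof -
  obtain f' g' where f': "f' \<in> chom K b a" "f' \<odot> f = cid K a" "f \<odot> f' = cid K b"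
    and g': "g' \<in> chom K c b" "g' \<odot> g = cid K b" "g \<odot> g' = cid K c"
    using cisoE assms by metis
  have "(f' \<odot> g') \<odot> (g \<odot> f) = f' \<odot> (g' \<odot> g) \<odot> f"
    using comp_assoc[OF comp_hom[OF assms(3,4)] g'(1) f'(1)] comp_assoc[OF assms(3,4) g'(1)] by simp
  then have "(f' \<odot> g') \<odot> (g \<odot> f) = cid K a" using comp_id assms(3) f' g' by simp
  moreover have "(g \<odot> f) \<odot> (f' \<odot> g') = g \<odot> (f \<odot> f') \<odot> g'"
    using comp_assoc[OF comp_hom[OF g'(1) f'(1)] assms(3,4)] comp_assoc[OF g'(1) f'(1) assms(3)] by simp
  then have "(g \<odot> f) \<odot> (f' \<odot> g') = cid K c" using comp_id g'(1) f' g' by simp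
  ultimately show ?thesis
    using cisoI[of "g \<odot> f" a c "f' \<odot> g'"] comp_hom f' g' assms by blast
qed

lemma isomorphicI: "f \<in> chom K a b \<Longrightarrow> ciso K f \<Longrightarrow> isomorphic K a b"
  unfolding isomorphic_def by blast

lemma isomorphic_sym: "isomorphic K a b \<Longrightarrow> isomorphic K b a"
  unfolding isomorphic_def by (metis cisoE cisoI)

lemma isomorphic_trans: "isomorphic K a b \<Longrightarrow> isomorphic K b c \<Longrightarrow> isomorphic K a c"
  unfolding isomorphic_def by (meson ciso_comp comp_hom)

end

lemma cat_functor_ciso:
  assumes "dagger_category K" "dagger_category L" "cat_functor K L P0 P1" "ciso K f" "f \<in> chom K a b"
  shows "ciso L (P1 f)"
proof -
  interpret K: dagger_category K by fact
  interpret L: dagger_category L by fact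
  obtain g where g: "g \<in> chom K b a" "g \<odot>\<^bsub>K\<^esub> f = cid K a" "f \<odot>\<^bsub>K\<^esub> g = cid K b"
    using K.cisoE assms by metis
  have "a \<in> cob K" "b \<in> cob K" using K.chom_obj assms by blast+
  then show ?thesis
    using L.cisoI[OF cat_functorD(2)[OF assms(3,5)] cat_functorD(2)[OF assms(3) g(1)]]
      cat_functorD(4)[OF assms(3,5) g(1)] cat_functorD(4)[OF assms(3) g(1) assms(5)]
      cat_functorD(3)[OF assms(3)] g by simp
qed

lemma cat_functor_isomorphic:
  assumes "dagger_category K" "dagger_category L" "cat_functor K L P0 P1" "isomorphic K a b"
  shows "isomorphic L (P0 a) (P0 b)"
  using assms cat_functor_ciso cat_functorD(2) unfolding isomorphic_def by metis

lemma cat_equivalence_imp_ff_ess_surj: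
  assumes K: "dagger_category K" and L: "dagger_category L" and eq: "cat_equivalence K L P0 P1"
  shows "ff_ess_surj K L P0 P1"
proof -
  interpret K: dagger_category K by fact
  interpret L: dagger_category L by fact
  from eq obtain Q0 Q1 \<eta> \<epsilon> where P: "cat_functor K L P0 P1" and Q: "cat_functor L K Q0 Q1"
    and \<eta>: "nat_family K K id id (Q0 \<circ> P0) (Q1 \<circ> P1) \<eta>" "\<And>a. a\<in>cob K \<Longrightarrow> ciso K (\<eta> a)"
    and \<epsilon>: "nat_family L L (P0 \<circ> Q0) (P1 \<circ> Q1) id id \<epsilon>" "\<And>b. b\<in>cob L \<Longrightarrow> ciso L (\<epsilon> b)"
    unfolding cat_equivalence_def by blast
  note PD = cat_functorD[OF P] and QD = cat_functorD[OF Q]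
  have \<eta>h: "\<eta> a \<in> chom K a (Q0 (P0 a))" if "a \<in> cob K" for a
    using \<eta>(1) that unfolding nat_family_def by simp
  have \<eta>n: "\<eta> b \<odot>\<^bsub>K\<^esub> f = Q1 (P1 f) \<odot>\<^bsub>K\<^esub> \<eta> a" if "f \<in> chom K a b" for f a b
    using \<eta>(1) that unfolding nat_family_def by auto
  have \<epsilon>h: "\<epsilon> a \<in> chom L (P0 (Q0 a)) a" if "a \<in> cob L" for a
    using \<epsilon>(1) that unfolding nat_family_def by simp
  have \<epsilon>n: "\<epsilon> b \<odot>\<^bsub>L\<^esub> P1 (Q1 f) = f \<odot>\<^bsub>L\<^esub> \<epsilon> a" if "f \<in> chom L a b" for f a b
    using \<epsilon>(1) that unfolding nat_family_def by auto
  have injP: "inj_on P1 (chom K a b)" if "a \<in> cob K" "b \<in> cob K" for a b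
  proof (rule inj_onI)
    fix f g assume f: "f \<in> chom K a b" "g \<in> chom K a b" "P1 f = P1 g"
    then have "\<eta> b \<odot>\<^bsub>K\<^esub> f = \<eta> b \<odot>\<^bsub>K\<^esub> g" using \<eta>n by metis
    then show "f = g" using K.iso_cancel_left[OF \<eta>(2) \<eta>h f(1,2)] that by blast
  qed
  have injQ: "inj_on Q1 (chom L a b)" if "a \<in> cob L" "b \<in> cob L" for a b
  proof (rule inj_onI)
    fix f g assume f: "f \<in> chom L a b" "g \<in> chom L a b" "Q1 f = Q1 g"
    then have "f \<odot>\<^bsub>L\<^esub> \<epsilon> a = g \<odot>\<^bsub>L\<^esub> \<epsilon> a" using \<epsilon>n by metis
    then show "f = g" using L.iso_cancel_right[OF \<epsilon>(2) \<epsilon>h f(1,2)] that by blast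
  qed
  have surj: "h \<in> P1 ` chom K a b" if ab: "a \<in> cob K" "b \<in> cob K" and h: "h \<in> chom L (P0 a) (P0 b)" for a b h
  proof -
    obtain k where k: "k \<in> chom K (Q0 (P0 b)) b" "\<eta> b \<odot>\<^bsub>K\<^esub> k = cid K (Q0 (P0 b))"
      using K.cisoE[OF \<eta>(2) \<eta>h] ab by metis
    define f where "f = k \<odot>\<^bsub>K\<^esub> Q1 h \<odot>\<^bsub>K\<^esub> \<eta> a"
    have Qh: "Q1 h \<in> chom K (Q0 (P0 a)) (Q0 (P0 b))" using QD h by blast
    have c: "Q1 h \<odot>\<^bsub>K\<^esub> \<eta> a \<in> chom K a (Q0 (P0 b))" using K.comp_hom \<eta>h[OF ab(1)] Qh by blast
    have f: "f \<in> chom K a b" unfolding f_def using K.comp_hom c k(1) by blast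
    have "\<eta> b \<odot>\<^bsub>K\<^esub> f = Q1 h \<odot>\<^bsub>K\<^esub> \<eta> a"
      unfolding f_def using K.comp_assoc[OF c k(1) \<eta>h[OF ab(2)]] k(2) K.comp_id[OF c] by simp
    then have "Q1 (P1 f) \<odot>\<^bsub>K\<^esub> \<eta> a = Q1 h \<odot>\<^bsub>K\<^esub> \<eta> a" using \<eta>n f by metis
    then have "Q1 (P1 f) = Q1 h"
      using K.iso_cancel_right[OF \<eta>(2) \<eta>h _ Qh] ab QD(2) PD(2) f by blast
    then have "P1 f = h" using injQ PD ab h f unfolding inj_on_def by blast
    then show ?thesis using f by blast
  qed
  have "bij_betw P1 (chom K a b) (chom L (P0 a) (P0 b))" if "a \<in> cob K" "b \<in> cob K" for a b
    unfolding bij_betw_def using injP surj PD(2) that by blast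
  moreover have "\<exists>a\<in>cob K. isomorphic L (P0 a) d" if "d \<in> cob L" for d
    using \<epsilon>h \<epsilon>(2) QD(1) L.isomorphicI that by blast
  ultimately show ?thesis unfolding ff_ess_surj_def using P by blast
qed

text \<open>The quasi-inverse is chosen on objects by essential surjectivity; on arrows it is then forced,
  as the lift along \<open>P1\<close> of the conjugate by the chosen isomorphisms \<open>e\<close>.\<close>

lemma ff_ess_surj_imp_cat_equivalence:
  assumes K: "dagger_category K" and L: "dagger_category L" and eq: "ff_ess_surj K L P0 P1"
  shows "cat_equivalence K L P0 P1"
proof -
  interpret K: dagger_category K by fact
  interpret L: dagger_category L by fact
  from eq have P: "cat_functor K L P0 P1"
    and bij: "\<And>a b. a \<in> cob K \<Longrightarrow> b \<in> cob K \<Longrightarrow> bij_betw P1 (chom K a b) (chom L (P0 a) (P0 b))"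
    and es: "\<forall>d\<in>cob L. \<exists>a\<in>cob K. isomorphic L (P0 a) d"
    unfolding ff_ess_surj_def by blast+
  note PD = cat_functorD[OF P]
  have "\<forall>d\<in>cob L. \<exists>a e e'. a \<in> cob K \<and> e \<in> chom L (P0 a) d \<and> e' \<in> chom L d (P0 a) \<and>
     e' \<odot>\<^bsub>L\<^esub> e = cid L (P0 a) \<and> e \<odot>\<^bsub>L\<^esub> e' = cid L d"
    using es unfolding isomorphic_def by (metis L.cisoE)
  then obtain Q0 e e' where Q0: "\<And>d. d \<in> cob L \<Longrightarrow> Q0 d \<in> cob K"
    and e: "\<And>d. d \<in> cob L \<Longrightarrow> e d \<in> chom L (P0 (Q0 d)) d"
    and e': "\<And>d. d \<in> cob L \<Longrightarrow> e' d \<in> chom L d (P0 (Q0 d))"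
    and ee: "\<And>d. d \<in> cob L \<Longrightarrow> e' d \<odot>\<^bsub>L\<^esub> e d = cid L (P0 (Q0 d))"
       "\<And>d. d \<in> cob L \<Longrightarrow> e d \<odot>\<^bsub>L\<^esub> e' d = cid L d"
    by metis
  define lift where "lift a b h = (THE f. f \<in> chom K a b \<and> P1 f = h)" for a b h
  have lift_eq: "lift a b (P1 f) = f" if "f \<in> chom K a b" for a b f
    unfolding lift_def using bij[of a b] K.chom_obj[OF that] that
    by (intro the_equality) (auto simp: bij_betw_def inj_on_def)
  have lift: "lift a b h \<in> chom K a b" "P1 (lift a b h) = h"
    if abh: "a \<in> cob K" "b \<in> cob K" "h \<in> chom L (P0 a) (P0 b)" for a b h
  proof -
    obtain f where "f \<in> chom K a b" "P1 f = h" using bij_betw_hit[OF bij[OF abh(1,2)] abh(3)] by blast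
    then show "lift a b h \<in> chom K a b" "P1 (lift a b h) = h" using lift_eq by auto
  qed
  define Q1 where "Q1 h = lift (Q0 (cdom L h)) (Q0 (ccod L h)) (e' (ccod L h) \<odot>\<^bsub>L\<^esub> h \<odot>\<^bsub>L\<^esub> e (cdom L h))" for h
  have Q1: "Q1 h \<in> chom K (Q0 c) (Q0 d)" "P1 (Q1 h) = e' d \<odot>\<^bsub>L\<^esub> h \<odot>\<^bsub>L\<^esub> e c" if "h \<in> chom L c d" for h c d
  proof -
    have cd: "c \<in> cob L" "d \<in> cob L" "cdom L h = c" "ccod L h = d"
      using L.chom_obj that unfolding chom_def by blast+
    have "e' d \<odot>\<^bsub>L\<^esub> h \<odot>\<^bsub>L\<^esub> e c \<in> chom L (P0 (Q0 c)) (P0 (Q0 d))"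
      using L.comp_hom e e' cd that by blast
    then show "Q1 h \<in> chom K (Q0 c) (Q0 d)" "P1 (Q1 h) = e' d \<odot>\<^bsub>L\<^esub> h \<odot>\<^bsub>L\<^esub> e c"
      unfolding Q1_def using lift Q0 cd by auto
  qed
  have inj: "f = g" if "f \<in> chom K a b" "g \<in> chom K a b" "P1 f = P1 g" for f g a b
    using lift_eq that by metis
  have eP1Q1: "e d \<odot>\<^bsub>L\<^esub> P1 (Q1 h) = h \<odot>\<^bsub>L\<^esub> e c" if h: "h \<in> chom L c d" for h c d
  proof -
    have cd: "c \<in> cob L" "d \<in> cob L" using L.chom_obj h by blast+
    have k: "h \<odot>\<^bsub>L\<^esub> e c \<in> chom L (P0 (Q0 c)) d" using L.comp_hom e cd h by blast
    show ?thesis unfolding Q1(2)[OF h]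
      using L.comp_assoc[OF k e'[OF cd(2)] e[OF cd(2)]] ee cd L.comp_id[OF k] by simp
  qed
  have isoe: "ciso L (e d)" if "d \<in> cob L" for d using L.cisoI e e' ee that by blast
  have Qid: "Q1 (cid L d) = cid K (Q0 d)" if d: "d \<in> cob L" for d
  proof (rule inj[OF Q1(1)[OF L.id_hom[OF d]] K.id_hom[OF Q0[OF d]]])
    show "P1 (Q1 (cid L d)) = P1 (cid K (Q0 d))"
      unfolding Q1(2)[OF L.id_hom[OF d]] PD(3)[OF Q0[OF d]] using L.comp_id e d ee by metis
  qed
  have Qcomp: "Q1 (g \<odot>\<^bsub>L\<^esub> f) = Q1 g \<odot>\<^bsub>K\<^esub> Q1 f" if f: "f \<in> chom L a b" and g: "g \<in> chom L b c" for f g a b c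
  proof (rule inj)
    have gf: "g \<odot>\<^bsub>L\<^esub> f \<in> chom L a c" using L.comp_hom f g by blast
    have o: "a \<in> cob L" "b \<in> cob L" "c \<in> cob L" using L.chom_obj f g by blast+
    show "Q1 (g \<odot>\<^bsub>L\<^esub> f) \<in> chom K (Q0 a) (Q0 c)" by (rule Q1(1)[OF gf])
    show QQ: "Q1 g \<odot>\<^bsub>K\<^esub> Q1 f \<in> chom K (Q0 a) (Q0 c)" by (rule K.comp_hom[OF Q1(1)[OF f] Q1(1)[OF g]])
    have p: "P1 (Q1 g) \<in> chom L (P0 (Q0 b)) (P0 (Q0 c))" "P1 (Q1 f) \<in> chom L (P0 (Q0 a)) (P0 (Q0 b))"
      using PD(2)[OF Q1(1)[OF g]] PD(2)[OF Q1(1)[OF f]] .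
    have "e c \<odot>\<^bsub>L\<^esub> P1 (Q1 g) \<odot>\<^bsub>L\<^esub> P1 (Q1 f) = g \<odot>\<^bsub>L\<^esub> f \<odot>\<^bsub>L\<^esub> e a"
      using L.comp_assoc[OF p(2,1) e[OF o(3)]] L.comp_assoc[OF p(2) e[OF o(2)] g] eP1Q1[OF f] eP1Q1[OF g] by simp
    also have "\<dots> = e c \<odot>\<^bsub>L\<^esub> P1 (Q1 (g \<odot>\<^bsub>L\<^esub> f))"
      using L.comp_assoc[OF e[OF o(1)] f g] eP1Q1[OF gf] by simp
    finally have "P1 (Q1 g) \<odot>\<^bsub>L\<^esub> P1 (Q1 f) = P1 (Q1 (g \<odot>\<^bsub>L\<^esub> f))"
      by (rule L.iso_cancel_left[OF isoe[OF o(3)] e[OF o(3)] L.comp_hom[OF p(2,1)] PD(2)[OF Q1(1)[OF gf]]])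
    then show "P1 (Q1 (g \<odot>\<^bsub>L\<^esub> f)) = P1 (Q1 g \<odot>\<^bsub>K\<^esub> Q1 f)"
      using PD(4)[OF Q1(1)[OF f] Q1(1)[OF g]] by simp
  qed
  have Qf: "cat_functor L K Q0 Q1"
    unfolding cat_functor_def using Q0 Q1(1) Qid Qcomp by blast
  define \<eta> where "\<eta> a = lift a (Q0 (P0 a)) (e' (P0 a))" for a
  have \<eta>: "\<eta> a \<in> chom K a (Q0 (P0 a))" "P1 (\<eta> a) = e' (P0 a)" if "a \<in> cob K" for a
    unfolding \<eta>_def using lift that Q0 PD(1) e' by auto
  have \<eta>iso: "ciso K (\<eta> a)" if a: "a \<in> cob K" for a
  proof (rule K.cisoI[OF \<eta>(1)[OF a]])
    define z where "z = lift (Q0 (P0 a)) a (e (P0 a))"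
    have Pa: "P0 a \<in> cob L" using PD a by blast
    show z: "z \<in> chom K (Q0 (P0 a)) a" and "z \<odot>\<^bsub>K\<^esub> \<eta> a = cid K a" and "\<eta> a \<odot>\<^bsub>K\<^esub> z = cid K (Q0 (P0 a))"
    proof -
      show z: "z \<in> chom K (Q0 (P0 a)) a" unfolding z_def using lift a Q0 Pa e by blast
      have Pz: "P1 z = e (P0 a)" unfolding z_def using lift a Q0 Pa e by blast
      show "z \<odot>\<^bsub>K\<^esub> \<eta> a = cid K a"
        by (rule inj[OF K.comp_hom[OF \<eta>(1)[OF a] z] K.id_hom[OF a]])
          (simp add: PD(3)[OF a] PD(4)[OF \<eta>(1)[OF a] z] Pz \<eta>(2)[OF a] ee(2)[OF Pa])
      show "\<eta> a \<odot>\<^bsub>K\<^esub> z = cid K (Q0 (P0 a))"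
        by (rule inj[OF K.comp_hom[OF z \<eta>(1)[OF a]] K.id_hom[OF Q0[OF Pa]]])
          (simp add: PD(3)[OF Q0[OF Pa]] PD(4)[OF z \<eta>(1)[OF a]] Pz \<eta>(2)[OF a] ee(1)[OF Pa])
    qed
  qed
  have \<eta>nat: "\<eta> b \<odot>\<^bsub>K\<^esub> f = Q1 (P1 f) \<odot>\<^bsub>K\<^esub> \<eta> a" if f: "f \<in> chom K a b" for a b f
  proof (rule inj)
    have o: "a \<in> cob K" "b \<in> cob K" using K.chom_obj f by blast+
    have Po: "P0 a \<in> cob L" "P0 b \<in> cob L" using PD o by blast+
    show "\<eta> b \<odot>\<^bsub>K\<^esub> f \<in> chom K a (Q0 (P0 b))" using K.comp_hom \<eta> o f by blast
    show "Q1 (P1 f) \<odot>\<^bsub>K\<^esub> \<eta> a \<in> chom K a (Q0 (P0 b))"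
      by (rule K.comp_hom[OF \<eta>(1)[OF o(1)] Q1(1)[OF PD(2)[OF f]]])
    have Pf: "P1 f \<in> chom L (P0 a) (P0 b)" using PD f by blast
    have "P1 (\<eta> b \<odot>\<^bsub>K\<^esub> f) = e' (P0 b) \<odot>\<^bsub>L\<^esub> P1 f" using PD(4) \<eta> o f by metis
    also have "\<dots> = e' (P0 b) \<odot>\<^bsub>L\<^esub> P1 f \<odot>\<^bsub>L\<^esub> (e (P0 a) \<odot>\<^bsub>L\<^esub> e' (P0 a))"
      using L.comp_id[OF Pf] ee Po by simp
    also have "\<dots> = (e' (P0 b) \<odot>\<^bsub>L\<^esub> P1 f \<odot>\<^bsub>L\<^esub> e (P0 a)) \<odot>\<^bsub>L\<^esub> e' (P0 a)"
      using L.comp_assoc[OF e'[OF Po(1)] e[OF Po(1)] Pf]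
        L.comp_assoc[OF e'[OF Po(1)] L.comp_hom[OF e[OF Po(1)] Pf] e'[OF Po(2)]] by simp
    also have "\<dots> = P1 (Q1 (P1 f)) \<odot>\<^bsub>L\<^esub> P1 (\<eta> a)" using Q1(2)[OF Pf] \<eta> o by simp
    also have "\<dots> = P1 (Q1 (P1 f) \<odot>\<^bsub>K\<^esub> \<eta> a)" using PD(4)[OF \<eta>(1)[OF o(1)] Q1(1)[OF Pf]] by simp
    finally show "P1 (\<eta> b \<odot>\<^bsub>K\<^esub> f) = P1 (Q1 (P1 f) \<odot>\<^bsub>K\<^esub> \<eta> a)" .
  qed
  have "nat_family K K id id (Q0 \<circ> P0) (Q1 \<circ> P1) \<eta>"
    unfolding nat_family_def using \<eta>(1) \<eta>nat by simp
  moreover have "nat_family L L (P0 \<circ> Q0) (P1 \<circ> Q1) id id e"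
    unfolding nat_family_def using e eP1Q1 by simp
  ultimately show ?thesis unfolding cat_equivalence_def using P Qf \<eta>iso isoe by blast
qed

lemma dagger_equivalence_imp_cat_equivalence:
  assumes "dagger_equivalence K L P0 P1"
  shows "cat_equivalence K L P0 P1"
proof -
  from assms obtain Q0 Q1 \<eta> \<epsilon> where "cat_functor K L P0 P1" "cat_functor L K Q0 Q1"
    "nat_family K K id id (Q0 \<circ> P0) (Q1 \<circ> P1) \<eta>" "\<forall>a\<in>cob K. cunitary K (\<eta> a)"
    "nat_family L L (P0 \<circ> Q0) (P1 \<circ> Q1) id id \<epsilon>" "\<forall>b\<in>cob L. cunitary L (\<epsilon> b)"
    unfolding dagger_equivalence_def lin_dagger_functor_def by blast
  moreover from this have "\<forall>a\<in>cob K. ciso K (\<eta> a)" "\<forall>b\<in>cob L. ciso L (\<epsilon> b)"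
    unfolding cunitary_def ciso_def by blast+
  ultimately show ?thesis unfolding cat_equivalence_def by blast
qed

lemma cat_functor_comp:
  "cat_functor K L P0 P1 \<Longrightarrow> cat_functor L M Q0 Q1 \<Longrightarrow> cat_functor K M (Q0 \<circ> P0) (Q1 \<circ> P1)"
  unfolding cat_functor_def by simp blast

lemma ff_ess_surj_comp:
  assumes "dagger_category L" "dagger_category M" "ff_ess_surj K L P0 P1" "ff_ess_surj L M Q0 Q1"
  shows "ff_ess_surj K M (Q0 \<circ> P0) (Q1 \<circ> P1)"
proof -
  interpret M: dagger_category M by fact
  have P: "cat_functor K L P0 P1" and Q: "cat_functor L M Q0 Q1"
    using assms unfolding ff_ess_surj_def by blast+
  note PD = cat_functorD[OF P] and QD = cat_functorD[OF Q]
  have "bij_betw (Q1 \<circ> P1) (chom K a b) (chom M ((Q0 \<circ> P0) a) ((Q0 \<circ> P0) b))"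
    if "a \<in> cob K" "b \<in> cob K" for a b
    using bij_betw_trans[of P1 "chom K a b" "chom L (P0 a) (P0 b)" Q1 "chom M (Q0 (P0 a)) (Q0 (P0 b))"]
      assms(3,4) that PD(1) unfolding ff_ess_surj_def comp_apply by blast
  moreover have "\<exists>a\<in>cob K. isomorphic M ((Q0 \<circ> P0) a) d" if d: "d \<in> cob M" for d
  proof -
    obtain b where b: "b \<in> cob L" "isomorphic M (Q0 b) d" using ff_ess_surjD(3)[OF assms(4) d] by blast
    obtain a where a: "a \<in> cob K" "isomorphic L (P0 a) b" using ff_ess_surjD(3)[OF assms(3) b(1)] by blast
    have "isomorphic M (Q0 (P0 a)) (Q0 b)" using cat_functor_isomorphic assms(1,2) Q a(2) by metis
    then show ?thesis using a(1) b(2) M.isomorphic_trans by auto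
  qed
  ultimately show ?thesis unfolding ff_ess_surj_def using cat_functor_comp[OF P Q] by blast
qed

lemma ff_ess_surj_cancel_left:
  assumes K: "dagger_category K" and L: "dagger_category L" and M: "dagger_category M"
    and P: "cat_functor K L P0 P1" and Q: "ff_ess_surj L M Q0 Q1" and QP: "ff_ess_surj K M (Q0 \<circ> P0) (Q1 \<circ> P1)"
  shows "ff_ess_surj K L P0 P1"
proof -
  interpret L: dagger_category L by fact
  interpret M: dagger_category M by fact
  have Qf: "cat_functor L M Q0 Q1" using Q unfolding ff_ess_surj_def by blast
  note PD = cat_functorD[OF P] and QD = cat_functorD[OF Qf]
  have bQ: "bij_betw Q1 (chom L a b) (chom M (Q0 a) (Q0 b))" if "a \<in> cob L" "b \<in> cob L" for a b
    using Q that unfolding ff_ess_surj_def by blast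
  have "bij_betw P1 (chom K a b) (chom L (P0 a) (P0 b))" if "a \<in> cob K" "b \<in> cob K" for a b
  proof -
    have qp: "bij_betw (Q1 \<circ> P1) (chom K a b) (chom M (Q0 (P0 a)) (Q0 (P0 b)))"
      using QP that unfolding ff_ess_surj_def by simp
    have sub: "P1 ` chom K a b \<subseteq> chom L (P0 a) (P0 b)" using PD by blast
    have "inj_on P1 (chom K a b)" using qp inj_on_imageI2 unfolding bij_betw_def by blast
    moreover have "h \<in> P1 ` chom K a b" if h: "h \<in> chom L (P0 a) (P0 b)" for h
    proof -
      have "Q1 h \<in> chom M (Q0 (P0 a)) (Q0 (P0 b))" using QD h by blast
      then obtain f where f: "f \<in> chom K a b" "Q1 h = Q1 (P1 f)" using qp unfolding bij_betw_def by auto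
      then have "h = P1 f" using bQ[of "P0 a" "P0 b"] h sub L.chom_obj[OF h] unfolding bij_betw_def inj_on_def by blast
      then show ?thesis using f by blast
    qed
    ultimately show ?thesis unfolding bij_betw_def using sub by blast
  qed
  moreover have "\<exists>a\<in>cob K. isomorphic L (P0 a) d" if d: "d \<in> cob L" for d
  proof -
    have "Q0 d \<in> cob M" using QD d by blast
    then obtain a k where a: "a \<in> cob K" and k: "k \<in> chom M (Q0 (P0 a)) (Q0 d)" "ciso M k"
      using QP unfolding ff_ess_surj_def isomorphic_def by auto
    obtain k' where k': "k' \<in> chom M (Q0 d) (Q0 (P0 a))" "k' \<odot>\<^bsub>M\<^esub> k = cid M (Q0 (P0 a))" "k \<odot>\<^bsub>M\<^esub> k' = cid M (Q0 d)"
      using M.cisoE k by metis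
    have Pa: "P0 a \<in> cob L" using PD a by blast
    obtain h where h: "h \<in> chom L (P0 a) d" "Q1 h = k" using bij_betw_hit[OF bQ[OF Pa d] k(1)] by blast
    obtain h' where h': "h' \<in> chom L d (P0 a)" "Q1 h' = k'" using bij_betw_hit[OF bQ[OF d Pa] k'(1)] by blast
    have inj: "f = g" if "f \<in> chom L x y" "g \<in> chom L x y" "Q1 f = Q1 g" for f g x y
      using bQ[of x y] L.chom_obj[OF that(1)] that unfolding bij_betw_def inj_on_def by blast
    have "h' \<odot>\<^bsub>L\<^esub> h = cid L (P0 a)"
      using inj[OF L.comp_hom[OF h(1) h'(1)] L.id_hom[OF Pa]] QD(3)[OF Pa] QD(4)[OF h(1) h'(1)] h h' k' by simp
    moreover have "h \<odot>\<^bsub>L\<^esub> h' = cid L d"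
      using inj[OF L.comp_hom[OF h'(1) h(1)] L.id_hom[OF d]] QD(3)[OF d] QD(4)[OF h'(1) h(1)] h h' k' by simp
    ultimately show ?thesis using a L.isomorphicI L.cisoI h h' by blast
  qed
  ultimately show ?thesis unfolding ff_ess_surj_def using P by blast
qed

lemma ff_ess_surj_nat_iso:
  assumes K: "dagger_category K" and L: "dagger_category L"
    and P: "ff_ess_surj K L P0 P1" and Q: "cat_functor K L Q0 Q1"
    and \<kappa>: "nat_family K L P0 P1 Q0 Q1 \<kappa>" and iso: "\<And>a. a \<in> cob K \<Longrightarrow> ciso L (\<kappa> a)"
  shows "ff_ess_surj K L Q0 Q1"
proof -
  interpret K: dagger_category K by fact
  interpret L: dagger_category L by fact
  have Pf: "cat_functor K L P0 P1" using P unfolding ff_ess_surj_def by blast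
  note PD = cat_functorD[OF Pf] and QD = cat_functorD[OF Q]
  have \<kappa>h: "\<kappa> a \<in> chom L (P0 a) (Q0 a)" if "a \<in> cob K" for a
    using \<kappa> that unfolding nat_family_def by simp
  have \<kappa>n: "\<kappa> b \<odot>\<^bsub>L\<^esub> P1 f = Q1 f \<odot>\<^bsub>L\<^esub> \<kappa> a" if "f \<in> chom K a b" for f a b
    using \<kappa> that unfolding nat_family_def by auto
  have "bij_betw Q1 (chom K a b) (chom L (Q0 a) (Q0 b))" if ab: "a \<in> cob K" "b \<in> cob K" for a b
  proof -
    have bP: "bij_betw P1 (chom K a b) (chom L (P0 a) (P0 b))" by (rule ff_ess_surjD(2)[OF P ab])
    have "inj_on Q1 (chom K a b)"
    proof (rule inj_onI)
      fix f g assume f: "f \<in> chom K a b" "g \<in> chom K a b" "Q1 f = Q1 g"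
      then have "\<kappa> b \<odot>\<^bsub>L\<^esub> P1 f = \<kappa> b \<odot>\<^bsub>L\<^esub> P1 g" using \<kappa>n by metis
      then have "P1 f = P1 g" using L.iso_cancel_left[OF iso \<kappa>h] PD f ab by blast
      then show "f = g" using bP f unfolding bij_betw_def inj_on_def by blast
    qed
    moreover have "h \<in> Q1 ` chom K a b" if h: "h \<in> chom L (Q0 a) (Q0 b)" for h
    proof -
      obtain k where k: "k \<in> chom L (Q0 b) (P0 b)" "\<kappa> b \<odot>\<^bsub>L\<^esub> k = cid L (Q0 b)"
        using L.cisoE[OF iso \<kappa>h] ab by metis
      have h\<kappa>: "h \<odot>\<^bsub>L\<^esub> \<kappa> a \<in> chom L (P0 a) (Q0 b)" using L.comp_hom \<kappa>h ab h by blast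
      then have "k \<odot>\<^bsub>L\<^esub> (h \<odot>\<^bsub>L\<^esub> \<kappa> a) \<in> chom L (P0 a) (P0 b)" using L.comp_hom k by blast
      then obtain f where f: "f \<in> chom K a b" "P1 f = k \<odot>\<^bsub>L\<^esub> (h \<odot>\<^bsub>L\<^esub> \<kappa> a)"
        using bij_betw_hit[OF bP] by blast
      have "\<kappa> b \<odot>\<^bsub>L\<^esub> P1 f = h \<odot>\<^bsub>L\<^esub> \<kappa> a"
        unfolding f(2) using L.comp_assoc[OF h\<kappa> k(1) \<kappa>h[OF ab(2)]] k(2) L.comp_id[OF h\<kappa>] by simp
      then have "Q1 f \<odot>\<^bsub>L\<^esub> \<kappa> a = h \<odot>\<^bsub>L\<^esub> \<kappa> a" using \<kappa>n f by metis
      then have "Q1 f = h" using L.iso_cancel_right[OF iso \<kappa>h] QD f h ab by blast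
      then show ?thesis using f by blast
    qed
    ultimately show ?thesis unfolding bij_betw_def using QD by blast
  qed
  moreover have "\<exists>a\<in>cob K. isomorphic L (Q0 a) d" if d: "d \<in> cob L" for d
  proof -
    obtain a where a: "a \<in> cob K" "isomorphic L (P0 a) d" using ff_ess_surjD(3)[OF P d] by blast
    then have "isomorphic L (Q0 a) (P0 a)" using L.isomorphicI[OF \<kappa>h iso, THEN L.isomorphic_sym] by blast
    then show ?thesis using a(1) L.isomorphic_trans[OF _ a(2)] by blast
  qed
  ultimately show ?thesis unfolding ff_ess_surj_def using Q by blast
qed

lemma ff_ess_surj_id: "dagger_category K \<Longrightarrow> ff_ess_surj K K id id"
proof -
  assume "dagger_category K"
  then interpret dagger_category K .
  have "isomorphic K d d" if "d \<in> cob K" for d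
    by (rule isomorphicI[OF id_hom[OF that] cisoI[OF id_hom[OF that] id_hom[OF that]]])
      (use comp_id[OF id_hom[OF that]] in auto)
  then show ?thesis unfolding ff_ess_surj_def cat_functor_def by auto
qed

text \<open>With a quasi-inverse \<open>R\<close> of \<open>P\<close>, the functor \<open>Q\<close> is isomorphic to \<open>(Q \<circ> P) \<circ> R\<close>.\<close>

lemma ff_ess_surj_cancel_right:
  assumes K: "dagger_category K" and L: "dagger_category L" and M: "dagger_category M"
    and P: "ff_ess_surj K L P0 P1" and Q: "cat_functor L M Q0 Q1" and QP: "ff_ess_surj K M (Q0 \<circ> P0) (Q1 \<circ> P1)"
  shows "ff_ess_surj L M Q0 Q1"
proof -
  interpret L: dagger_category L by fact
  obtain R0 R1 \<epsilon> where R: "cat_functor L K R0 R1"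
    and \<epsilon>: "nat_family L L (P0 \<circ> R0) (P1 \<circ> R1) id id \<epsilon>" "\<And>b. b \<in> cob L \<Longrightarrow> ciso L (\<epsilon> b)"
    using ff_ess_surj_imp_cat_equivalence[OF K L P] unfolding cat_equivalence_def by blast
  have PR: "cat_functor L L (P0 \<circ> R0) (P1 \<circ> R1)" by (rule cat_functor_comp[OF R ff_ess_surjD(1)[OF P]])
  have \<epsilon>h: "\<epsilon> a \<in> chom L (P0 (R0 a)) a" if "a \<in> cob L" for a
    using \<epsilon>(1) that unfolding nat_family_def by simp
  have \<epsilon>n: "\<epsilon> b \<odot>\<^bsub>L\<^esub> P1 (R1 f) = f \<odot>\<^bsub>L\<^esub> \<epsilon> a" if "f \<in> chom L a b" for f a b
    using \<epsilon>(1) that unfolding nat_family_def by auto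
  have PRf: "P1 (R1 f) \<in> chom L (P0 (R0 a)) (P0 (R0 b))" if "f \<in> chom L a b" for f a b
    using cat_functorD(2)[OF PR that] by simp
  have "\<forall>b. \<exists>k. b \<in> cob L \<longrightarrow> k \<in> chom L b (P0 (R0 b)) \<and> k \<odot>\<^bsub>L\<^esub> \<epsilon> b = cid L (P0 (R0 b)) \<and> \<epsilon> b \<odot>\<^bsub>L\<^esub> k = cid L b"
    using L.cisoE[OF \<epsilon>(2) \<epsilon>h] by metis
  then obtain k where k: "\<And>b. b \<in> cob L \<Longrightarrow> k b \<in> chom L b (P0 (R0 b))"
      "\<And>b. b \<in> cob L \<Longrightarrow> k b \<odot>\<^bsub>L\<^esub> \<epsilon> b = cid L (P0 (R0 b))" "\<And>b. b \<in> cob L \<Longrightarrow> \<epsilon> b \<odot>\<^bsub>L\<^esub> k b = cid L b"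
    by metis
  have kn: "k b \<odot>\<^bsub>L\<^esub> f = P1 (R1 f) \<odot>\<^bsub>L\<^esub> k a" if f: "f \<in> chom L a b" for f a b
  proof (rule L.iso_cancel_left)
    have o: "a \<in> cob L" "b \<in> cob L" using L.chom_obj f by blast+
    show "ciso L (\<epsilon> b)" "\<epsilon> b \<in> chom L (P0 (R0 b)) b" using \<epsilon>(2) \<epsilon>h o by blast+
    show "k b \<odot>\<^bsub>L\<^esub> f \<in> chom L a (P0 (R0 b))" by (rule L.comp_hom[OF f k(1)[OF o(2)]])
    show "P1 (R1 f) \<odot>\<^bsub>L\<^esub> k a \<in> chom L a (P0 (R0 b))" by (rule L.comp_hom[OF k(1)[OF o(1)] PRf[OF f]])
    have "\<epsilon> b \<odot>\<^bsub>L\<^esub> k b \<odot>\<^bsub>L\<^esub> f = f"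
      using L.comp_assoc[OF f k(1)[OF o(2)] \<epsilon>h[OF o(2)]] k(3)[OF o(2)] L.comp_id[OF f] by simp
    moreover have "\<epsilon> b \<odot>\<^bsub>L\<^esub> P1 (R1 f) \<odot>\<^bsub>L\<^esub> k a = f"
      using L.comp_assoc[OF k(1)[OF o(1)] PRf[OF f] \<epsilon>h[OF o(2)]] \<epsilon>n[OF f]
        L.comp_assoc[OF k(1)[OF o(1)] \<epsilon>h[OF o(1)] f] k(3)[OF o(1)] L.comp_id[OF f] by simp
    ultimately show "\<epsilon> b \<odot>\<^bsub>L\<^esub> k b \<odot>\<^bsub>L\<^esub> f = \<epsilon> b \<odot>\<^bsub>L\<^esub> P1 (R1 f) \<odot>\<^bsub>L\<^esub> k a" by simp
  qed
  have "ff_ess_surj L L (P0 \<circ> R0) (P1 \<circ> R1)"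
  proof (rule ff_ess_surj_nat_iso[OF L L ff_ess_surj_id[OF L] PR])
    show "nat_family L L id id (P0 \<circ> R0) (P1 \<circ> R1) k"
      unfolding nat_family_def using k(1) kn by simp
    show "ciso L (k a)" if "a \<in> cob L" for a
      by (rule L.cisoI[OF k(1)[OF that] \<epsilon>h[OF that] k(3)[OF that] k(2)[OF that]])
  qed
  then have "ff_ess_surj L K R0 R1" by (rule ff_ess_surj_cancel_left[OF L K L R P])
  then have QPR: "ff_ess_surj L M ((Q0 \<circ> P0) \<circ> R0) ((Q1 \<circ> P1) \<circ> R1)" using QP by (rule ff_ess_surj_comp[OF K M])
  show ?thesis
  proof (rule ff_ess_surj_nat_iso[OF L M QPR Q])
    show "nat_family L M ((Q0 \<circ> P0) \<circ> R0) ((Q1 \<circ> P1) \<circ> R1) Q0 Q1 (\<lambda>a. Q1 (\<epsilon> a))"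
      unfolding nat_family_def
    proof (intro conjI ballI allI)
      fix a assume "a \<in> cob L"
      then show "Q1 (\<epsilon> a) \<in> chom M (((Q0 \<circ> P0) \<circ> R0) a) (Q0 a)" using cat_functorD(2)[OF Q \<epsilon>h] by simp
    next
      fix a b f assume f: "f \<in> chom L a b"
      have o: "a \<in> cob L" "b \<in> cob L" using L.chom_obj f by blast+
      show "Q1 (\<epsilon> b) \<odot>\<^bsub>M\<^esub> ((Q1 \<circ> P1) \<circ> R1) f = Q1 f \<odot>\<^bsub>M\<^esub> Q1 (\<epsilon> a)"
        using cat_functorD(4)[OF Q PRf[OF f] \<epsilon>h[OF o(2)]] cat_functorD(4)[OF Q \<epsilon>h[OF o(1)] f] \<epsilon>n[OF f] by simp
    qed
    show "ciso M (Q1 (\<epsilon> a))" if "a \<in> cob L" for a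
      by (rule cat_functor_ciso[OF L M Q \<epsilon>(2)[OF that] \<epsilon>h[OF that]])
  qed
qed

section \<open>Calculus in a dagger 2-category\<close>

text \<open>The side conditions of the composition laws are restated with the functions \<open>dom2\<close>, \<open>cod2\<close>, \<open>src\<close>, \<open>trg\<close> in
  place of hom sets: the simplifier can then compute the boundary of a composite and discharge them.\<close>

named_theorems typing

context dagger_2category
begin

lemma chom_hom_cat: "a \<in> Ob C \<Longrightarrow> b \<in> Ob C \<Longrightarrow> X \<in> hom1 C a b \<Longrightarrow> chom (hom_cat C a b) X Y = hom2 C X Y"
  unfolding chom_def hom_cat_def hom1_def hom2_def using two_one by auto

lemma hom_cat_sel:
  "cob (hom_cat C a b) = hom1 C a b" "cid (hom_cat C a b) = id2 C" "ccomp (hom_cat C a b) = vcomp C"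
  "czero (hom_cat C a b) = zero2 C" "cadd (hom_cat C a b) = add2 C"
  "cscale (hom_cat C a b) = scale2 C" "cdag (hom_cat C a b) = dagger C"
  "cdom (hom_cat C a b) = dom2 C" "ccod (hom_cat C a b) = cod2 C"
  by (simp_all add: hom_cat_def)

lemma two_chom:
  "f \<in> TwoM C \<Longrightarrow> f \<in> chom (hom_cat C (src C (dom2 C f)) (trg C (dom2 C f))) (dom2 C f) (cod2 C f)"
  unfolding chom_def hom_cat_def hom1_def using two_one by auto

lemma chomD:
  "f \<in> chom (hom_cat C a b) X Y \<Longrightarrow> f \<in> TwoM C \<and> dom2 C f = X \<and> cod2 C f = Y \<and>
     X \<in> OneM C \<and> src C X = a \<and> trg C X = b \<and> Y \<in> OneM C \<and> src C Y = a \<and> trg C Y = b"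
  unfolding chom_def hom_cat_def hom1_def by auto

lemma two_dagger_cat: "f \<in> TwoM C \<Longrightarrow> dagger_category (hom_cat C (src C (dom2 C f)) (trg C (dom2 C f)))"
  using hom_cat two_one one_obj by blast

lemma src_trg [typing]:
  "X \<in> OneM C \<Longrightarrow> src C X \<in> Ob C" "X \<in> OneM C \<Longrightarrow> trg C X \<in> Ob C"
  using one_obj by blast+

lemma dom_cod [typing]:
  "f \<in> TwoM C \<Longrightarrow> dom2 C f \<in> OneM C" "f \<in> TwoM C \<Longrightarrow> cod2 C f \<in> OneM C"
  "f \<in> TwoM C \<Longrightarrow> src C (cod2 C f) = src C (dom2 C f)" "f \<in> TwoM C \<Longrightarrow> trg C (cod2 C f) = trg C (dom2 C f)"
  using two_one by blast+

lemma unit_typing [typing]: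
  assumes "a \<in> Ob C"
  shows "unit1 C a \<in> OneM C" "src C (unit1 C a) = a" "trg C (unit1 C a) = a"
  using unit1_hom assms unfolding hom1_def by auto

lemma tensor_typing [typing]:
  assumes "X \<in> OneM C" "Y \<in> OneM C" "trg C X = src C Y"
  shows "X \<otimes> Y \<in> OneM C" "src C (X \<otimes> Y) = src C X" "trg C (X \<otimes> Y) = trg C Y"
  using tensor_hom[of X "src C X" "trg C X" Y "trg C Y"] assms unfolding hom1_def by auto

lemma id_typing [typing]:
  assumes "X \<in> OneM C"
  shows "id2 C X \<in> TwoM C" "dom2 C (id2 C X) = X" "cod2 C (id2 C X) = X"
proof -
  interpret K: dagger_category "hom_cat C (src C X) (trg C X)" using hom_cat one_obj assms by blast
  show "id2 C X \<in> TwoM C" "dom2 C (id2 C X) = X" "cod2 C (id2 C X) = X"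
    using K.id_hom[of X] assms unfolding hom_cat_sel hom1_def by (auto dest: chomD)
qed

lemma dagger_typing [typing]:
  assumes "f \<in> TwoM C"
  shows "f\<dagger> \<in> TwoM C" "dom2 C (f\<dagger>) = cod2 C f" "cod2 C (f\<dagger>) = dom2 C f"
  using dagger_category.dag_hom[OF two_dagger_cat two_chom, OF assms assms]
  unfolding hom_cat_sel by (auto dest: chomD)

lemma two_chom': "f \<in> TwoM C \<Longrightarrow> dom2 C f = X \<Longrightarrow> cod2 C f = Y \<Longrightarrow> src C X = a \<Longrightarrow> trg C X = b \<Longrightarrow>
    f \<in> chom (hom_cat C a b) X Y"
  using two_chom by blast

lemma vcomp_typing [typing]:
  assumes "f \<in> TwoM C" "g \<in> TwoM C" "dom2 C g = cod2 C f"
  shows "g \<cdot> f \<in> TwoM C" "dom2 C (g \<cdot> f) = dom2 C f" "cod2 C (g \<cdot> f) = cod2 C g"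
proof -
  have "g \<in> chom (hom_cat C (src C (dom2 C f)) (trg C (dom2 C f))) (cod2 C f) (cod2 C g)"
    using assms dom_cod by (intro two_chom') auto
  then show "g \<cdot> f \<in> TwoM C" "dom2 C (g \<cdot> f) = dom2 C f" "cod2 C (g \<cdot> f) = cod2 C g"
    using dagger_category.comp_hom[OF two_dagger_cat two_chom, OF assms(1,1)]
    unfolding hom_cat_sel by (auto dest: chomD)
qed

lemma hcomp_typing [typing]:
  assumes "f \<in> TwoM C" "g \<in> TwoM C" "trg C (dom2 C f) = src C (dom2 C g)"
  shows "f \<star> g \<in> TwoM C" "dom2 C (f \<star> g) = dom2 C f \<otimes> dom2 C g" "cod2 C (f \<star> g) = cod2 C f \<otimes> cod2 C g"
  using hcomp_hom[OF assms(3), of f "cod2 C f" g "cod2 C g"] assms unfolding hom2_def by auto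

lemma assoc_typing [typing]:
  assumes "X \<in> OneM C" "Y \<in> OneM C" "Z \<in> OneM C" "trg C X = src C Y" "trg C Y = src C Z"
  shows "assoc C X Y Z \<in> TwoM C" "dom2 C (assoc C X Y Z) = (X \<otimes> Y) \<otimes> Z"
    "cod2 C (assoc C X Y Z) = X \<otimes> (Y \<otimes> Z)"
  using assoc_hom[of X "src C X" "trg C X" Y "trg C Y" Z "trg C Z"] assms unfolding hom1_def hom2_def by auto

lemma lun_typing [typing]:
  assumes "X \<in> OneM C"
  shows "lun C X \<in> TwoM C" "dom2 C (lun C X) = unit1 C (src C X) \<otimes> X" "cod2 C (lun C X) = X"
  using lun_hom[of X "src C X" "trg C X"] assms unfolding hom1_def hom2_def by auto

lemma run_typing [typing]:
  assumes "X \<in> OneM C"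
  shows "run C X \<in> TwoM C" "dom2 C (run C X) = X \<otimes> unit1 C (trg C X)" "cod2 C (run C X) = X"
  using run_hom[of X "src C X" "trg C X"] assms unfolding hom1_def hom2_def by auto

lemma vcomp_assoc:
  assumes "f \<in> TwoM C" "g \<in> TwoM C" "h \<in> TwoM C" "dom2 C g = cod2 C f" "dom2 C h = cod2 C g"
  shows "(h \<cdot> g) \<cdot> f = h \<cdot> (g \<cdot> f)"
proof -
  let ?K = "hom_cat C (src C (dom2 C f)) (trg C (dom2 C f))"
  have "g \<in> chom ?K (cod2 C f) (cod2 C g)" "h \<in> chom ?K (cod2 C g) (cod2 C h)"
    using assms dom_cod by (auto intro!: two_chom')
  then show ?thesis
    using dagger_category.comp_assoc[OF two_dagger_cat two_chom, OF assms(1,1)]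
    unfolding hom_cat_sel by blast
qed

lemma vcomp_id:
  assumes "f \<in> TwoM C"
  shows "dom2 C f = X \<Longrightarrow> f \<cdot> id2 C X = f" "cod2 C f = X \<Longrightarrow> id2 C X \<cdot> f = f"
  using dagger_category.comp_id[OF two_dagger_cat two_chom, OF assms assms] unfolding hom_cat_sel by auto

lemma dagger_dagger: "f \<in> TwoM C \<Longrightarrow> (f\<dagger>)\<dagger> = f"
  using dagger_category.dag_dag[OF two_dagger_cat two_chom] unfolding hom_cat_sel by auto

lemma dagger_id: "X \<in> OneM C \<Longrightarrow> (id2 C X)\<dagger> = id2 C X"
  using dagger_category.dag_id[OF hom_cat, of "src C X" "trg C X" X] one_obj
  unfolding hom_cat_sel hom1_def by auto

lemma dagger_vcomp:
  assumes "f \<in> TwoM C" "g \<in> TwoM C" "dom2 C g = cod2 C f"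
  shows "(g \<cdot> f)\<dagger> = f\<dagger> \<cdot> g\<dagger>"
proof -
  let ?K = "hom_cat C (src C (dom2 C f)) (trg C (dom2 C f))"
  have "g \<in> chom ?K (cod2 C f) (cod2 C g)" using assms dom_cod by (auto intro!: two_chom')
  then show ?thesis
    using dagger_category.dag_comp[OF two_dagger_cat two_chom, OF assms(1,1)]
    unfolding hom_cat_sel by blast
qed

lemma dagger_hcomp:
  assumes "f \<in> TwoM C" "g \<in> TwoM C" "trg C (dom2 C f) = src C (dom2 C g)"
  shows "(f \<star> g)\<dagger> = f\<dagger> \<star> g\<dagger>"
  using hcomp_dagger[OF assms(3), of f "cod2 C f" g "cod2 C g"] assms unfolding hom2_def by auto

lemma hcomp_id': "X \<in> OneM C \<Longrightarrow> Y \<in> OneM C \<Longrightarrow> trg C X = src C Y \<Longrightarrow> id2 C X \<star> id2 C Y = id2 C (X \<otimes> Y)"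
  using hcomp_id[of X "src C X" "trg C X" Y "trg C Y"] unfolding hom1_def by auto

lemma interchange':
  assumes "f \<in> TwoM C" "f' \<in> TwoM C" "g \<in> TwoM C" "g' \<in> TwoM C" "dom2 C f' = cod2 C f" "dom2 C g' = cod2 C g"
    "trg C (dom2 C f) = src C (dom2 C g)"
  shows "(f' \<star> g') \<cdot> (f \<star> g) = (f' \<cdot> f) \<star> (g' \<cdot> g)"
  using interchange[OF assms(7), of f "cod2 C f" f' "cod2 C f'" g "cod2 C g" g' "cod2 C g'"] assms
  unfolding hom2_def by auto

lemma vcomp_extend:
  assumes "p \<cdot> q = r" "p \<in> TwoM C" "q \<in> TwoM C" "dom2 C p = cod2 C q" "k \<in> TwoM C" "cod2 C k = dom2 C q"
  shows "p \<cdot> (q \<cdot> k) = r \<cdot> k"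
  using vcomp_assoc[of k q p] assms by simp

text \<open>Apply a commuting square inside a composite bracketed to the right.\<close>

lemma vcomp_square:
  assumes "p \<cdot> q = r \<cdot> s" "p \<in> TwoM C" "q \<in> TwoM C" "r \<in> TwoM C" "s \<in> TwoM C" "k \<in> TwoM C"
    "dom2 C p = cod2 C q" "dom2 C r = cod2 C s" "cod2 C k = dom2 C q" "cod2 C k = dom2 C s"
  shows "p \<cdot> (q \<cdot> k) = r \<cdot> (s \<cdot> k)"
  using vcomp_extend[OF assms(1,2,3,7,6,9)] vcomp_assoc[OF assms(6,5,4) assms(10)[symmetric] assms(8)] by simp

lemma hcomp_lwhisker:
  assumes "X \<in> OneM C" "f \<in> TwoM C" "g \<in> TwoM C" "dom2 C g = cod2 C f" "trg C X = src C (dom2 C f)"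
  shows "id2 C X \<star> (g \<cdot> f) = (id2 C X \<star> g) \<cdot> (id2 C X \<star> f)"
  using assms by (simp add: interchange' typing vcomp_id)

lemma hcomp_rwhisker:
  assumes "X \<in> OneM C" "f \<in> TwoM C" "g \<in> TwoM C" "dom2 C g = cod2 C f" "src C X = trg C (dom2 C f)"
  shows "(g \<cdot> f) \<star> id2 C X = (g \<star> id2 C X) \<cdot> (f \<star> id2 C X)"
  using assms by (simp add: interchange' typing vcomp_id)

lemma hcomp_lr:
  assumes "f \<in> TwoM C" "g \<in> TwoM C" "trg C (dom2 C f) = src C (dom2 C g)" "cod2 C f = X'" "dom2 C g = Y"
  shows "(id2 C X' \<star> g) \<cdot> (f \<star> id2 C Y) = f \<star> g"
  using assms dom_cod[OF assms(1)] by (auto simp add: interchange' typing vcomp_id)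

lemma hcomp_rl:
  assumes "f \<in> TwoM C" "g \<in> TwoM C" "trg C (dom2 C f) = src C (dom2 C g)" "dom2 C f = X" "cod2 C g = Y'"
  shows "(f \<star> id2 C Y') \<cdot> (id2 C X \<star> g) = f \<star> g"
  using assms dom_cod[OF assms(2)] by (auto simp add: interchange' typing vcomp_id)

lemma whisker_swap:
  assumes "f \<in> TwoM C" "g \<in> TwoM C" "trg C (dom2 C f) = src C (dom2 C g)" "dom2 C f = X" "cod2 C f = X'"
    "dom2 C g = Y" "cod2 C g = Y'"
  shows "(f \<star> id2 C Y') \<cdot> (id2 C X \<star> g) = (id2 C X' \<star> g) \<cdot> (f \<star> id2 C Y)"
  using hcomp_lr[of f g X' Y] hcomp_rl[of f g X Y'] assms by simp

lemma unitary2D: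
  "unitary2 C f \<Longrightarrow> f\<dagger> \<cdot> f = id2 C (dom2 C f)" "unitary2 C f \<Longrightarrow> f \<cdot> f\<dagger> = id2 C (cod2 C f)"
  unfolding unitary2_def by auto

lemma assoc_inv:
  assumes "X \<in> OneM C" "Y \<in> OneM C" "Z \<in> OneM C" "trg C X = src C Y" "trg C Y = src C Z"
  shows "(assoc C X Y Z)\<dagger> \<cdot> assoc C X Y Z = id2 C ((X \<otimes> Y) \<otimes> Z)"
    "assoc C X Y Z \<cdot> (assoc C X Y Z)\<dagger> = id2 C (X \<otimes> (Y \<otimes> Z))"
  using assoc_hom[of X "src C X" "trg C X" Y "trg C Y" Z "trg C Z"] unitary2D[of "assoc C X Y Z"] assms
  by (auto simp: typing hom1_def)

lemma lun_inv:
  assumes "X \<in> OneM C"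
  shows "(lun C X)\<dagger> \<cdot> lun C X = id2 C (unit1 C (src C X) \<otimes> X)" "lun C X \<cdot> (lun C X)\<dagger> = id2 C X"
  using lun_hom[of X "src C X" "trg C X"] unitary2D[of "lun C X"] assms by (auto simp: typing hom1_def)

lemma run_inv:
  assumes "X \<in> OneM C"
  shows "(run C X)\<dagger> \<cdot> run C X = id2 C (X \<otimes> unit1 C (trg C X))" "run C X \<cdot> (run C X)\<dagger> = id2 C X"
  using run_hom[of X "src C X" "trg C X"] unitary2D[of "run C X"] assms by (auto simp: typing hom1_def)

lemma lun_nat':
  assumes "f \<in> TwoM C" "dom2 C f = X" "cod2 C f = Y" "src C X = a"
  shows "lun C Y \<cdot> (id2 C (unit1 C a) \<star> f) = f \<cdot> lun C X"
  using lun_nat[of f X Y] assms unfolding hom2_def by auto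

lemma run_nat':
  assumes "f \<in> TwoM C" "dom2 C f = X" "cod2 C f = Y" "trg C X = b"
  shows "run C Y \<cdot> (f \<star> id2 C (unit1 C b)) = f \<cdot> run C X"
  using run_nat[of f X Y] assms unfolding hom2_def by auto

lemma assoc_nat':
  assumes "f \<in> TwoM C" "g \<in> TwoM C" "h \<in> TwoM C" "dom2 C f = X" "dom2 C g = Y" "dom2 C h = Z"
    "cod2 C f = X'" "cod2 C g = Y'" "cod2 C h = Z'" "trg C X = src C Y" "trg C Y = src C Z"
  shows "assoc C X' Y' Z' \<cdot> ((f \<star> g) \<star> h) = (f \<star> (g \<star> h)) \<cdot> assoc C X Y Z"
  using assoc_nat[of X Y Z f X' g Y' h Z'] assms unfolding hom2_def by auto

lemma vcomp_cancel_right: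
  assumes "f \<cdot> h = g \<cdot> h" "h \<cdot> k = id2 C X" "f \<in> TwoM C" "g \<in> TwoM C" "h \<in> TwoM C" "k \<in> TwoM C"
    "dom2 C f = X" "dom2 C g = X" "cod2 C h = X" "cod2 C k = dom2 C h"
  shows "f = g"
proof -
  have "f \<cdot> (h \<cdot> k) = g \<cdot> (h \<cdot> k)"
    using vcomp_assoc[of k h f] vcomp_assoc[of k h g] assms by simp
  then show ?thesis using assms by (simp add: vcomp_id)
qed

lemma vcomp_cancel_left:
  assumes "h \<cdot> f = h \<cdot> g" "k \<cdot> h = id2 C X" "f \<in> TwoM C" "g \<in> TwoM C" "h \<in> TwoM C" "k \<in> TwoM C"
    "cod2 C f = X" "cod2 C g = X" "dom2 C h = X" "dom2 C k = cod2 C h"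
  shows "f = g"
proof -
  have "(k \<cdot> h) \<cdot> f = (k \<cdot> h) \<cdot> g"
    using vcomp_assoc[of f h k] vcomp_assoc[of g h k] assms by simp
  then show ?thesis using assms by (simp add: vcomp_id)
qed

lemma lun_dag_nat:
  assumes "f \<in> TwoM C" "dom2 C f = X" "cod2 C f = Y" "src C X = a"
  shows "(id2 C (unit1 C a) \<star> f) \<cdot> (lun C X)\<dagger> = (lun C Y)\<dagger> \<cdot> f"
proof -
  have X: "X \<in> OneM C" "Y \<in> OneM C" "src C Y = a" "a \<in> Ob C" using assms dom_cod src_trg by auto
  have "(lun C X \<cdot> (id2 C (unit1 C a) \<star> f\<dagger>))\<dagger> = (f\<dagger> \<cdot> lun C Y)\<dagger>"
    using lun_nat'[of "f\<dagger>" Y X a] assms X by (simp add: typing)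
  then show ?thesis using assms X by (simp add: typing dagger_vcomp dagger_hcomp dagger_id dagger_dagger)
qed

lemma run_dag_nat:
  assumes "f \<in> TwoM C" "dom2 C f = X" "cod2 C f = Y" "trg C X = b"
  shows "(f \<star> id2 C (unit1 C b)) \<cdot> (run C X)\<dagger> = (run C Y)\<dagger> \<cdot> f"
proof -
  have X: "X \<in> OneM C" "Y \<in> OneM C" "trg C Y = b" "b \<in> Ob C" using assms dom_cod src_trg by auto
  have "(run C X \<cdot> (f\<dagger> \<star> id2 C (unit1 C b)))\<dagger> = (f\<dagger> \<cdot> run C Y)\<dagger>"
    using run_nat'[of "f\<dagger>" Y X b] assms X by (simp add: typing)
  then show ?thesis using assms X by (simp add: typing dagger_vcomp dagger_hcomp dagger_id dagger_dagger)
qed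

lemma assoc_dag_nat:
  assumes "f \<in> TwoM C" "g \<in> TwoM C" "h \<in> TwoM C" "dom2 C f = X" "dom2 C g = Y" "dom2 C h = Z"
    "cod2 C f = X'" "cod2 C g = Y'" "cod2 C h = Z'" "trg C X = src C Y" "trg C Y = src C Z"
  shows "(assoc C X' Y' Z')\<dagger> \<cdot> (f \<star> (g \<star> h)) = ((f \<star> g) \<star> h) \<cdot> (assoc C X Y Z)\<dagger>"
proof -
  have X: "X \<in> OneM C" "Y \<in> OneM C" "Z \<in> OneM C" "X' \<in> OneM C" "Y' \<in> OneM C" "Z' \<in> OneM C"
    "src C X' = src C X" "trg C X' = trg C X" "src C Y' = src C Y" "trg C Y' = trg C Y" "src C Z' = src C Z"
    using assms dom_cod src_trg by auto
  have "(assoc C X Y Z \<cdot> ((f\<dagger> \<star> g\<dagger>) \<star> h\<dagger>))\<dagger> = ((f\<dagger> \<star> (g\<dagger> \<star> h\<dagger>)) \<cdot> assoc C X' Y' Z')\<dagger>"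
    using assoc_nat'[of "f\<dagger>" "g\<dagger>" "h\<dagger>" X' Y' Z' X Y Z] assms X by (simp add: typing)
  then show ?thesis using assms X by (simp add: typing dagger_vcomp dagger_hcomp dagger_dagger)
qed

lemma assoc_nat_l:
  assumes "f \<in> TwoM C" "Y \<in> OneM C" "Z \<in> OneM C" "dom2 C f = X" "cod2 C f = X'" "trg C X = src C Y" "trg C Y = src C Z"
  shows "assoc C X' Y Z \<cdot> ((f \<star> id2 C Y) \<star> id2 C Z) = (f \<star> id2 C (Y \<otimes> Z)) \<cdot> assoc C X Y Z"
  using assoc_nat'[of f "id2 C Y" "id2 C Z" X Y Z X' Y Z] assms by (simp add: typing hcomp_id')

lemma assoc_nat_m:
  assumes "f \<in> TwoM C" "X \<in> OneM C" "Z \<in> OneM C" "dom2 C f = Y" "cod2 C f = Y'" "trg C X = src C Y" "trg C Y = src C Z"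
  shows "assoc C X Y' Z \<cdot> ((id2 C X \<star> f) \<star> id2 C Z) = (id2 C X \<star> (f \<star> id2 C Z)) \<cdot> assoc C X Y Z"
  using assoc_nat'[of "id2 C X" f "id2 C Z" X Y Z X Y' Z] assms by (simp add: typing)

lemma assoc_nat_r:
  assumes "f \<in> TwoM C" "X \<in> OneM C" "Y \<in> OneM C" "dom2 C f = Z" "cod2 C f = Z'" "trg C X = src C Y" "trg C Y = src C Z"
  shows "assoc C X Y Z' \<cdot> (id2 C (X \<otimes> Y) \<star> f) = (id2 C X \<star> (id2 C Y \<star> f)) \<cdot> assoc C X Y Z"
  using assoc_nat'[of "id2 C X" "id2 C Y" f X Y Z X Y Z'] assms by (simp add: typing hcomp_id')

lemma assoc_dag_nat_l:
  assumes "f \<in> TwoM C" "Y \<in> OneM C" "Z \<in> OneM C" "dom2 C f = X" "cod2 C f = X'" "trg C X = src C Y" "trg C Y = src C Z"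
  shows "(assoc C X' Y Z)\<dagger> \<cdot> (f \<star> id2 C (Y \<otimes> Z)) = ((f \<star> id2 C Y) \<star> id2 C Z) \<cdot> (assoc C X Y Z)\<dagger>"
  using assoc_dag_nat[of f "id2 C Y" "id2 C Z" X Y Z X' Y Z] assms by (simp add: typing hcomp_id')

lemma assoc_dag_nat_r:
  assumes "f \<in> TwoM C" "X \<in> OneM C" "Y \<in> OneM C" "dom2 C f = Z" "cod2 C f = Z'" "trg C X = src C Y" "trg C Y = src C Z"
  shows "(assoc C X Y Z')\<dagger> \<cdot> (id2 C X \<star> (id2 C Y \<star> f)) = (id2 C (X \<otimes> Y) \<star> f) \<cdot> (assoc C X Y Z)\<dagger>"
  using assoc_dag_nat[of "id2 C X" "id2 C Y" f X Y Z X Y Z'] assms by (simp add: typing hcomp_id')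

lemma triangle':
  assumes "X \<in> OneM C" "Y \<in> OneM C" "trg C X = src C Y" "trg C X = b"
  shows "(id2 C X \<star> lun C Y) \<cdot> assoc C X (unit1 C b) Y = run C X \<star> id2 C Y"
  using triangle[of X "src C X" b Y "trg C Y"] assms unfolding hom1_def by auto

lemma pentagon':
  assumes "W \<in> OneM C" "X \<in> OneM C" "Y \<in> OneM C" "Z \<in> OneM C"
    "trg C W = src C X" "trg C X = src C Y" "trg C Y = src C Z"
  shows "(id2 C W \<star> assoc C X Y Z) \<cdot> (assoc C W (X \<otimes> Y) Z \<cdot> (assoc C W X Y \<star> id2 C Z))
      = assoc C W X (Y \<otimes> Z) \<cdot> assoc C (W \<otimes> X) Y Z"
  using pentagon[of W "src C W" "trg C W" X "trg C X" Y "trg C Y" Z "trg C Z"] assms unfolding hom1_def by auto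

lemma unit_lwhisk_faithful:
  assumes "id2 C (unit1 C a) \<star> f = id2 C (unit1 C a) \<star> g" "f \<in> TwoM C" "g \<in> TwoM C"
    "dom2 C f = X" "dom2 C g = X" "cod2 C f = cod2 C g" "src C X = a"
  shows "f = g"
proof (rule vcomp_cancel_right[where h = "lun C X" and k = "(lun C X)\<dagger>" and X = X])
  have X: "X \<in> OneM C" using assms dom_cod src_trg by auto
  show "f \<cdot> lun C X = g \<cdot> lun C X" using lun_nat'[of f X "cod2 C f" a] lun_nat'[of g X "cod2 C f" a] assms by simp
qed (use assms dom_cod[of f] lun_inv[of X] in \<open>auto simp: typing\<close>)

lemma unit_rwhisk_faithful:
  assumes "f \<star> id2 C (unit1 C b) = g \<star> id2 C (unit1 C b)" "f \<in> TwoM C" "g \<in> TwoM C"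
    "dom2 C f = X" "dom2 C g = X" "cod2 C f = cod2 C g" "trg C X = b"
  shows "f = g"
proof (rule vcomp_cancel_right[where h = "run C X" and k = "(run C X)\<dagger>" and X = X])
  have X: "X \<in> OneM C" using assms dom_cod src_trg by auto
  show "f \<cdot> run C X = g \<cdot> run C X" using run_nat'[of f X "cod2 C f" b] run_nat'[of g X "cod2 C f" b] assms by simp
qed (use assms dom_cod[of f] run_inv[of X] in \<open>auto simp: typing\<close>)

text \<open>Kelly's lemma. Since \<open>1 \<otimes> -\<close> is faithful, the equation may be tensored with \<open>1\<close> on the left, where
  it follows from the pentagon and two triangles.\<close>

lemma lun_tensor:
  assumes X: "X \<in> OneM C" and Y: "Y \<in> OneM C" and XY: "trg C X = src C Y" and a: "src C X = a"
  shows "lun C (X \<otimes> Y) \<cdot> assoc C (unit1 C a) X Y = lun C X \<star> id2 C Y"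
proof (rule unit_lwhisk_faithful[where a = a and X = "(unit1 C a \<otimes> X) \<otimes> Y"])
  let ?I = "unit1 C a" let ?i = "id2 C (unit1 C a)"
  have I: "a \<in> Ob C" "?I \<in> OneM C" "src C ?I = a" "trg C ?I = a" using X a by (auto simp: typing)
  note T = X Y XY a I
  define S where "S = assoc C ?I (?I \<otimes> X) Y \<cdot> (assoc C ?I ?I X \<star> id2 C Y)"
  have S: "S \<in> TwoM C" "dom2 C S = ((?I \<otimes> ?I) \<otimes> X) \<otimes> Y" "cod2 C S = ?I \<otimes> ((?I \<otimes> X) \<otimes> Y)"
    unfolding S_def using T by (simp_all add: typing)
  have "(?i \<star> (lun C (X \<otimes> Y) \<cdot> assoc C ?I X Y)) \<cdot> S =
      (?i \<star> lun C (X \<otimes> Y)) \<cdot> ((?i \<star> assoc C ?I X Y) \<cdot> S)"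
    using T S by (simp add: typing hcomp_lwhisker vcomp_assoc)
  also have "\<dots> = (?i \<star> lun C (X \<otimes> Y)) \<cdot> (assoc C ?I ?I (X \<otimes> Y) \<cdot> assoc C (?I \<otimes> ?I) X Y)"
    unfolding S_def using T pentagon'[of ?I ?I X Y] by (simp add: typing)
  also have "\<dots> = (run C ?I \<star> id2 C (X \<otimes> Y)) \<cdot> assoc C (?I \<otimes> ?I) X Y"
    using T vcomp_extend[OF triangle'[of ?I "X \<otimes> Y" a]] by (simp add: typing)
  also have "\<dots> = assoc C ?I X Y \<cdot> ((run C ?I \<star> id2 C X) \<star> id2 C Y)"
    using T assoc_nat'[of "run C ?I" "id2 C X" "id2 C Y" "?I \<otimes> ?I" X Y ?I X Y] by (simp add: typing hcomp_id')
  also have "\<dots> = assoc C ?I X Y \<cdot> (((?i \<star> lun C X) \<star> id2 C Y) \<cdot> (assoc C ?I ?I X \<star> id2 C Y))"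
    using T triangle'[of ?I X a, symmetric] by (simp add: typing hcomp_rwhisker)
  also have "\<dots> = (?i \<star> (lun C X \<star> id2 C Y)) \<cdot> S"
    unfolding S_def
    using T vcomp_extend[OF assoc_nat'[of ?i "lun C X" "id2 C Y" ?I "?I \<otimes> X" Y ?I X Y]] by (simp add: typing vcomp_assoc)
  finally have e: "(?i \<star> (lun C (X \<otimes> Y) \<cdot> assoc C ?I X Y)) \<cdot> S = (?i \<star> (lun C X \<star> id2 C Y)) \<cdot> S" .
  show "?i \<star> (lun C (X \<otimes> Y) \<cdot> assoc C ?I X Y) = ?i \<star> (lun C X \<star> id2 C Y)"
  proof (rule vcomp_cancel_right[OF e, where k = "S\<dagger>"])
    have "assoc C ?I ?I X \<star> id2 C Y \<cdot> (assoc C ?I ?I X)\<dagger> \<star> id2 C Y = id2 C ((?I \<otimes> (?I \<otimes> X)) \<otimes> Y)"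
      using T by (simp add: typing interchange' assoc_inv vcomp_id hcomp_id')
    then show "S \<cdot> S\<dagger> = id2 C (?I \<otimes> ((?I \<otimes> X) \<otimes> Y))"
      unfolding S_def using T
      by (simp add: typing dagger_vcomp dagger_hcomp dagger_id vcomp_assoc vcomp_extend assoc_inv vcomp_id)
  qed (use T S in \<open>auto simp: typing\<close>)
qed (use X Y XY a in \<open>auto simp: typing\<close>)

text \<open>The mirror image of \<open>lun_tensor\<close>, tensored with \<open>1\<close> on the right.\<close>

lemma run_tensor:
  assumes X: "X \<in> OneM C" and Y: "Y \<in> OneM C" and XY: "trg C X = src C Y" and b: "trg C Y = b"
  shows "run C (X \<otimes> Y) = (id2 C X \<star> run C Y) \<cdot> assoc C X Y (unit1 C b)"
proof (rule unit_rwhisk_faithful[where b = b and X = "(X \<otimes> Y) \<otimes> unit1 C b"])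
  let ?I = "unit1 C b" let ?i = "id2 C (unit1 C b)"
  have I: "b \<in> Ob C" "?I \<in> OneM C" "src C ?I = b" "trg C ?I = b" using Y b by (auto simp: typing)
  note T = X Y XY b I
  let ?A = "assoc C X Y ?I"
  have "?A \<cdot> (run C (X \<otimes> Y) \<star> ?i) = ?A \<cdot> ((id2 C (X \<otimes> Y) \<star> lun C ?I) \<cdot> assoc C (X \<otimes> Y) ?I ?I)"
    using T triangle'[of "X \<otimes> Y" ?I b] by (simp add: typing)
  also have "\<dots> = (id2 C X \<star> (id2 C Y \<star> lun C ?I)) \<cdot> (assoc C X Y (?I \<otimes> ?I) \<cdot> assoc C (X \<otimes> Y) ?I ?I)"
    using T vcomp_extend[OF assoc_nat'[of "id2 C X" "id2 C Y" "lun C ?I" X Y "?I \<otimes> ?I" X Y ?I]]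
    by (simp add: typing vcomp_assoc hcomp_id')
  also have "\<dots> = (id2 C X \<star> (id2 C Y \<star> lun C ?I)) \<cdot> ((id2 C X \<star> assoc C Y ?I ?I) \<cdot>
      (assoc C X (Y \<otimes> ?I) ?I \<cdot> (?A \<star> ?i)))"
    using T pentagon'[of X Y ?I ?I] by simp
  also have "\<dots> = (id2 C X \<star> (run C Y \<star> ?i)) \<cdot> (assoc C X (Y \<otimes> ?I) ?I \<cdot> (?A \<star> ?i))"
    using T triangle'[of Y ?I b, symmetric] by (simp add: typing hcomp_lwhisker vcomp_assoc)
  also have "\<dots> = ?A \<cdot> (((id2 C X \<star> run C Y) \<star> ?i) \<cdot> (?A \<star> ?i))"
    using T vcomp_extend[OF assoc_nat'[of "id2 C X" "run C Y" ?i X "Y \<otimes> ?I" ?I X Y ?I]] by (simp add: typing vcomp_assoc)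
  also have "\<dots> = ?A \<cdot> (((id2 C X \<star> run C Y) \<cdot> ?A) \<star> ?i)"
    using T by (simp add: typing hcomp_rwhisker)
  finally have e: "?A \<cdot> (run C (X \<otimes> Y) \<star> ?i) = ?A \<cdot> (((id2 C X \<star> run C Y) \<cdot> ?A) \<star> ?i)" .
  show "run C (X \<otimes> Y) \<star> ?i = ((id2 C X \<star> run C Y) \<cdot> ?A) \<star> ?i"
    by (rule vcomp_cancel_left[OF e, where k = "?A\<dagger>" and X = "(X \<otimes> Y) \<otimes> ?I"])
      (use T in \<open>auto simp: typing assoc_inv\<close>)
qed (use X Y XY b in \<open>auto simp: typing\<close>)

text \<open>Naturality of \<open>lun\<close> at \<open>lun\<close> itself identifies \<open>1 \<otimes> lun\<close> with \<open>lun\<close> of \<open>1 \<otimes> 1\<close>; then compare Kelly's lemma with the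
  triangle.\<close>

lemma lun_unit_eq_run_unit:
  assumes a: "a \<in> Ob C"
  shows "lun C (unit1 C a) = run C (unit1 C a)"
proof -
  let ?I = "unit1 C a" let ?i = "id2 C (unit1 C a)" let ?A = "assoc C ?I ?I ?I"
  have I: "?I \<in> OneM C" "src C ?I = a" "trg C ?I = a" using a by (auto simp: typing)
  note T = a I
  have "lun C ?I \<cdot> (?i \<star> lun C ?I) = lun C ?I \<cdot> lun C (?I \<otimes> ?I)"
    using T lun_nat'[of "lun C ?I" "?I \<otimes> ?I" ?I a] by (simp add: typing)
  then have l: "?i \<star> lun C ?I = lun C (?I \<otimes> ?I)"
    by (rule vcomp_cancel_left[where k = "(lun C ?I)\<dagger>" and X = "?I \<otimes> ?I"]) (use T lun_inv[of ?I] in \<open>auto simp: typing\<close>)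
  have "lun C ?I \<star> ?i = run C ?I \<star> ?i"
    using lun_tensor[of ?I ?I a] triangle'[of ?I ?I a] l T by (simp add: typing)
  then show ?thesis
    by (rule unit_rwhisk_faithful[where b = a and X = "?I \<otimes> ?I"]) (use T in \<open>auto simp: typing\<close>)
qed

lemma unitary_dagger: "f \<in> TwoM C \<Longrightarrow> unitary2 C f \<Longrightarrow> unitary2 C (f\<dagger>)"
  unfolding unitary2_def by (simp add: typing dagger_dagger)

lemma unitary_comp:
  assumes "f \<in> TwoM C" "g \<in> TwoM C" "dom2 C g = cod2 C f" "unitary2 C f" "unitary2 C g"
  shows "unitary2 C (g \<cdot> f)"
proof -
  note u = assms(4,5)[unfolded unitary2_def]
  have "(f\<dagger> \<cdot> g\<dagger>) \<cdot> (g \<cdot> f) = f\<dagger> \<cdot> ((g\<dagger> \<cdot> g) \<cdot> f)" using assms(1-3) by (simp add: typing vcomp_assoc)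
  also have "\<dots> = id2 C (dom2 C f)" using u assms(1-3) by (simp add: typing vcomp_id)
  finally have 1: "(f\<dagger> \<cdot> g\<dagger>) \<cdot> (g \<cdot> f) = id2 C (dom2 C f)" .
  have "(g \<cdot> f) \<cdot> (f\<dagger> \<cdot> g\<dagger>) = g \<cdot> ((f \<cdot> f\<dagger>) \<cdot> g\<dagger>)" using assms(1-3) by (simp add: typing vcomp_assoc)
  also have "\<dots> = id2 C (cod2 C g)" using u assms(1-3) by (simp add: typing vcomp_id)
  finally show ?thesis using 1 assms(1-3) unfolding unitary2_def by (simp add: typing dagger_vcomp)
qed

lemma unitary_id: "X \<in> OneM C \<Longrightarrow> unitary2 C (id2 C X)"
  unfolding unitary2_def by (simp add: typing dagger_id vcomp_id)

lemma unitary_hcomp: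
  assumes "f \<in> TwoM C" "g \<in> TwoM C" "trg C (dom2 C f) = src C (dom2 C g)" "unitary2 C f" "unitary2 C g"
  shows "unitary2 C (f \<star> g)"
  using assms unfolding unitary2_def by (simp add: typing dagger_hcomp interchange' hcomp_id')

lemma unitary_struct:
  "X \<in> OneM C \<Longrightarrow> unitary2 C (lun C X)" "X \<in> OneM C \<Longrightarrow> unitary2 C (run C X)"
  "X \<in> OneM C \<Longrightarrow> Y \<in> OneM C \<Longrightarrow> Z \<in> OneM C \<Longrightarrow> trg C X = src C Y \<Longrightarrow> trg C Y = src C Z \<Longrightarrow>
    unitary2 C (assoc C X Y Z)"
  by (simp_all add: unitary2_def typing lun_inv run_inv assoc_inv)

lemmas unitary_intros = unitary_dagger unitary_comp unitary_id unitary_hcomp unitary_struct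

text \<open>A one-sided inverse of a unitary is its dagger; applied to the zigzag equations, this makes
  whiskered evaluations unitary.\<close>

lemma unitary_middle:
  assumes "p \<cdot> (q \<cdot> r) = id2 C X" "unitary2 C p" "unitary2 C r"
    "p \<in> TwoM C" "q \<in> TwoM C" "r \<in> TwoM C" "dom2 C q = cod2 C r" "dom2 C p = cod2 C q"
    "dom2 C r = X" "cod2 C p = X"
  shows "unitary2 C q"
proof -
  note u = unitary2D[OF assms(2)] unitary2D[OF assms(3)]
  have pq: "p\<dagger> \<in> TwoM C" "cod2 C (q \<cdot> r) = dom2 C p" "q \<cdot> r \<in> TwoM C" "r\<dagger> \<in> TwoM C"
      "cod2 C (r\<dagger>) = dom2 C r" "dom2 C (p\<dagger>) = cod2 C p" "cod2 C (p\<dagger>) = dom2 C p"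
    using assms(4-8) by (simp_all add: typing)
  have "q \<cdot> r = id2 C (dom2 C p) \<cdot> (q \<cdot> r)" using vcomp_id(2)[OF pq(3,2)] by simp
  also have "\<dots> = p\<dagger> \<cdot> (p \<cdot> (q \<cdot> r))" by (rule vcomp_extend[symmetric, OF u(1) pq(1) assms(4) pq(6,3,2)])
  also have "\<dots> = p\<dagger>" using assms(1,9,10) vcomp_id(1)[OF pq(1)] pq(6) by simp
  finally have "(q \<cdot> r) \<cdot> r\<dagger> = p\<dagger> \<cdot> r\<dagger>" by simp
  then have "q \<cdot> (r \<cdot> r\<dagger>) = p\<dagger> \<cdot> r\<dagger>" using vcomp_assoc[OF pq(4) assms(6,5)] pq(5) assms(7) by simp
  then have "q = p\<dagger> \<cdot> r\<dagger>" using u(4) vcomp_id(1)[OF assms(5)] assms(7) by simp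
  moreover have "unitary2 C (p\<dagger> \<cdot> r\<dagger>)"
    using assms(2,3,4,6) pq assms(9,10) by (intro unitary_comp unitary_dagger) auto
  ultimately show ?thesis by simp
qed

lemma unitary_iso2: "f \<in> TwoM C \<Longrightarrow> unitary2 C f \<Longrightarrow> iso2 C f"
  unfolding unitary2_def iso2_def hom2_def by (intro bexI[of _ "f\<dagger>"]) (simp_all add: typing)

lemma iso2E:
  assumes "iso2 C f" "f \<in> TwoM C"
  obtains g where "g \<in> TwoM C" "dom2 C g = cod2 C f" "cod2 C g = dom2 C f"
    "g \<cdot> f = id2 C (dom2 C f)" "f \<cdot> g = id2 C (cod2 C f)"
  using assms unfolding iso2_def hom2_def by auto

end

section \<open>Adjunctions\<close>

locale adjoint_pair = dagger_2category C
  for C :: "('o, 'm, 'c, 'z) two_cat_scheme" (structure) and X Xv e c +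
  assumes adj: "adjoint1 C X Xv e c"
begin

lemma adj_typing [typing]:
  "X \<in> OneM C" "Xv \<in> OneM C" "src C Xv = trg C X" "trg C Xv = src C X"
  "e \<in> TwoM C" "dom2 C e = Xv \<otimes> X" "cod2 C e = unit1 C (trg C X)"
  "c \<in> TwoM C" "dom2 C c = unit1 C (src C X)" "cod2 C c = X \<otimes> Xv"
  using adj unfolding adjoint1_def hom1_def hom2_def by auto

lemma zigzag:
  "run C X \<cdot> ((id2 C X \<star> e) \<cdot> (assoc C X Xv X \<cdot> ((c \<star> id2 C X) \<cdot> (lun C X)\<dagger>))) = id2 C X"
  "lun C Xv \<cdot> ((e \<star> id2 C Xv) \<cdot> ((assoc C Xv X Xv)\<dagger> \<cdot> ((id2 C Xv \<star> c) \<cdot> (run C Xv)\<dagger>))) = id2 C Xv"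
  using adj unfolding adjoint1_def by auto

text \<open>Inserting the first zigzag after \<open>A\<close> and sliding \<open>f\<close> past the cup expresses \<open>f\<close> through \<open>f \<otimes> Xv\<close>.
  In \<open>key\<close> the tail \<open>S\<close> collects what does not involve \<open>h\<close>.\<close>

lemma rwhisk_dual_faithful:
  assumes A: "A \<in> OneM C" "trg C A = src C X"
    and f: "f \<in> TwoM C" "dom2 C f = A \<otimes> X" and g: "g \<in> TwoM C" "dom2 C g = A \<otimes> X"
    and fg: "cod2 C f = cod2 C g" "f \<star> id2 C Xv = g \<star> id2 C Xv"
  shows "f = g"
proof -
  define S where "S = (id2 C A \<star> assoc C X Xv X) \<cdot> ((id2 C A \<star> (c \<star> id2 C X)) \<cdot> (id2 C A \<star> (lun C X)\<dagger>))"
  have S: "S \<in> TwoM C" "dom2 C S = A \<otimes> X" "cod2 C S = A \<otimes> (X \<otimes> (Xv \<otimes> X))"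
    unfolding S_def using A by (simp_all add: typing)
  define S' where "S' = (assoc C A X (Xv \<otimes> X))\<dagger> \<cdot> S"
  have S': "S' \<in> TwoM C" "dom2 C S' = A \<otimes> X" "cod2 C S' = (A \<otimes> X) \<otimes> (Xv \<otimes> X)"
    unfolding S'_def using A S by (simp_all add: typing)
  have key: "h = run C W \<cdot> ((id2 C W \<star> e) \<cdot> (assoc C W Xv X \<cdot> (((h \<star> id2 C Xv) \<star> id2 C X) \<cdot>
      ((assoc C (A \<otimes> X) Xv X)\<dagger> \<cdot> S'))))"
    if h: "h \<in> TwoM C" "dom2 C h = A \<otimes> X" "cod2 C h = W" for h W
  proof -
    let ?I = "unit1 C (trg C X)"
    have W: "W \<in> OneM C" "src C W = src C A" "trg C W = trg C X"
      using dom_cod[OF h(1)] h A by (simp_all add: typing)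
    note T = A S S' h W
    let ?p = "id2 C A \<star> (id2 C X \<star> e)"
    have "id2 C A \<star> (run C X \<cdot> ((id2 C X \<star> e) \<cdot> (assoc C X Xv X \<cdot> ((c \<star> id2 C X) \<cdot> (lun C X)\<dagger>)))) =
        (id2 C A \<star> run C X) \<cdot> (?p \<cdot> S)"
      unfolding S_def using A by (simp add: typing hcomp_lwhisker)
    then have "h = h \<cdot> ((id2 C A \<star> run C X) \<cdot> (?p \<cdot> S))"
      using vcomp_id(1)[OF h(1,2)] A unfolding zigzag(1) by (simp add: typing hcomp_id')
    also have "id2 C A \<star> run C X = run C (A \<otimes> X) \<cdot> (assoc C A X ?I)\<dagger>"
      using A by (simp add: typing run_tensor[of A X] vcomp_assoc assoc_inv vcomp_id)
    also have "h \<cdot> ((run C (A \<otimes> X) \<cdot> (assoc C A X ?I)\<dagger>) \<cdot> (?p \<cdot> S)) =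
       (h \<cdot> run C (A \<otimes> X)) \<cdot> ((assoc C A X ?I)\<dagger> \<cdot> (?p \<cdot> S))"
      using T by (simp add: typing vcomp_assoc)
    also have "(assoc C A X ?I)\<dagger> \<cdot> (?p \<cdot> S) = (id2 C (A \<otimes> X) \<star> e) \<cdot> S'"
      unfolding S'_def by (rule vcomp_square[OF assoc_dag_nat_r]) (use T in \<open>simp_all add: typing\<close>)
    also have "h \<cdot> run C (A \<otimes> X) = run C W \<cdot> (h \<star> id2 C ?I)"
      by (rule run_nat'[symmetric]) (use T in \<open>simp_all add: typing\<close>)
    also have "(run C W \<cdot> (h \<star> id2 C ?I)) \<cdot> ((id2 C (A \<otimes> X) \<star> e) \<cdot> S') =
        run C W \<cdot> ((h \<star> id2 C ?I) \<cdot> ((id2 C (A \<otimes> X) \<star> e) \<cdot> S'))"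
      using T by (simp add: typing vcomp_assoc)
    also have "(h \<star> id2 C ?I) \<cdot> ((id2 C (A \<otimes> X) \<star> e) \<cdot> S') = (id2 C W \<star> e) \<cdot> ((h \<star> id2 C (Xv \<otimes> X)) \<cdot> S')"
      by (rule vcomp_square[OF whisker_swap]) (use T in \<open>simp_all add: typing\<close>)
    also have "h \<star> id2 C (Xv \<otimes> X) = (h \<star> id2 C (Xv \<otimes> X)) \<cdot> (assoc C (A \<otimes> X) Xv X \<cdot> (assoc C (A \<otimes> X) Xv X)\<dagger>)"
      using T by (simp add: typing assoc_inv vcomp_id)
    also have "\<dots> = assoc C W Xv X \<cdot> (((h \<star> id2 C Xv) \<star> id2 C X) \<cdot> (assoc C (A \<otimes> X) Xv X)\<dagger>)"
      by (rule vcomp_square[OF assoc_nat_l[symmetric]]) (use T in \<open>simp_all add: typing\<close>)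
    finally show ?thesis using T by (simp add: typing vcomp_assoc)
  qed
  show ?thesis
    using key[OF f fg(1)] key[OF g refl] fg(2) by simp
qed

text \<open>Half of the adjunction between \<open>- \<otimes> X\<close> and \<open>- \<otimes> Xv\<close>: the transpose \<open>W \<otimes> X \<Rightarrow> A\<close> of a map \<open>W \<Rightarrow> A \<otimes> Xv\<close> determines it, because
  the second zigzag recovers \<open>h\<close> from its transpose.\<close>

lemma transpose_faithful:
  assumes A: "A \<in> OneM C" "trg C A = trg C X"
    and f: "f \<in> TwoM C" "cod2 C f = A \<otimes> Xv" and g: "g \<in> TwoM C" "cod2 C g = A \<otimes> Xv"
    and fg: "dom2 C f = dom2 C g"
      "(id2 C A \<star> e) \<cdot> (assoc C A Xv X \<cdot> (f \<star> id2 C X)) = (id2 C A \<star> e) \<cdot> (assoc C A Xv X \<cdot> (g \<star> id2 C X))"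
  shows "f = g"
proof -
  have key: "h = (id2 C A \<star> lun C Xv) \<cdot> (assoc C A (unit1 C (trg C X)) Xv \<cdot>
      ((((id2 C A \<star> e) \<cdot> (assoc C A Xv X \<cdot> (h \<star> id2 C X))) \<star> id2 C Xv) \<cdot>
      ((assoc C W X Xv)\<dagger> \<cdot> ((id2 C W \<star> c) \<cdot> (run C W)\<dagger>))))"
    if h: "h \<in> TwoM C" "cod2 C h = A \<otimes> Xv" "dom2 C h = W" for h W
  proof -
    let ?I = "unit1 C (trg C X)" let ?J = "unit1 C (src C X)"
    have W: "W \<in> OneM C" "src C W = src C A" "trg C W = src C X"
      using dom_cod[OF h(1)] h A by (simp_all add: typing)
    define R where "R = (id2 C W \<star> c) \<cdot> (run C W)\<dagger>"
    define R' where "R' = (assoc C W X Xv)\<dagger> \<cdot> R"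
    define L where "L = (id2 C A \<star> lun C Xv) \<cdot> (id2 C A \<star> (e \<star> id2 C Xv))"
    have R: "R \<in> TwoM C" "dom2 C R = W" "cod2 C R = W \<otimes> (X \<otimes> Xv)" "R' \<in> TwoM C" "dom2 C R' = W" "cod2 C R' = (W \<otimes> X) \<otimes> Xv"
      unfolding R'_def R_def using A h W by (simp_all add: typing)
    have L: "L \<in> TwoM C" "dom2 C L = A \<otimes> ((Xv \<otimes> X) \<otimes> Xv)" "cod2 C L = A \<otimes> Xv"
      unfolding L_def using A h W by (simp_all add: typing)
    note T = A h W R L
    let ?a = "id2 C A \<star> (assoc C Xv X Xv)\<dagger>" and ?b = "id2 C A \<star> (id2 C Xv \<star> c)" and ?r = "id2 C A \<star> (run C Xv)\<dagger>"
    have "id2 C A \<star> (lun C Xv \<cdot> ((e \<star> id2 C Xv) \<cdot> ((assoc C Xv X Xv)\<dagger> \<cdot> ((id2 C Xv \<star> c) \<cdot> (run C Xv)\<dagger>)))) =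
       L \<cdot> (?a \<cdot> (?b \<cdot> ?r))"
      unfolding L_def using A by (simp add: typing hcomp_lwhisker vcomp_assoc)
    then have "h = (L \<cdot> (?a \<cdot> (?b \<cdot> ?r))) \<cdot> h"
      using vcomp_id(2)[OF h(1,2)] A unfolding zigzag(2) by (simp add: typing hcomp_id')
    also have "\<dots> = L \<cdot> (?a \<cdot> (?b \<cdot> (?r \<cdot> h)))"
      using T by (simp add: typing vcomp_assoc)
    also have "?r \<cdot> h = assoc C A Xv ?J \<cdot> ((h \<star> id2 C ?J) \<cdot> (run C W)\<dagger>)"
    proof -
      have "(run C (A \<otimes> Xv))\<dagger> = (assoc C A Xv ?J)\<dagger> \<cdot> ?r"
        using A by (simp add: typing run_tensor[of A Xv] dagger_vcomp dagger_hcomp dagger_id)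
      then have "assoc C A Xv ?J \<cdot> (run C (A \<otimes> Xv))\<dagger> = assoc C A Xv ?J \<cdot> ((assoc C A Xv ?J)\<dagger> \<cdot> ?r)" by simp
      also have "\<dots> = id2 C (A \<otimes> (Xv \<otimes> ?J)) \<cdot> ?r"
        by (rule vcomp_extend[OF assoc_inv(2)]) (use A in \<open>simp_all add: typing\<close>)
      finally have "?r \<cdot> h = assoc C A Xv ?J \<cdot> ((run C (A \<otimes> Xv))\<dagger> \<cdot> h)"
        using A h by (simp add: typing vcomp_id vcomp_assoc[symmetric])
      also have "(run C (A \<otimes> Xv))\<dagger> \<cdot> h = (h \<star> id2 C ?J) \<cdot> (run C W)\<dagger>"
        by (rule run_dag_nat[symmetric]) (use A h W in \<open>simp_all add: typing\<close>)
      finally show ?thesis .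
    qed
    also have "?b \<cdot> (assoc C A Xv ?J \<cdot> ((h \<star> id2 C ?J) \<cdot> (run C W)\<dagger>)) =
       assoc C A Xv (X \<otimes> Xv) \<cdot> ((id2 C (A \<otimes> Xv) \<star> c) \<cdot> ((h \<star> id2 C ?J) \<cdot> (run C W)\<dagger>))"
      by (rule vcomp_square[OF assoc_nat_r[symmetric]]) (use T in \<open>simp_all add: typing\<close>)
    also have "(id2 C (A \<otimes> Xv) \<star> c) \<cdot> ((h \<star> id2 C ?J) \<cdot> (run C W)\<dagger>) = (h \<star> id2 C (X \<otimes> Xv)) \<cdot> R"
      unfolding R_def by (rule vcomp_square[OF whisker_swap[symmetric]]) (use T in \<open>simp_all add: typing\<close>)
    also have "h \<star> id2 C (X \<otimes> Xv) = (h \<star> id2 C (X \<otimes> Xv)) \<cdot> (assoc C W X Xv \<cdot> (assoc C W X Xv)\<dagger>)"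
      using T by (simp add: typing assoc_inv vcomp_id)
    also have "\<dots> = assoc C (A \<otimes> Xv) X Xv \<cdot> (((h \<star> id2 C X) \<star> id2 C Xv) \<cdot> (assoc C W X Xv)\<dagger>)"
      by (rule vcomp_square[OF assoc_nat_l[symmetric]]) (use T in \<open>simp_all add: typing\<close>)
    also have "(assoc C (A \<otimes> Xv) X Xv \<cdot> (((h \<star> id2 C X) \<star> id2 C Xv) \<cdot> (assoc C W X Xv)\<dagger>)) \<cdot> R =
        assoc C (A \<otimes> Xv) X Xv \<cdot> (((h \<star> id2 C X) \<star> id2 C Xv) \<cdot> R')"
      unfolding R'_def using T by (simp add: typing vcomp_assoc)
    also have "?a \<cdot> (assoc C A Xv (X \<otimes> Xv) \<cdot> (assoc C (A \<otimes> Xv) X Xv \<cdot> (((h \<star> id2 C X) \<star> id2 C Xv) \<cdot> R'))) =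
       (?a \<cdot> (assoc C A Xv (X \<otimes> Xv) \<cdot> assoc C (A \<otimes> Xv) X Xv)) \<cdot> (((h \<star> id2 C X) \<star> id2 C Xv) \<cdot> R')"
      using T by (simp add: typing vcomp_assoc)
    also have "?a \<cdot> (assoc C A Xv (X \<otimes> Xv) \<cdot> assoc C (A \<otimes> Xv) X Xv) =
      assoc C A (Xv \<otimes> X) Xv \<cdot> (assoc C A Xv X \<star> id2 C Xv)"
    proof -
      have p: "assoc C A Xv (X \<otimes> Xv) \<cdot> assoc C (A \<otimes> Xv) X Xv = (id2 C A \<star> assoc C Xv X Xv) \<cdot>
            (assoc C A (Xv \<otimes> X) Xv \<cdot> (assoc C A Xv X \<star> id2 C Xv))"
        by (rule pentagon'[symmetric]) (use A in \<open>simp_all add: typing\<close>)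
      have q: "?a \<cdot> (id2 C A \<star> assoc C Xv X Xv) = id2 C (A \<otimes> ((Xv \<otimes> X) \<otimes> Xv))"
        using A by (simp add: typing hcomp_lwhisker[symmetric] assoc_inv hcomp_id')
      show ?thesis unfolding p
        by (subst vcomp_extend[OF q]) (use A in \<open>simp_all add: typing vcomp_id\<close>)
    qed
    also have "L \<cdot> ((assoc C A (Xv \<otimes> X) Xv \<cdot> (assoc C A Xv X \<star> id2 C Xv)) \<cdot> (((h \<star> id2 C X) \<star> id2 C Xv) \<cdot> R')) =
       (id2 C A \<star> lun C Xv) \<cdot> ((id2 C A \<star> (e \<star> id2 C Xv)) \<cdot> (assoc C A (Xv \<otimes> X) Xv \<cdot> ((assoc C A Xv X \<star> id2 C Xv) \<cdot>
         (((h \<star> id2 C X) \<star> id2 C Xv) \<cdot> R'))))"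
      unfolding L_def using T by (simp add: typing vcomp_assoc)
    also have "(id2 C A \<star> (e \<star> id2 C Xv)) \<cdot> (assoc C A (Xv \<otimes> X) Xv \<cdot> ((assoc C A Xv X \<star> id2 C Xv) \<cdot>
         (((h \<star> id2 C X) \<star> id2 C Xv) \<cdot> R'))) =
       assoc C A ?I Xv \<cdot> (((id2 C A \<star> e) \<star> id2 C Xv) \<cdot> ((assoc C A Xv X \<star> id2 C Xv) \<cdot> (((h \<star> id2 C X) \<star> id2 C Xv) \<cdot> R')))"
      by (rule vcomp_square[OF assoc_nat_m[symmetric]]) (use T in \<open>simp_all add: typing\<close>)
    also have "((id2 C A \<star> e) \<star> id2 C Xv) \<cdot> ((assoc C A Xv X \<star> id2 C Xv) \<cdot> (((h \<star> id2 C X) \<star> id2 C Xv) \<cdot> R')) =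
       (((id2 C A \<star> e) \<cdot> (assoc C A Xv X \<cdot> (h \<star> id2 C X))) \<star> id2 C Xv) \<cdot> R'"
      using T by (simp add: typing vcomp_assoc hcomp_rwhisker)
    finally show ?thesis unfolding R'_def R_def .
  qed
  show ?thesis
    using key[OF f refl] key[OF g fg(1)[symmetric]] fg(2) by simp
qed

text \<open>Bending the output \<open>X\<close> of \<open>h : 1 \<Rightarrow> X \<otimes> Z\<close> down with \<open>e\<close> and back up with \<open>c\<close> gives \<open>h\<close> again; after sliding \<open>h\<close> to
  the far right, what remains is the first zigzag tensored with \<open>Z\<close>.\<close>

lemma mate_coev:
  assumes Z: "Z \<in> OneM C" "src C Z = trg C X"
    and h: "h \<in> TwoM C" "dom2 C h = unit1 C (src C X)" "cod2 C h = X \<otimes> Z"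
  shows "(id2 C X \<star> (lun C Z \<cdot> ((e \<star> id2 C Z) \<cdot> ((assoc C Xv X Z)\<dagger> \<cdot> ((id2 C Xv \<star> h) \<cdot> (run C Xv)\<dagger>))))) \<cdot> c = h"
proof -
  let ?I = "unit1 C (trg C X)" let ?J = "unit1 C (src C X)"
  have Z2: "trg C Z = src C X"
  proof -
    have "trg C (cod2 C h) = trg C (dom2 C h)" using dom_cod h(1) by blast
    then show ?thesis using h Z by (simp add: typing)
  qed
  define L where "L = (id2 C X \<star> lun C Z) \<cdot> (id2 C X \<star> (e \<star> id2 C Z))"
  define R where "R = (lun C (X \<otimes> Z))\<dagger> \<cdot> h"
  have L: "L \<in> TwoM C" "dom2 C L = X \<otimes> ((Xv \<otimes> X) \<otimes> Z)" "cod2 C L = X \<otimes> Z"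
    unfolding L_def using Z Z2 by (simp_all add: typing)
  have R: "R \<in> TwoM C" "dom2 C R = ?J" "cod2 C R = ?J \<otimes> (X \<otimes> Z)"
    unfolding R_def using Z Z2 h by (simp_all add: typing)
  note T = Z Z2 h L R
  let ?a = "id2 C X \<star> (assoc C Xv X Z)\<dagger>" and ?b = "id2 C X \<star> (id2 C Xv \<star> h)" and ?r = "id2 C X \<star> (run C Xv)\<dagger>"
  have "(id2 C X \<star> (lun C Z \<cdot> ((e \<star> id2 C Z) \<cdot> ((assoc C Xv X Z)\<dagger> \<cdot> ((id2 C Xv \<star> h) \<cdot> (run C Xv)\<dagger>))))) \<cdot> c =
      L \<cdot> (?a \<cdot> (?b \<cdot> (?r \<cdot> c)))"
    unfolding L_def using Z Z2 h by (simp add: typing hcomp_lwhisker vcomp_assoc)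
  also have "?r \<cdot> c = assoc C X Xv ?J \<cdot> ((c \<star> id2 C ?J) \<cdot> (run C ?J)\<dagger>)"
  proof -
    have "(run C (X \<otimes> Xv))\<dagger> = (assoc C X Xv ?J)\<dagger> \<cdot> ?r"
      by (simp add: typing run_tensor[of X Xv] dagger_vcomp dagger_hcomp dagger_id)
    then have "assoc C X Xv ?J \<cdot> (run C (X \<otimes> Xv))\<dagger> = assoc C X Xv ?J \<cdot> ((assoc C X Xv ?J)\<dagger> \<cdot> ?r)" by simp
    also have "\<dots> = id2 C (X \<otimes> (Xv \<otimes> ?J)) \<cdot> ?r"
      by (rule vcomp_extend[OF assoc_inv(2)]) (simp_all add: typing)
    finally have "?r \<cdot> c = assoc C X Xv ?J \<cdot> ((run C (X \<otimes> Xv))\<dagger> \<cdot> c)"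
      by (simp add: typing vcomp_id vcomp_assoc[symmetric])
    also have "(run C (X \<otimes> Xv))\<dagger> \<cdot> c = (c \<star> id2 C ?J) \<cdot> (run C ?J)\<dagger>"
      by (rule run_dag_nat[symmetric]) (simp_all add: typing)
    finally show ?thesis .
  qed
  also have "?b \<cdot> (assoc C X Xv ?J \<cdot> ((c \<star> id2 C ?J) \<cdot> (run C ?J)\<dagger>)) =
      assoc C X Xv (X \<otimes> Z) \<cdot> ((id2 C (X \<otimes> Xv) \<star> h) \<cdot> ((c \<star> id2 C ?J) \<cdot> (run C ?J)\<dagger>))"
    by (rule vcomp_square[OF assoc_nat_r[symmetric]]) (use T in \<open>simp_all add: typing\<close>)
  also have "(id2 C (X \<otimes> Xv) \<star> h) \<cdot> ((c \<star> id2 C ?J) \<cdot> (run C ?J)\<dagger>) =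
      (c \<star> id2 C (X \<otimes> Z)) \<cdot> ((id2 C ?J \<star> h) \<cdot> (run C ?J)\<dagger>)"
    by (rule vcomp_square[OF whisker_swap[symmetric]]) (use T in \<open>simp_all add: typing\<close>)
  also have "(id2 C ?J \<star> h) \<cdot> (run C ?J)\<dagger> = R"
    unfolding R_def lun_unit_eq_run_unit[OF src_trg(1)[OF adj_typing(1)], symmetric]
    by (rule lun_dag_nat) (use T in \<open>simp_all add: typing\<close>)
  also have "?a \<cdot> (assoc C X Xv (X \<otimes> Z) \<cdot> ((c \<star> id2 C (X \<otimes> Z)) \<cdot> R)) =
      (?a \<cdot> (assoc C X Xv (X \<otimes> Z) \<cdot> (assoc C (X \<otimes> Xv) X Z \<cdot> (assoc C (X \<otimes> Xv) X Z)\<dagger>))) \<cdot> ((c \<star> id2 C (X \<otimes> Z)) \<cdot> R)"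
    using T by (simp add: typing vcomp_assoc assoc_inv vcomp_id)
  also have "?a \<cdot> (assoc C X Xv (X \<otimes> Z) \<cdot> (assoc C (X \<otimes> Xv) X Z \<cdot> (assoc C (X \<otimes> Xv) X Z)\<dagger>)) =
      assoc C X (Xv \<otimes> X) Z \<cdot> ((assoc C X Xv X \<star> id2 C Z) \<cdot> (assoc C (X \<otimes> Xv) X Z)\<dagger>)"
  proof -
    have p: "assoc C X Xv (X \<otimes> Z) \<cdot> assoc C (X \<otimes> Xv) X Z = (id2 C X \<star> assoc C Xv X Z) \<cdot>
          (assoc C X (Xv \<otimes> X) Z \<cdot> (assoc C X Xv X \<star> id2 C Z))"
      by (rule pentagon'[symmetric]) (use Z Z2 in \<open>simp_all add: typing\<close>)
    have q: "?a \<cdot> (id2 C X \<star> assoc C Xv X Z) = id2 C (X \<otimes> ((Xv \<otimes> X) \<otimes> Z))"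
      using Z Z2 by (simp add: typing hcomp_lwhisker[symmetric] assoc_inv hcomp_id')
    have "?a \<cdot> (assoc C X Xv (X \<otimes> Z) \<cdot> (assoc C (X \<otimes> Xv) X Z \<cdot> (assoc C (X \<otimes> Xv) X Z)\<dagger>)) =
       (?a \<cdot> (assoc C X Xv (X \<otimes> Z) \<cdot> assoc C (X \<otimes> Xv) X Z)) \<cdot> (assoc C (X \<otimes> Xv) X Z)\<dagger>"
      using Z Z2 by (simp add: typing vcomp_assoc)
    also have "?a \<cdot> (assoc C X Xv (X \<otimes> Z) \<cdot> assoc C (X \<otimes> Xv) X Z) =
        assoc C X (Xv \<otimes> X) Z \<cdot> (assoc C X Xv X \<star> id2 C Z)"
      unfolding p by (subst vcomp_extend[OF q]) (use Z Z2 in \<open>simp_all add: typing vcomp_id\<close>)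
    finally show ?thesis using Z Z2 by (simp add: typing vcomp_assoc)
  qed
  also have "(assoc C X (Xv \<otimes> X) Z \<cdot> ((assoc C X Xv X \<star> id2 C Z) \<cdot> (assoc C (X \<otimes> Xv) X Z)\<dagger>)) \<cdot> ((c \<star> id2 C (X \<otimes> Z)) \<cdot> R) =
      assoc C X (Xv \<otimes> X) Z \<cdot> ((assoc C X Xv X \<star> id2 C Z) \<cdot> ((assoc C (X \<otimes> Xv) X Z)\<dagger> \<cdot> ((c \<star> id2 C (X \<otimes> Z)) \<cdot> R)))"
    using T by (simp add: typing vcomp_assoc)
  also have "(assoc C (X \<otimes> Xv) X Z)\<dagger> \<cdot> ((c \<star> id2 C (X \<otimes> Z)) \<cdot> R) = ((c \<star> id2 C X) \<star> id2 C Z) \<cdot> ((assoc C ?J X Z)\<dagger> \<cdot> R)"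
    by (rule vcomp_square[OF assoc_dag_nat_l]) (use T in \<open>simp_all add: typing\<close>)
  also have "(assoc C ?J X Z)\<dagger> \<cdot> R = ((lun C X)\<dagger> \<star> id2 C Z) \<cdot> h"
  proof -
    have "(lun C (X \<otimes> Z) \<cdot> assoc C ?J X Z)\<dagger> = (lun C X \<star> id2 C Z)\<dagger>"
      using lun_tensor[OF adj_typing(1) Z(1) Z(2)[symmetric] refl] by simp
    then have "(assoc C ?J X Z)\<dagger> \<cdot> (lun C (X \<otimes> Z))\<dagger> = (lun C X)\<dagger> \<star> id2 C Z"
      using Z Z2 by (simp add: typing dagger_vcomp dagger_hcomp dagger_id)
    then show ?thesis unfolding R_def by (rule vcomp_extend) (use Z Z2 h in \<open>simp_all add: typing\<close>)
  qed
  also have "L \<cdot> (assoc C X (Xv \<otimes> X) Z \<cdot> ((assoc C X Xv X \<star> id2 C Z) \<cdot> (((c \<star> id2 C X) \<star> id2 C Z) \<cdot> (((lun C X)\<dagger> \<star> id2 C Z) \<cdot> h)))) =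
      (id2 C X \<star> lun C Z) \<cdot> ((id2 C X \<star> (e \<star> id2 C Z)) \<cdot> (assoc C X (Xv \<otimes> X) Z \<cdot>
        ((assoc C X Xv X \<star> id2 C Z) \<cdot> (((c \<star> id2 C X) \<star> id2 C Z) \<cdot> (((lun C X)\<dagger> \<star> id2 C Z) \<cdot> h)))))"
    unfolding L_def using Z Z2 h by (simp add: typing vcomp_assoc)
  also have "(id2 C X \<star> (e \<star> id2 C Z)) \<cdot> (assoc C X (Xv \<otimes> X) Z \<cdot>
        ((assoc C X Xv X \<star> id2 C Z) \<cdot> (((c \<star> id2 C X) \<star> id2 C Z) \<cdot> (((lun C X)\<dagger> \<star> id2 C Z) \<cdot> h)))) =
      assoc C X ?I Z \<cdot> (((id2 C X \<star> e) \<star> id2 C Z) \<cdot>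
        ((assoc C X Xv X \<star> id2 C Z) \<cdot> (((c \<star> id2 C X) \<star> id2 C Z) \<cdot> (((lun C X)\<dagger> \<star> id2 C Z) \<cdot> h))))"
    by (rule vcomp_square[OF assoc_nat_m[symmetric]]) (use Z Z2 h in \<open>simp_all add: typing\<close>)
  also have "(id2 C X \<star> lun C Z) \<cdot> (assoc C X ?I Z \<cdot> (((id2 C X \<star> e) \<star> id2 C Z) \<cdot>
        ((assoc C X Xv X \<star> id2 C Z) \<cdot> (((c \<star> id2 C X) \<star> id2 C Z) \<cdot> (((lun C X)\<dagger> \<star> id2 C Z) \<cdot> h))))) =
      (run C X \<star> id2 C Z) \<cdot> (((id2 C X \<star> e) \<star> id2 C Z) \<cdot>
        ((assoc C X Xv X \<star> id2 C Z) \<cdot> (((c \<star> id2 C X) \<star> id2 C Z) \<cdot> (((lun C X)\<dagger> \<star> id2 C Z) \<cdot> h))))"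
    by (rule vcomp_extend[OF triangle']) (use Z Z2 h in \<open>simp_all add: typing\<close>)
  also have "\<dots> = ((run C X \<cdot> ((id2 C X \<star> e) \<cdot> (assoc C X Xv X \<cdot> ((c \<star> id2 C X) \<cdot> (lun C X)\<dagger>)))) \<star> id2 C Z) \<cdot> h"
    using Z Z2 h by (simp add: typing hcomp_rwhisker vcomp_assoc)
  also have "\<dots> = h"
    unfolding zigzag(1) using Z Z2 h by (simp add: typing hcomp_id' vcomp_id)
  finally show ?thesis .
qed

lemma lwhisk_ev_unitary:
  assumes "unitary2 C c"
  shows "unitary2 C (id2 C X \<star> e)"
  by (rule unitary_middle[OF zigzag(1)])
    (use assms in \<open>auto intro!: unitary_intros simp: typing\<close>)

lemma rwhisk_ev_unitary:
  assumes "unitary2 C c"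
  shows "unitary2 C (e \<star> id2 C Xv)"
  by (rule unitary_middle[OF zigzag(2)])
    (use assms in \<open>auto intro!: unitary_intros simp: typing\<close>)

text \<open>The second zigzag makes \<open>e \<otimes> Xv\<close> unitary, and \<open>- \<otimes> Xv\<close> is faithful on maps out of \<open>Xv \<otimes> X\<close>.\<close>

lemma coev_unitary_imp_ev_isometric:
  assumes "unitary2 C c"
  shows "e\<dagger> \<cdot> e = id2 C (Xv \<otimes> X)"
proof (rule rwhisk_dual_faithful[where A = Xv])
  have "(e\<dagger> \<cdot> e) \<star> id2 C Xv = (e \<star> id2 C Xv)\<dagger> \<cdot> (e \<star> id2 C Xv)"
    by (simp add: typing hcomp_rwhisker dagger_hcomp dagger_id)
  also have "\<dots> = id2 C (Xv \<otimes> X) \<star> id2 C Xv"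
    using unitary2D(1)[OF rwhisk_ev_unitary[OF assms]] by (simp add: typing hcomp_id')
  finally show "(e\<dagger> \<cdot> e) \<star> id2 C Xv = id2 C (Xv \<otimes> X) \<star> id2 C Xv" .
qed (simp_all add: typing)

text \<open>The endomorphism \<open>e e\<^sup>\<dagger>\<close> of the unit becomes trivial after tensoring with \<open>X\<close> on the left, hence also after
  tensoring with \<open>Y \<otimes> X \<cong> 1\<close>.\<close>

lemma coev_unitary_imp_ev_unitary:
  assumes c: "unitary2 C c" and Y: "Y \<in> OneM C" "src C Y = trg C X" "trg C Y = src C X"
    and t: "t \<in> TwoM C" "dom2 C t = Y \<otimes> X" "cod2 C t = unit1 C (trg C X)" "iso2 C t"
  shows "unitary2 C e"
proof -
  let ?I = "unit1 C (trg C X)"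
  define p where "p = e \<cdot> e\<dagger>"
  have p: "p \<in> TwoM C" "dom2 C p = ?I" "cod2 C p = ?I" unfolding p_def by (simp_all add: typing)
  have "(id2 C X \<star> e) \<cdot> (id2 C X \<star> e)\<dagger> = id2 C (X \<otimes> ?I)"
    using unitary2D(2)[OF lwhisk_ev_unitary[OF c]] by (simp add: typing)
  then have Xp: "id2 C X \<star> p = id2 C (X \<otimes> ?I)"
    unfolding p_def by (simp add: typing hcomp_lwhisker dagger_hcomp dagger_id)
  have "assoc C Y X ?I \<cdot> (id2 C (Y \<otimes> X) \<star> p) = (id2 C Y \<star> (id2 C X \<star> p)) \<cdot> assoc C Y X ?I"
    by (rule assoc_nat_r) (use Y p in \<open>simp_all add: typing\<close>)
  also have "\<dots> = assoc C Y X ?I \<cdot> id2 C ((Y \<otimes> X) \<otimes> ?I)"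
    unfolding Xp using Y by (simp add: typing hcomp_id' vcomp_id)
  finally have a: "assoc C Y X ?I \<cdot> (id2 C (Y \<otimes> X) \<star> p) = assoc C Y X ?I \<cdot> id2 C ((Y \<otimes> X) \<otimes> ?I)" .
  have Yp: "id2 C (Y \<otimes> X) \<star> p = id2 C ((Y \<otimes> X) \<otimes> ?I)"
    by (rule vcomp_cancel_left[OF a assoc_inv(1)]) (use Y p in \<open>simp_all add: typing\<close>)
  obtain t' where t': "t' \<in> TwoM C" "dom2 C t' = ?I" "cod2 C t' = Y \<otimes> X" "t \<cdot> t' = id2 C ?I"
    using iso2E[OF t(4,1)] t by metis
  have "(id2 C ?I \<star> p) \<cdot> (t \<star> id2 C ?I) = (t \<star> id2 C ?I) \<cdot> (id2 C (Y \<otimes> X) \<star> p)"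
    by (rule whisker_swap[symmetric]) (use Y p t in \<open>simp_all add: typing\<close>)
  also have "\<dots> = id2 C (?I \<otimes> ?I) \<cdot> (t \<star> id2 C ?I)"
    unfolding Yp using Y t by (simp add: typing vcomp_id)
  finally have b: "(id2 C ?I \<star> p) \<cdot> (t \<star> id2 C ?I) = id2 C (?I \<otimes> ?I) \<cdot> (t \<star> id2 C ?I)" .
  have "id2 C ?I \<star> p = id2 C (?I \<otimes> ?I)"
    by (rule vcomp_cancel_right[OF b, where k = "t' \<star> id2 C ?I"])
      (use Y p t t' in \<open>simp_all add: typing interchange' vcomp_id hcomp_id'\<close>)
  then have "id2 C ?I \<star> p = id2 C ?I \<star> id2 C ?I" by (simp add: typing hcomp_id')
  then have "p = id2 C ?I"
    by (rule unit_lwhisk_faithful[where X = "unit1 C (trg C X)"]) (use p in \<open>simp_all add: typing\<close>)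
  then show ?thesis
    unfolding unitary2_def using coev_unitary_imp_ev_isometric[OF c] by (simp add: typing p_def)
qed

text \<open>The unit of an adjunction whose left adjoint \<open>- \<otimes> X\<close> is fully faithful is invertible; being
  isometric, it is then unitary.\<close>

lemma fully_faithful_imp_coev_unitary:
  assumes bij: "\<And>Z W. Z \<in> hom1 C (src C X) (src C X) \<Longrightarrow> W \<in> hom1 C (src C X) (src C X) \<Longrightarrow>
      bij_betw (\<lambda>f. f \<star> id2 C X) (hom2 C Z W) (hom2 C (Z \<otimes> X) (W \<otimes> X))"
    and iso: "c\<dagger> \<cdot> c = id2 C (unit1 C (src C X))"
  shows "unitary2 C c"
proof -
  let ?J = "unit1 C (src C X)"
  define z where "z = (id2 C X \<star> e) \<cdot> assoc C X Xv X"
  have z: "z \<in> TwoM C" "dom2 C z = (X \<otimes> Xv) \<otimes> X" "cod2 C z = X \<otimes> unit1 C (trg C X)"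
    unfolding z_def by (simp_all add: typing)
  have hom1s: "?J \<in> hom1 C (src C X) (src C X)" "X \<otimes> Xv \<in> hom1 C (src C X) (src C X)"
    unfolding hom1_def by (simp_all add: typing)
  have "(lun C X)\<dagger> \<cdot> (run C X \<cdot> z) \<in> hom2 C ((X \<otimes> Xv) \<otimes> X) (?J \<otimes> X)"
    unfolding hom2_def using z by (simp add: typing)
  \<comment> \<open>The candidate inverse of \<open>c\<close> is the preimage of the counit \<open>X \<otimes> e\<close> under \<open>- \<otimes> X\<close>.\<close>
  then obtain r where r: "r \<in> TwoM C" "dom2 C r = X \<otimes> Xv" "cod2 C r = ?J" "r \<star> id2 C X = (lun C X)\<dagger> \<cdot> (run C X \<cdot> z)"
    using bij_betw_hit[OF bij[OF hom1s(2,1)]] unfolding hom2_def by blast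
  have zc: "z \<cdot> (c \<star> id2 C X) = (run C X)\<dagger> \<cdot> lun C X"
  proof -
    have "(run C X)\<dagger> \<cdot> (run C X \<cdot> ((z \<cdot> ((c \<star> id2 C X) \<cdot> (lun C X)\<dagger>)) \<cdot> lun C X)) = (run C X)\<dagger> \<cdot> lun C X"
    proof -
      have "run C X \<cdot> (z \<cdot> ((c \<star> id2 C X) \<cdot> (lun C X)\<dagger>)) = id2 C X"
        using zigzag(1) unfolding z_def by (simp add: typing vcomp_assoc)
      then have "run C X \<cdot> ((z \<cdot> ((c \<star> id2 C X) \<cdot> (lun C X)\<dagger>)) \<cdot> lun C X) = id2 C X \<cdot> lun C X"
        by (rule vcomp_extend) (use z in \<open>simp_all add: typing\<close>)
      then show ?thesis by (simp add: typing vcomp_id)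
    qed
    moreover have "(run C X)\<dagger> \<cdot> (run C X \<cdot> ((z \<cdot> ((c \<star> id2 C X) \<cdot> (lun C X)\<dagger>)) \<cdot> lun C X)) =
        id2 C (X \<otimes> unit1 C (trg C X)) \<cdot> ((z \<cdot> ((c \<star> id2 C X) \<cdot> (lun C X)\<dagger>)) \<cdot> lun C X)"
      by (rule vcomp_extend[OF run_inv(1)]) (use z in \<open>simp_all add: typing\<close>)
    ultimately show ?thesis using z by (simp add: typing vcomp_id vcomp_assoc lun_inv)
  qed
  have "r \<cdot> c = id2 C ?J"
  proof -
    have "(r \<cdot> c) \<star> id2 C X = (lun C X)\<dagger> \<cdot> (run C X \<cdot> (z \<cdot> (c \<star> id2 C X)))"
      using r z by (simp add: typing hcomp_rwhisker vcomp_assoc)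
    also have "\<dots> = (lun C X)\<dagger> \<cdot> (id2 C X \<cdot> lun C X)"
      unfolding zc by (subst vcomp_extend[OF run_inv(2)]) (simp_all add: typing)
    also have "\<dots> = id2 C ?J \<star> id2 C X" by (simp add: typing vcomp_id lun_inv hcomp_id')
    finally have "(r \<cdot> c) \<star> id2 C X = id2 C ?J \<star> id2 C X" .
    moreover have "r \<cdot> c \<in> hom2 C ?J ?J" "id2 C ?J \<in> hom2 C ?J ?J"
      unfolding hom2_def using r by (simp_all add: typing)
    ultimately show ?thesis using bij[OF hom1s(1,1)] unfolding bij_betw_def inj_on_def by blast
  qed
  have cr: "c \<cdot> r = id2 C (X \<otimes> Xv)"
  proof (rule transpose_faithful[where A = X])
    have "(id2 C X \<star> e) \<cdot> (assoc C X Xv X \<cdot> ((c \<cdot> r) \<star> id2 C X)) = (z \<cdot> (c \<star> id2 C X)) \<cdot> (r \<star> id2 C X)"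
      unfolding z_def using r(1-3) by (simp add: typing hcomp_rwhisker vcomp_assoc)
    also have "\<dots> = (run C X)\<dagger> \<cdot> (lun C X \<cdot> ((lun C X)\<dagger> \<cdot> (run C X \<cdot> z)))"
      unfolding zc r(4) using z by (simp add: typing vcomp_assoc)
    also have "lun C X \<cdot> ((lun C X)\<dagger> \<cdot> (run C X \<cdot> z)) = id2 C X \<cdot> (run C X \<cdot> z)"
      by (rule vcomp_extend[OF lun_inv(2)]) (use z in \<open>simp_all add: typing\<close>)
    also have "\<dots> = run C X \<cdot> z" using z by (simp add: typing vcomp_id)
    also have "(run C X)\<dagger> \<cdot> (run C X \<cdot> z) = id2 C (X \<otimes> unit1 C (trg C X)) \<cdot> z"
      by (rule vcomp_extend[OF run_inv(1)]) (use z in \<open>simp_all add: typing\<close>)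
    also have "\<dots> = (id2 C X \<star> e) \<cdot> (assoc C X Xv X \<cdot> (id2 C (X \<otimes> Xv) \<star> id2 C X))"
      using z unfolding z_def by (simp add: typing vcomp_id hcomp_id')
    finally show "(id2 C X \<star> e) \<cdot> (assoc C X Xv X \<cdot> ((c \<cdot> r) \<star> id2 C X)) =
      (id2 C X \<star> e) \<cdot> (assoc C X Xv X \<cdot> (id2 C (X \<otimes> Xv) \<star> id2 C X))" .
  qed (use r in \<open>simp_all add: typing\<close>)
  have "r = c\<dagger> \<cdot> (c \<cdot> r)"
    using vcomp_extend[OF iso, of r] r by (simp add: typing vcomp_id)
  then have "r = c\<dagger>" unfolding cr by (simp add: typing vcomp_id)
  then show ?thesis using cr iso unfolding unitary2_def by (simp add: typing)
qed

end

section \<open>Traces\<close>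

locale weighted_2category = dagger_2category C
  for C :: "('o, 'm, 'c) pre3" (structure) +
  assumes uaf: "unitary_adjoint_functor C" and spherical: "spherical_weight C"
begin

lemma adjoint_dual: "X \<in> OneM C \<Longrightarrow> adjoint_pair C X (dual C X) (ev C X) (coev C X)"
  using uaf unfolding unitary_adjoint_functor_def by unfold_locales blast

lemma dual_typing [typing]:
  assumes "X \<in> OneM C"
  shows "dual C X \<in> OneM C" "src C (dual C X) = trg C X" "trg C (dual C X) = src C X"
    "ev C X \<in> TwoM C" "dom2 C (ev C X) = dual C X \<otimes> X" "cod2 C (ev C X) = unit1 C (trg C X)"
    "coev C X \<in> TwoM C" "dom2 C (coev C X) = unit1 C (src C X)" "cod2 C (coev C X) = X \<otimes> dual C X"
  using adjoint_pair.adj_typing[OF adjoint_dual[OF assms]] by blast+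

lemma dual2_typing [typing]:
  assumes "f \<in> TwoM C"
  shows "dual2 C f \<in> TwoM C" "dom2 C (dual2 C f) = dual C (cod2 C f)" "cod2 C (dual2 C f) = dual C (dom2 C f)"
  unfolding dual2_def mate_def using assms by (simp_all add: typing)

lemma coev_dual2:
  assumes f: "f \<in> TwoM C" "dom2 C f = X" "cod2 C f = Y"
  shows "(f \<star> id2 C (dual C X)) \<cdot> coev C X = (id2 C Y \<star> dual2 C f) \<cdot> coev C Y"
proof -
  have XY: "X \<in> OneM C" "Y \<in> OneM C" "src C Y = src C X" "trg C Y = trg C X"
    using dom_cod[OF f(1)] f by simp_all
  interpret adjoint_pair C Y "dual C Y" "ev C Y" "coev C Y" by (rule adjoint_dual[OF XY(2)])
  show ?thesis
    unfolding dual2_def mate_def f(2,3)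
    by (rule mate_coev[symmetric]) (use XY f in \<open>simp_all add: typing\<close>)
qed

lemma dual2_dagger: "f \<in> TwoM C \<Longrightarrow> (dual2 C f)\<dagger> = dual2 C (f\<dagger>)"
  using uaf unfolding unitary_adjoint_functor_def by blast

text \<open>The compatibility \<open>(f\<^sup>\<or>)\<^sup>\<dagger> = (f\<^sup>\<dagger>)\<^sup>\<or>\<close> lets a map slide around the cap \<open>coev\<^sup>\<dagger>\<close> in the same way as
  around the cup \<open>coev\<close>.\<close>

lemma coev_dagger_dual2:
  assumes g: "g \<in> TwoM C" "dom2 C g = Y" "cod2 C g = X"
  shows "(coev C X)\<dagger> \<cdot> (g \<star> id2 C (dual C X)) = (coev C Y)\<dagger> \<cdot> (id2 C Y \<star> dual2 C g)"
proof -
  have XY: "X \<in> OneM C" "Y \<in> OneM C" "src C Y = src C X" "trg C Y = trg C X"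
    using dom_cod[OF g(1)] g by simp_all
  have d: "(dual2 C (g\<dagger>))\<dagger> = dual2 C g"
    using dual2_dagger[of "g\<dagger>"] g by (simp add: typing dagger_dagger)
  have "((g\<dagger> \<star> id2 C (dual C X)) \<cdot> coev C X)\<dagger> = ((id2 C Y \<star> dual2 C (g\<dagger>)) \<cdot> coev C Y)\<dagger>"
    by (subst coev_dual2[of "g\<dagger>" X Y]) (use g XY in \<open>simp_all add: typing\<close>)
  then show ?thesis
    using g XY by (simp add: typing dagger_vcomp dagger_hcomp dagger_id dagger_dagger d)
qed

text \<open>Slide \<open>g\<close> once around the loop: over the cap by \<open>coev_dagger_dual2\<close>, past \<open>f\<close>, and under the cup by
  \<open>coev_dual2\<close>. Hence \<open>Tr\<close> is invariant under unitary conjugation.\<close>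

lemma loop_cyclic:
  assumes f: "f \<in> TwoM C" "dom2 C f = X" "cod2 C f = Y" and g: "g \<in> TwoM C" "dom2 C g = Y" "cod2 C g = X"
  shows "(coev C X)\<dagger> \<cdot> (((g \<cdot> f) \<star> id2 C (dual C X)) \<cdot> coev C X) =
    (coev C Y)\<dagger> \<cdot> (((f \<cdot> g) \<star> id2 C (dual C Y)) \<cdot> coev C Y)"
proof -
  have XY: "X \<in> OneM C" "Y \<in> OneM C" "src C Y = src C X" "trg C Y = trg C X"
    using dom_cod[OF f(1)] f by simp_all
  note T = f g XY
  define u where "u = (f \<star> id2 C (dual C X)) \<cdot> coev C X"
  have u: "u \<in> TwoM C" "dom2 C u = unit1 C (src C X)" "cod2 C u = Y \<otimes> dual C X"
    unfolding u_def using T by (simp_all add: typing)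
  have "(coev C X)\<dagger> \<cdot> (((g \<cdot> f) \<star> id2 C (dual C X)) \<cdot> coev C X) =
     (coev C X)\<dagger> \<cdot> ((g \<star> id2 C (dual C X)) \<cdot> u)"
    unfolding u_def using T by (simp add: typing hcomp_rwhisker vcomp_assoc)
  also have "\<dots> = (coev C Y)\<dagger> \<cdot> ((id2 C Y \<star> dual2 C g) \<cdot> u)"
    by (rule vcomp_square[OF coev_dagger_dual2]) (use T u in \<open>simp_all add: typing\<close>)
  also have "(id2 C Y \<star> dual2 C g) \<cdot> u = (f \<star> id2 C (dual C Y)) \<cdot> ((id2 C X \<star> dual2 C g) \<cdot> coev C X)"
    unfolding u_def by (rule vcomp_square[OF whisker_swap[symmetric]]) (use T in \<open>simp_all add: typing\<close>)
  also have "(id2 C X \<star> dual2 C g) \<cdot> coev C X = (g \<star> id2 C (dual C Y)) \<cdot> coev C Y"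
    by (rule coev_dual2[symmetric]) (use T in simp_all)
  finally show ?thesis using T by (simp add: typing hcomp_rwhisker vcomp_assoc)
qed

lemma Tr_eq: "X \<in> OneM C \<Longrightarrow> Tr C X f = weight C (src C X) ((coev C X)\<dagger> \<cdot> ((f \<star> id2 C (dual C X)) \<cdot> coev C X))"
  unfolding Tr_def by simp

lemma Tr_intertwine:
  assumes k: "k \<in> TwoM C" "dom2 C k = X" "cod2 C k = Y" "unitary2 C k"
    and f: "f \<in> TwoM C" "dom2 C f = X" "cod2 C f = X" and g: "g \<in> TwoM C" "dom2 C g = Y" "cod2 C g = Y"
    and kf: "k \<cdot> f = g \<cdot> k"
  shows "Tr C X f = Tr C Y g"
proof -
  have XY: "X \<in> OneM C" "Y \<in> OneM C" "src C Y = src C X"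
    using dom_cod[OF k(1)] k by simp_all
  note u = unitary2D[OF k(4), unfolded k(2,3)]
  have "g = g \<cdot> (k \<cdot> k\<dagger>)" unfolding u using g by (simp add: vcomp_id)
  also have "\<dots> = k \<cdot> (f \<cdot> k\<dagger>)" using k f g by (simp add: typing vcomp_assoc[symmetric] kf)
  finally have g': "g = k \<cdot> (f \<cdot> k\<dagger>)" .
  have f': "(f \<cdot> k\<dagger>) \<cdot> k = f" using k f u by (simp add: typing vcomp_assoc vcomp_id)
  have "(coev C Y)\<dagger> \<cdot> ((g \<star> id2 C (dual C Y)) \<cdot> coev C Y) = (coev C X)\<dagger> \<cdot> ((f \<star> id2 C (dual C X)) \<cdot> coev C X)"
    using loop_cyclic[of "f \<cdot> k\<dagger>" Y X k] k f unfolding g' by (simp add: typing f')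
  then show ?thesis using Tr_eq[of X f] Tr_eq[of Y g] XY by simp
qed

text \<open>Conjugating \<open>f \<otimes> X\<close> by \<open>lun\<close> gives an endomorphism of \<open>X\<close>; in its trace loop \<open>f\<close> slides out to the left,
  leaving the closed loop \<open>coev\<^sup>\<dagger> coev\<close>.\<close>

lemma Tr_unit_whisker:
  assumes X: "X \<in> OneM C" "src C X = a" and f: "f \<in> TwoM C" "dom2 C f = unit1 C a" "cod2 C f = unit1 C a"
  shows "Tr C (unit1 C a \<otimes> X) (f \<star> id2 C X) = weight C a (((coev C X)\<dagger> \<cdot> coev C X) \<cdot> f)"
proof -
  let ?I = "unit1 C a" let ?D = "dual C X" let ?XD = "X \<otimes> dual C X"
  have a: "a \<in> Ob C" "?I \<in> OneM C" "src C ?I = a" "trg C ?I = a" using X by (auto simp: typing)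
  note T = X f a
  define g where "g = lun C X \<cdot> ((f \<star> id2 C X) \<cdot> (lun C X)\<dagger>)"
  have g: "g \<in> TwoM C" "dom2 C g = X" "cod2 C g = X"
    unfolding g_def using T by (simp_all add: typing)
  have "Tr C (?I \<otimes> X) (f \<star> id2 C X) = Tr C X g"
    by (rule Tr_intertwine[where k = "lun C X"])
      (use T g in \<open>simp_all add: typing unitary_struct g_def vcomp_assoc lun_inv vcomp_id\<close>)
  also have "\<dots> = weight C a ((coev C X)\<dagger> \<cdot> ((g \<star> id2 C ?D) \<cdot> coev C X))"
    using Tr_eq X by simp
  also have "(g \<star> id2 C ?D) \<cdot> coev C X =
     (lun C X \<star> id2 C ?D) \<cdot> (((f \<star> id2 C X) \<star> id2 C ?D) \<cdot> (((lun C X)\<dagger> \<star> id2 C ?D) \<cdot> coev C X))"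
    unfolding g_def using T by (simp add: typing hcomp_rwhisker vcomp_assoc)
  also have "(lun C X)\<dagger> \<star> id2 C ?D = (assoc C ?I X ?D)\<dagger> \<cdot> (lun C ?XD)\<dagger>"
  proof -
    have "(lun C ?XD \<cdot> assoc C ?I X ?D)\<dagger> = (lun C X \<star> id2 C ?D)\<dagger>"
      by (subst lun_tensor) (use T in \<open>simp_all add: typing\<close>)
    then show ?thesis using T by (simp add: typing dagger_vcomp dagger_hcomp dagger_id)
  qed
  also have "((assoc C ?I X ?D)\<dagger> \<cdot> (lun C ?XD)\<dagger>) \<cdot> coev C X =
      (assoc C ?I X ?D)\<dagger> \<cdot> ((lun C ?XD)\<dagger> \<cdot> coev C X)" using T by (simp add: typing vcomp_assoc)
  also have "(lun C ?XD)\<dagger> \<cdot> coev C X = (id2 C ?I \<star> coev C X) \<cdot> (lun C ?I)\<dagger>"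
    by (rule lun_dag_nat[symmetric]) (use T in \<open>simp_all add: typing\<close>)
  also have "((f \<star> id2 C X) \<star> id2 C ?D) \<cdot> ((assoc C ?I X ?D)\<dagger> \<cdot> ((id2 C ?I \<star> coev C X) \<cdot> (lun C ?I)\<dagger>)) =
      (assoc C ?I X ?D)\<dagger> \<cdot> ((f \<star> id2 C ?XD) \<cdot> ((id2 C ?I \<star> coev C X) \<cdot> (lun C ?I)\<dagger>))"
    by (rule vcomp_square[OF assoc_dag_nat_l[symmetric]]) (use T in \<open>simp_all add: typing\<close>)
  also have "(f \<star> id2 C ?XD) \<cdot> ((id2 C ?I \<star> coev C X) \<cdot> (lun C ?I)\<dagger>) =
      (id2 C ?I \<star> coev C X) \<cdot> ((f \<star> id2 C ?I) \<cdot> (lun C ?I)\<dagger>)"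
    by (rule vcomp_square[OF whisker_swap]) (use T in \<open>simp_all add: typing\<close>)
  also have "(f \<star> id2 C ?I) \<cdot> (lun C ?I)\<dagger> = (run C ?I)\<dagger> \<cdot> f"
    unfolding lun_unit_eq_run_unit[OF a(1)] by (rule run_dag_nat) (use T in simp_all)
  also have "lun C X \<star> id2 C ?D = lun C ?XD \<cdot> assoc C ?I X ?D"
    by (rule lun_tensor[symmetric]) (use T in \<open>simp_all add: typing\<close>)
  also have "(lun C ?XD \<cdot> assoc C ?I X ?D) \<cdot> ((assoc C ?I X ?D)\<dagger> \<cdot> ((id2 C ?I \<star> coev C X) \<cdot> ((run C ?I)\<dagger> \<cdot> f))) =
      lun C ?XD \<cdot> ((assoc C ?I X ?D \<cdot> (assoc C ?I X ?D)\<dagger>) \<cdot> ((id2 C ?I \<star> coev C X) \<cdot> ((run C ?I)\<dagger> \<cdot> f)))"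
    using T by (simp add: typing vcomp_assoc)
  also have "\<dots> = lun C ?XD \<cdot> ((id2 C ?I \<star> coev C X) \<cdot> ((lun C ?I)\<dagger> \<cdot> f))"
    using T by (simp add: typing assoc_inv vcomp_id lun_unit_eq_run_unit)
  also have "\<dots> = coev C X \<cdot> (lun C ?I \<cdot> ((lun C ?I)\<dagger> \<cdot> f))"
    by (rule vcomp_square[OF lun_nat']) (use T in \<open>simp_all add: typing\<close>)
  also have "lun C ?I \<cdot> ((lun C ?I)\<dagger> \<cdot> f) = f"
    using vcomp_extend[OF lun_inv(2)[OF a(2)], of f] T by (simp add: typing vcomp_id)
  finally show ?thesis using T by (simp add: typing vcomp_assoc)
qed

text \<open>Unitarity of the canonical map \<open>1\<^sup>\<or> \<Rightarrow> 1\<close> says that \<open>ev\<close> of the unit is unitary; the zigzag passes this on to \<open>coev\<close>.\<close>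

lemma coev_unit_isometric:
  assumes a: "a \<in> Ob C"
  shows "(coev C (unit1 C a))\<dagger> \<cdot> coev C (unit1 C a) = id2 C (unit1 C a)"
proof -
  let ?I = "unit1 C a"
  have I: "?I \<in> OneM C" "src C ?I = a" "trg C ?I = a" using a by (simp_all add: typing)
  interpret adjoint_pair C ?I "dual C ?I" "ev C ?I" "coev C ?I" by (rule adjoint_dual[OF I(1)])
  note T = a I
  have du: "unitary2 C (dual_unit C a)" using uaf a unfolding unitary_adjoint_functor_def by blast
  have "unitary2 C (dual_unit C a \<cdot> run C (dual C ?I))"
    by (rule unitary_comp) (use du T in \<open>simp_all add: typing unitary_struct dual_unit_def\<close>)
  moreover have "dual_unit C a \<cdot> run C (dual C ?I) = ev C ?I"
    unfolding dual_unit_def using T run_inv(1)[of "dual C ?I"] by (simp add: typing vcomp_assoc vcomp_id)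
  ultimately have e: "unitary2 C (ev C ?I)" by simp
  have "unitary2 C (coev C ?I \<star> id2 C ?I)"
  proof (rule unitary_middle)
    show "(run C ?I \<cdot> ((id2 C ?I \<star> ev C ?I) \<cdot> assoc C ?I (dual C ?I) ?I)) \<cdot> ((coev C ?I \<star> id2 C ?I) \<cdot> (lun C ?I)\<dagger>) = id2 C ?I"
      using zigzag(1) T by (simp add: typing vcomp_assoc)
    show "unitary2 C (run C ?I \<cdot> ((id2 C ?I \<star> ev C ?I) \<cdot> assoc C ?I (dual C ?I) ?I))"
      using e T by (intro unitary_intros) (simp_all add: typing)
    show "unitary2 C ((lun C ?I)\<dagger>)" using T by (intro unitary_intros) (simp_all add: typing)
  qed (use T in \<open>simp_all add: typing\<close>)
  then have "(coev C ?I \<star> id2 C ?I)\<dagger> \<cdot> (coev C ?I \<star> id2 C ?I) = id2 C (?I \<otimes> ?I)"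
    using unitary2D(1) T by (simp add: typing)
  then have "((coev C ?I)\<dagger> \<cdot> coev C ?I) \<star> id2 C ?I = id2 C ?I \<star> id2 C ?I"
    using T by (simp add: typing hcomp_rwhisker dagger_hcomp dagger_id hcomp_id')
  then show ?thesis
    by (rule unit_rwhisk_faithful[where X = ?I]) (use T in \<open>simp_all add: typing\<close>)
qed

text \<open>Faithfulness applied to \<open>h = c - 1\<close>, for which \<open>\<Psi>(h\<^sup>\<dagger> h) = \<Psi>(c h) - \<Psi>(h) = 0\<close>.\<close>

lemma weight_faithful:
  assumes a: "a \<in> Ob C" and c: "c \<in> hom2 C (unit1 C a) (unit1 C a)" "c\<dagger> = c"
    and w: "\<And>f. f \<in> hom2 C (unit1 C a) (unit1 C a) \<Longrightarrow> weight C a (c \<cdot> f) = weight C a f"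
  shows "c = id2 C (unit1 C a)"
proof -
  let ?I = "unit1 C a" let ?i = "id2 C (unit1 C a)"
  interpret K: dagger_category "hom_cat C a a" using hom_cat a by blast
  have E: "chom (hom_cat C a a) ?I ?I = hom2 C ?I ?I"
    by (rule chom_hom_cat[OF a a unit1_hom[OF a]])
  have fpf: "faithful_positive_functional C a" using spherical a unfolding spherical_weight_def by blast
  note fp = fpf[unfolded faithful_positive_functional_def Let_def]
  have i: "?i \<in> hom2 C ?I ?I" using a unfolding hom2_def by (simp add: typing)
  define h where "h = c \<boxplus> scale2 C (-1) ?i"
  have si: "scale2 C (-1) ?i \<in> hom2 C ?I ?I" using K.scale_hom[of ?i ?I ?I "-1"] i unfolding hom_cat_sel E by blast
  have h: "h \<in> hom2 C ?I ?I" unfolding h_def using K.add_hom[of c ?I ?I] c si unfolding hom_cat_sel E by blast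
  have hdag: "h\<dagger> = h"
    unfolding h_def using K.dag_add[of c ?I ?I "scale2 C (-1) ?i"] K.dag_scale[of ?i ?I ?I "-1"] c i si a
    unfolding hom_cat_sel E by (simp add: dagger_id typing)
  have ch: "c \<cdot> h \<in> hom2 C ?I ?I" using K.comp_hom[of h ?I ?I c ?I] c h unfolding hom_cat_sel E by blast
  have sh: "scale2 C (-1) h \<in> hom2 C ?I ?I" using K.scale_hom[of h ?I ?I "-1"] h unfolding hom_cat_sel E by blast
  have hh: "h\<dagger> \<cdot> h = (c \<cdot> h) \<boxplus> scale2 C (-1) h"
  proof -
    have "(c \<boxplus> scale2 C (-1) ?i) \<cdot> h = (c \<cdot> h) \<boxplus> (scale2 C (-1) ?i \<cdot> h)"
      using K.comp_add_left[of h ?I ?I c ?I "scale2 C (-1) ?i"] h c si unfolding hom_cat_sel E by blast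
    also have "scale2 C (-1) ?i \<cdot> h = scale2 C (-1) (?i \<cdot> h)"
      using K.comp_scale[of h ?I ?I ?i ?I] h i unfolding hom_cat_sel E by blast
    also have "?i \<cdot> h = h" using h vcomp_id(2)[of h ?I] unfolding hom2_def by blast
    finally show ?thesis unfolding hdag by (simp add: h_def)
  qed
  have "weight C a (h\<dagger> \<cdot> h) = weight C a (c \<cdot> h) + (-1) * weight C a h"
    unfolding hh using fp ch sh h by metis
  then have "weight C a (h\<dagger> \<cdot> h) = 0" using w[OF h] by simp
  then have h0: "h = zero2 C ?I ?I" using fp h by blast
  have "c = c \<boxplus> zero2 C ?I ?I" using K.add_zero[of c ?I ?I] c unfolding hom_cat_sel E by simp
  also have "zero2 C ?I ?I = scale2 C (-1 + 1) ?i" using K.scale_zero[of ?i ?I ?I] i unfolding hom_cat_sel E by simp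
  also have "\<dots> = scale2 C (-1) ?i \<boxplus> ?i"
    using K.scale_add_left[of ?i ?I ?I "-1" 1] K.scale_one[of ?i ?I ?I] i unfolding hom_cat_sel E by simp
  also have "c \<boxplus> (scale2 C (-1) ?i \<boxplus> ?i) = h \<boxplus> ?i"
    unfolding h_def using K.add_assoc[of c ?I ?I "scale2 C (-1) ?i" ?i] c si i unfolding hom_cat_sel E by simp
  also have "\<dots> = ?i"
    unfolding h0 using K.add_comm[of "zero2 C ?I ?I" ?I ?I ?i] K.add_zero[of ?i ?I ?I] K.zero_hom[of ?I ?I] i unit1_hom[OF a]
    unfolding hom_cat_sel E by simp
  finally show ?thesis .
qed

end

lemma three_hilbert_weighted: "three_hilbert C \<Longrightarrow> weighted_2category C"
  unfolding three_hilbert_def pre_three_hilbert_def finite_unitary_2category_def unitary_2category_def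
    cstar_2category_def weighted_2category_def weighted_2category_axioms_def by blast

section \<open>Tensoring with a 1-morphism\<close>

context dagger_2category
begin

lemma chom_iff:
  "f \<in> chom (hom_cat C a b) X Y \<longleftrightarrow> f \<in> TwoM C \<and> dom2 C f = X \<and> cod2 C f = Y \<and> src C X = a \<and> trg C X = b"
  using chomD two_chom' by blast

lemma hom1_iff: "X \<in> hom1 C a b \<longleftrightarrow> X \<in> OneM C \<and> src C X = a \<and> trg C X = b"
  unfolding hom1_def by blast

lemma hom2_iff: "f \<in> hom2 C X Y \<longleftrightarrow> f \<in> TwoM C \<and> dom2 C f = X \<and> cod2 C f = Y"
  unfolding hom2_def by blast

lemma iso2_ciso:
  assumes "f \<in> chom (hom_cat C a b) X Y" "iso2 C f"
  shows "ciso (hom_cat C a b) f"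
proof -
  note f = assms(1)[unfolded chom_iff]
  obtain g where g: "g \<in> TwoM C" "dom2 C g = cod2 C f" "cod2 C g = dom2 C f"
    "g \<cdot> f = id2 C (dom2 C f)" "f \<cdot> g = id2 C (cod2 C f)"
    using iso2E[OF assms(2)] f by metis
  have "X \<in> OneM C" using dom_cod[of f] f by blast
  then interpret K: dagger_category "hom_cat C a b" using hom_cat src_trg f by blast
  show ?thesis
    by (rule K.cisoI[OF assms(1), of g]) (use g f dom_cod[of f] in \<open>auto simp: chom_iff hom_cat_sel\<close>)
qed

lemma ciso_iso2:
  assumes "f \<in> chom (hom_cat C a b) X Y" "ciso (hom_cat C a b) f"
  shows "iso2 C f"
  using assms unfolding ciso_def cinverse_def hom_cat_sel iso2_def hom2_def chom_iff by auto

lemma rtensor_functor: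
  assumes "X \<in> hom1 C b c"
  shows "cat_functor (hom_cat C a b) (hom_cat C a c) (\<lambda>Z. Z \<otimes> X) (\<lambda>f. f \<star> id2 C X)"
  using assms unfolding cat_functor_def hom_cat_sel
  by (auto simp: chom_iff hom1_iff typing hcomp_id' hcomp_rwhisker)

lemma ff_ess_surj_rtensor_unit:
  assumes "a \<in> Ob C" "b \<in> Ob C"
  shows "ff_ess_surj (hom_cat C a b) (hom_cat C a b) (\<lambda>Z. Z \<otimes> unit1 C b) (\<lambda>f. f \<star> id2 C (unit1 C b))"
proof (rule ff_ess_surj_nat_iso[OF hom_cat hom_cat ff_ess_surj_id[OF hom_cat] rtensor_functor])
  show "nat_family (hom_cat C a b) (hom_cat C a b) id id (\<lambda>Z. Z \<otimes> unit1 C b) (\<lambda>f. f \<star> id2 C (unit1 C b)) (\<lambda>Z. (run C Z)\<dagger>)"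
    using assms unfolding nat_family_def hom_cat_sel by (auto simp: chom_iff hom1_iff typing run_dag_nat)
  show "ciso (hom_cat C a b) ((run C Z)\<dagger>)" if "Z \<in> cob (hom_cat C a b)" for Z
    using that unfolding hom_cat_sel hom1_iff
    by (intro iso2_ciso[of _ _ _ Z "Z \<otimes> unit1 C b"] unitary_iso2)
      (auto simp: chom_iff typing intro!: unitary_intros)
qed (use assms unit1_hom in auto)

end

context adjoint_pair
begin

text \<open>The quasi-inverse is \<open>- \<otimes> Xv\<close>, with unit and counit built from \<open>c\<close> and \<open>e\<close>.\<close>

lemma unitary_imp_ff_ess_surj_rtensor:
  assumes c: "unitary2 C c" and e: "unitary2 C e" and a: "a \<in> Ob C"
  shows "ff_ess_surj (hom_cat C a (src C X)) (hom_cat C a (trg C X)) (\<lambda>Z. Z \<otimes> X) (\<lambda>f. f \<star> id2 C X)"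
proof (rule cat_equivalence_imp_ff_ess_surj[OF hom_cat hom_cat])
  let ?K = "hom_cat C a (src C X)" let ?L = "hom_cat C a (trg C X)"
  let ?P0 = "\<lambda>Z. Z \<otimes> X" let ?P1 = "\<lambda>f. f \<star> id2 C X"
  let ?Q0 = "\<lambda>Z. Z \<otimes> Xv" let ?Q1 = "\<lambda>f. f \<star> id2 C Xv"
  define \<eta> where "\<eta> Z = (assoc C Z X Xv)\<dagger> \<cdot> ((id2 C Z \<star> c) \<cdot> (run C Z)\<dagger>)" for Z
  define \<epsilon> where "\<epsilon> Z = run C Z \<cdot> ((id2 C Z \<star> e) \<cdot> assoc C Z Xv X)" for Z
  have \<eta>t: "\<eta> Z \<in> TwoM C" "dom2 C (\<eta> Z) = Z" "cod2 C (\<eta> Z) = (Z \<otimes> X) \<otimes> Xv" "unitary2 C (\<eta> Z)"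
    if "Z \<in> OneM C" "trg C Z = src C X" for Z
    unfolding \<eta>_def using that c by (auto simp: typing intro!: unitary_intros)
  have \<epsilon>t: "\<epsilon> Z \<in> TwoM C" "dom2 C (\<epsilon> Z) = (Z \<otimes> Xv) \<otimes> X" "cod2 C (\<epsilon> Z) = Z" "unitary2 C (\<epsilon> Z)"
    if "Z \<in> OneM C" "trg C Z = trg C X" for Z
    unfolding \<epsilon>_def using that e by (auto simp: typing intro!: unitary_intros)
  have \<eta>n: "\<eta> W \<cdot> f = ((f \<star> id2 C X) \<star> id2 C Xv) \<cdot> \<eta> Z"
    if f: "f \<in> TwoM C" "dom2 C f = Z" "cod2 C f = W" "trg C Z = src C X" for f Z W
  proof -
    let ?J = "unit1 C (src C X)"
    have ZW: "Z \<in> OneM C" "W \<in> OneM C" "src C W = src C Z" "trg C W = trg C Z" using dom_cod[OF f(1)] f by simp_all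
    note T = f ZW
    have "\<eta> W \<cdot> f = (assoc C W X Xv)\<dagger> \<cdot> ((id2 C W \<star> c) \<cdot> ((run C W)\<dagger> \<cdot> f))"
      unfolding \<eta>_def using T by (simp add: typing vcomp_assoc)
    also have "(run C W)\<dagger> \<cdot> f = (f \<star> id2 C ?J) \<cdot> (run C Z)\<dagger>"
      by (rule run_dag_nat[symmetric]) (use T in simp_all)
    also have "(id2 C W \<star> c) \<cdot> ((f \<star> id2 C ?J) \<cdot> (run C Z)\<dagger>) = (f \<star> id2 C (X \<otimes> Xv)) \<cdot> ((id2 C Z \<star> c) \<cdot> (run C Z)\<dagger>)"
      by (rule vcomp_square[OF whisker_swap[symmetric]]) (use T in \<open>simp_all add: typing\<close>)
    also have "(assoc C W X Xv)\<dagger> \<cdot> ((f \<star> id2 C (X \<otimes> Xv)) \<cdot> ((id2 C Z \<star> c) \<cdot> (run C Z)\<dagger>)) =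
        ((f \<star> id2 C X) \<star> id2 C Xv) \<cdot> \<eta> Z"
      unfolding \<eta>_def by (rule vcomp_square[OF assoc_dag_nat_l]) (use T in \<open>simp_all add: typing\<close>)
    finally show ?thesis .
  qed
  have \<epsilon>n: "\<epsilon> W \<cdot> ((f \<star> id2 C Xv) \<star> id2 C X) = f \<cdot> \<epsilon> Z"
    if f: "f \<in> TwoM C" "dom2 C f = Z" "cod2 C f = W" "trg C Z = trg C X" for f Z W
  proof -
    let ?I = "unit1 C (trg C X)"
    have ZW: "Z \<in> OneM C" "W \<in> OneM C" "src C W = src C Z" "trg C W = trg C Z" using dom_cod[OF f(1)] f by simp_all
    note T = f ZW
    have "\<epsilon> W \<cdot> ((f \<star> id2 C Xv) \<star> id2 C X) = run C W \<cdot> ((id2 C W \<star> e) \<cdot> (assoc C W Xv X \<cdot> ((f \<star> id2 C Xv) \<star> id2 C X)))"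
      unfolding \<epsilon>_def using T by (simp add: typing vcomp_assoc)
    also have "assoc C W Xv X \<cdot> ((f \<star> id2 C Xv) \<star> id2 C X) = (f \<star> id2 C (Xv \<otimes> X)) \<cdot> assoc C Z Xv X"
      by (rule assoc_nat_l) (use T in \<open>simp_all add: typing\<close>)
    also have "(id2 C W \<star> e) \<cdot> ((f \<star> id2 C (Xv \<otimes> X)) \<cdot> assoc C Z Xv X) = (f \<star> id2 C ?I) \<cdot> ((id2 C Z \<star> e) \<cdot> assoc C Z Xv X)"
      by (rule vcomp_square[OF whisker_swap[symmetric]]) (use T in \<open>simp_all add: typing\<close>)
    also have "run C W \<cdot> ((f \<star> id2 C ?I) \<cdot> ((id2 C Z \<star> e) \<cdot> assoc C Z Xv X)) = f \<cdot> \<epsilon> Z"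
      unfolding \<epsilon>_def by (rule vcomp_square[OF run_nat']) (use T in \<open>simp_all add: typing\<close>)
    finally show ?thesis .
  qed
  have hX: "X \<in> hom1 C (src C X) (trg C X)" "Xv \<in> hom1 C (trg C X) (src C X)" by (simp_all add: hom1_iff typing)
  have "nat_family ?K ?K id id (?Q0 \<circ> ?P0) (?Q1 \<circ> ?P1) \<eta>"
    unfolding nat_family_def hom_cat_sel using \<eta>t \<eta>n by (auto simp: chom_iff hom1_iff)
  moreover have "nat_family ?L ?L (?P0 \<circ> ?Q0) (?P1 \<circ> ?Q1) id id \<epsilon>"
    unfolding nat_family_def hom_cat_sel using \<epsilon>t \<epsilon>n by (auto simp: chom_iff hom1_iff typing)
  moreover have "\<forall>Z\<in>cob ?K. ciso ?K (\<eta> Z)"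
  proof
    fix Z assume "Z \<in> cob ?K"
    then have Z: "Z \<in> OneM C" "src C Z = a" "trg C Z = src C X" unfolding hom_cat_sel hom1_iff by auto
    show "ciso ?K (\<eta> Z)"
      by (rule iso2_ciso[of _ _ _ Z "(Z \<otimes> X) \<otimes> Xv"]) (use \<eta>t[OF Z(1,3)] Z in \<open>simp_all add: chom_iff unitary_iso2\<close>)
  qed
  moreover have "\<forall>Z\<in>cob ?L. ciso ?L (\<epsilon> Z)"
  proof
    fix Z assume "Z \<in> cob ?L"
    then have Z: "Z \<in> OneM C" "src C Z = a" "trg C Z = trg C X" unfolding hom_cat_sel hom1_iff by auto
    show "ciso ?L (\<epsilon> Z)"
      by (rule iso2_ciso[of _ _ _ "(Z \<otimes> Xv) \<otimes> X" Z]) (use \<epsilon>t[OF Z(1,3)] Z in \<open>simp_all add: chom_iff unitary_iso2 typing\<close>)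
  qed
  ultimately show "cat_equivalence ?K ?L ?P0 ?P1"
    unfolding cat_equivalence_def using rtensor_functor[OF hX(1)] rtensor_functor[OF hX(2)] by blast
qed (use a src_trg adj_typing in auto)

lemma unitary_imp_equivalence1:
  assumes "unitary2 C c" "unitary2 C e"
  shows "equivalence1 C X"
  unfolding equivalence1_def
proof (intro conjI bexI[of _ Xv])
  show "\<exists>f\<in>hom2 C (X \<otimes> Xv) (unit1 C (src C X)). iso2 C f"
    using assms(1) by (intro bexI[of _ "c\<dagger>"] unitary_iso2 unitary_dagger) (simp_all add: hom2_iff typing)
  show "\<exists>f\<in>hom2 C (Xv \<otimes> X) (unit1 C (trg C X)). iso2 C f"
    using assms(2) by (intro bexI[of _ e] unitary_iso2) (simp_all add: hom2_iff typing)
qed (simp_all add: typing hom1_iff)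

end

section \<open>Unitary 2-adjoints\<close>

lemma restrict_eq_iff: "(\<lambda>a\<in>A. f a) = (\<lambda>a\<in>A. g a) \<longleftrightarrow> (\<forall>a\<in>A. f a = g a)"
  unfolding restrict_def fun_eq_iff by auto

lemma Hom_OneM_comp:
  assumes "\<alpha> \<in> Hom_OneM C D" "a \<in> Ob C"
  shows "ncomp \<alpha> a \<in> hom1 D (fob (nsrc \<alpha>) a) (fob (ntrg \<alpha>) a)"
proof -
  have "two_transformation C D (nsrc \<alpha>) (ntrg \<alpha>) (ncomp \<alpha>) (nnat \<alpha>)"
    using assms(1) unfolding Hom_OneM_def by blast
  then show ?thesis using two_transformation.comp_hom assms(2) by fast
qed

context weighted_2category
begin

text \<open>The 2-morphisms of \<open>Hom3\<close> compose, and the dual of a transformation is formed, componentwise.\<close>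

lemma Hom3_ev_coev_iff:
  assumes \<alpha>: "\<alpha> \<in> Hom_OneM B C"
  shows "unitary2 (Hom3 B C) (coev (Hom3 B C) \<alpha>) \<longleftrightarrow> (\<forall>a\<in>Ob B. unitary2 C (coev C (ncomp \<alpha> a)))"
    and "unitary2 (Hom3 B C) (ev (Hom3 B C) \<alpha>) \<longleftrightarrow> (\<forall>a\<in>Ob B. unitary2 C (ev C (ncomp \<alpha> a)))"
    and "isometric2 (Hom3 B C) (ev (Hom3 B C) \<alpha>) \<longleftrightarrow> (\<forall>a\<in>Ob B. isometric2 C (ev C (ncomp \<alpha> a)))"
proof -
  have t: "ncomp \<alpha> a \<in> OneM C" "src C (ncomp \<alpha> a) = fob (nsrc \<alpha>) a" "trg C (ncomp \<alpha> a) = fob (ntrg \<alpha>) a"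
    if "a \<in> Ob B" for a
    using Hom_OneM_comp[OF \<alpha> that] unfolding hom1_iff by blast+
  show "unitary2 (Hom3 B C) (coev (Hom3 B C) \<alpha>) \<longleftrightarrow> (\<forall>a\<in>Ob B. unitary2 C (coev C (ncomp \<alpha> a)))"
    unfolding unitary2_def
    by (simp add: Hom3_def Hom_unit1_def Hom_tensor_def Hom_dual_def restrict_eq_iff typing t ball_conj_distrib cong: ball_cong)
  show "unitary2 (Hom3 B C) (ev (Hom3 B C) \<alpha>) \<longleftrightarrow> (\<forall>a\<in>Ob B. unitary2 C (ev C (ncomp \<alpha> a)))"
    unfolding unitary2_def
    by (simp add: Hom3_def Hom_unit1_def Hom_tensor_def Hom_dual_def restrict_eq_iff typing t ball_conj_distrib cong: ball_cong)
  show "isometric2 (Hom3 B C) (ev (Hom3 B C) \<alpha>) \<longleftrightarrow> (\<forall>a\<in>Ob B. isometric2 C (ev C (ncomp \<alpha> a)))"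
    unfolding isometric2_def
    by (simp add: Hom3_def Hom_unit1_def Hom_tensor_def Hom_dual_def restrict_eq_iff typing t cong: ball_cong)
qed

end

lemma hom_2Hilb_sel:
  "cob (hom_2Hilb C a b) = cob (hom_cat C a b)" "carr (hom_2Hilb C a b) = carr (hom_cat C a b)"
  "cdom (hom_2Hilb C a b) = cdom (hom_cat C a b)" "ccod (hom_2Hilb C a b) = ccod (hom_cat C a b)"
  "cid (hom_2Hilb C a b) = cid (hom_cat C a b)" "ccomp (hom_2Hilb C a b) = ccomp (hom_cat C a b)"
  "cadd (hom_2Hilb C a b) = cadd (hom_cat C a b)" "cscale (hom_2Hilb C a b) = cscale (hom_cat C a b)"
  "cdag (hom_2Hilb C a b) = cdag (hom_cat C a b)" "ctr (hom_2Hilb C a b) = Tr C"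
  by (simp_all add: hom_2Hilb_def lin_cat.defs tr_cat.defs)

lemma chom_2Hilb: "chom (hom_2Hilb C a b) = chom (hom_cat C a b)"
  by (intro ext) (simp add: chom_def hom_2Hilb_sel)

lemma ciso_2Hilb: "ciso (hom_2Hilb C a b) = ciso (hom_cat C a b)"
  by (intro ext) (simp add: ciso_def cinverse_def chom_2Hilb hom_2Hilb_sel)

lemma isometric_equivalence_2HilbD:
  assumes "isometric_equivalence_2Hilb (hom_2Hilb C a b) (hom_2Hilb D c d) P0 P1"
  shows "cat_equivalence (hom_cat C a b) (hom_cat D c d) P0 P1"
    and "X \<in> hom1 C a b \<Longrightarrow> f \<in> chom (hom_cat C a b) X X \<Longrightarrow> Tr D (P0 X) (P1 f) = Tr C X f"
proof -
  note a = assms[unfolded isometric_equivalence_2Hilb_def]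
  show "cat_equivalence (hom_cat C a b) (hom_cat D c d) P0 P1"
    using dagger_equivalence_imp_cat_equivalence[OF conjunct1[OF a]]
    unfolding cat_equivalence_def cat_functor_def nat_family_def chom_2Hilb ciso_2Hilb hom_2Hilb_sel .
  show "X \<in> hom1 C a b \<Longrightarrow> f \<in> chom (hom_cat C a b) X X \<Longrightarrow> Tr D (P0 X) (P1 f) = Tr C X f"
    using a unfolding hom_2Hilb_sel chom_2Hilb by (simp add: hom_cat_def)
qed

locale hom_adjunction =
  C: weighted_2category C + D: weighted_2category D + H: natural_hom_isometries C D F G P0 P1 nx ny
  for C :: "('o, 'm, 'c) pre3" and D :: "('p, 'n, 'd) pre3"
    and F :: "('o, 'm, 'c, 'p, 'n, 'd) two_fun" and G :: "('p, 'n, 'd, 'o, 'm, 'c) two_fun"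
    and P0 P1 nx ny +
  assumes F: "F \<in> Hom_Ob C D" and G: "G \<in> Hom_Ob D C"
begin

lemma F_functor: "two_functor C D F" and G_functor: "two_functor D C G"
  using F G unfolding Hom_Ob_def dagger_2functor_def by blast+

lemma fob_typing [typing]: "a \<in> Ob C \<Longrightarrow> fob F a \<in> Ob D" "y \<in> Ob D \<Longrightarrow> fob G y \<in> Ob C"
  using two_functor.fob_in[OF F_functor] two_functor.fob_in[OF G_functor] by blast+

lemma F_hom: "a \<in> Ob C \<Longrightarrow> b \<in> Ob C \<Longrightarrow>
    cat_functor (hom_cat C a b) (hom_cat D (fob F a) (fob F b)) (fmor F) (fcell F)"
  by (rule two_functor.hom_functor[OF F_functor])

lemma F_typing [typing]:
  "X \<in> OneM C \<Longrightarrow> fmor F X \<in> OneM D" "X \<in> OneM C \<Longrightarrow> src D (fmor F X) = fob F (src C X)"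
  "X \<in> OneM C \<Longrightarrow> trg D (fmor F X) = fob F (trg C X)"
  using cat_functorD(1)[OF F_hom[OF C.src_trg], of X X X]
  unfolding C.hom_cat_sel D.hom_cat_sel C.hom1_iff D.hom1_iff by blast+

lemma F_typing2 [typing]:
  assumes "f \<in> TwoM C"
  shows "fcell F f \<in> TwoM D" "dom2 D (fcell F f) = fmor F (dom2 C f)" "cod2 D (fcell F f) = fmor F (cod2 C f)"
  using cat_functorD(2)[OF F_hom[OF C.src_trg[OF C.dom_cod(1)], OF assms assms] C.two_chom[OF assms]] 
  unfolding D.chom_iff by blast+

lemma funit_facts [typing]:
  assumes "a \<in> Ob C"
  shows "funit F a \<in> TwoM D" "dom2 D (funit F a) = unit1 D (fob F a)" "cod2 D (funit F a) = fmor F (unit1 C a)"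
    "unitary2 D (funit F a)"
  using two_functor.funit_hom[OF F_functor assms] F assms
  unfolding D.hom2_iff Hom_Ob_def dagger_2functor_def by blast+

lemma P_ff_ess_surj:
  assumes "x \<in> Ob C" "y \<in> Ob D"
  shows "ff_ess_surj (hom_cat D (fob F x) y) (hom_cat C x (fob G y)) (P0 x y) (P1 x y)"
  by (rule cat_equivalence_imp_ff_ess_surj[OF D.hom_cat C.hom_cat isometric_equivalence_2HilbD(1)[OF H.hom_isometry[OF assms]]])
    (use assms in \<open>simp_all add: typing\<close>)

lemma P0_typing:
  assumes "x \<in> Ob C" "g \<in> hom1 D (fob F x) y"
  shows "P0 x y g \<in> OneM C" "src C (P0 x y g) = x" "trg C (P0 x y g) = fob G y"
proof -
  have "y \<in> Ob D" using assms D.src_trg unfolding D.hom1_iff by blast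
  then show "P0 x y g \<in> OneM C" "src C (P0 x y g) = x" "trg C (P0 x y g) = fob G y"
    using cat_functorD(1)[OF ff_ess_surjD(1)[OF P_ff_ess_surj[OF assms(1)]], of y g] assms(2)
    unfolding C.hom_cat_sel D.hom_cat_sel C.hom1_iff by blast+
qed

lemma P1_typing:
  assumes "x \<in> Ob C" "y \<in> Ob D" "q \<in> TwoM D" "dom2 D q = g" "cod2 D q = h" "src D g = fob F x" "trg D g = y"
  shows "P1 x y q \<in> TwoM C" "dom2 C (P1 x y q) = P0 x y g" "cod2 C (P1 x y q) = P0 x y h"
  using cat_functorD(2)[OF ff_ess_surjD(1)[OF P_ff_ess_surj[OF assms(1,2)]], of q g h] assms
  unfolding C.chom_iff D.chom_iff by blast+

lemma P1_Tr:
  assumes "x \<in> Ob C" "y \<in> Ob D" "q \<in> TwoM D" "dom2 D q = g" "cod2 D q = g" "src D g = fob F x" "trg D g = y"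
  shows "Tr C (P0 x y g) (P1 x y q) = Tr D g q"
proof -
  have "g \<in> hom1 D (fob F x) y" using assms D.dom_cod unfolding D.hom1_iff by blast
  then show ?thesis
    using isometric_equivalence_2HilbD(2)[OF H.hom_isometry[OF assms(1,2)], of g q] assms D.chom_iff by blast
qed

end

text \<open>The unit and the counit of the adjunction both arise from this situation, with \<open>g\<close> respectively \<open>m\<close> a
  unit 1-morphism.\<close>

locale transposed_pair = hom_adjunction C D F G P0 P1 nx ny
  for C :: "('o, 'm, 'c) pre3" and D :: "('p, 'n, 'd) pre3"
    and F :: "('o, 'm, 'c, 'p, 'n, 'd) two_fun" and G :: "('p, 'n, 'd, 'o, 'm, 'c) two_fun"
    and P0 P1 nx ny +
  fixes b y g m \<theta>
  assumes b: "b \<in> Ob C" and g: "g \<in> hom1 D (fob F b) y" and m: "m \<in> hom1 C b (fob G y)"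
    and \<theta>: "\<theta> \<in> hom2 C (P0 b y g) m" "unitary2 C \<theta>"
begin

lemma pair_typing [typing]:
  "g \<in> OneM D" "src D g = fob F b" "trg D g = y" "y \<in> Ob D"
  "m \<in> OneM C" "src C m = b" "trg C m = fob G y"
  "P0 b y g \<in> OneM C" "src C (P0 b y g) = b" "trg C (P0 b y g) = fob G y"
  "\<theta> \<in> TwoM C" "dom2 C \<theta> = P0 b y g" "cod2 C \<theta> = m"
  using g m \<theta> P0_typing[OF b g] D.src_trg unfolding D.hom1_iff C.hom1_iff C.hom2_iff by blast+

text \<open>The isomorphism \<open>P(F(X) \<otimes> g) \<Rightarrow> X \<otimes> P(g) \<Rightarrow> X \<otimes> m\<close>.\<close>

definition transposition where "transposition X = (id2 C X \<star>\<^bsub>C\<^esub> \<theta>) \<cdot>\<^bsub>C\<^esub> nx X g"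

lemma nx_typing:
  assumes X: "X \<in> OneM C" "trg C X = b"
  shows "nx X g \<in> TwoM C" "dom2 C (nx X g) = P0 (src C X) y (fmor F X \<otimes>\<^bsub>D\<^esub> g)"
    "cod2 C (nx X g) = X \<otimes>\<^bsub>C\<^esub> P0 b y g" "unitary2 C (nx X g)"
  using H.nx_hom[OF b, of X "src C X" g y] X g unfolding C.hom1_iff C.hom2_iff by blast+

lemma transposition_typing:
  assumes X: "X \<in> OneM C" "trg C X = b"
  shows "transposition X \<in> TwoM C" "dom2 C (transposition X) = P0 (src C X) y (fmor F X \<otimes>\<^bsub>D\<^esub> g)"
    "cod2 C (transposition X) = X \<otimes>\<^bsub>C\<^esub> m" "unitary2 C (transposition X)"
  unfolding transposition_def using nx_typing[OF X] X \<theta>(2)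
  by (simp_all add: typing C.unitary_comp C.unitary_hcomp C.unitary_id)

lemma transposition_natural:
  assumes f: "f \<in> TwoM C" "dom2 C f = X" "cod2 C f = X'" "src C X = a" "trg C X = b"
  shows "transposition X' \<cdot>\<^bsub>C\<^esub> (P1 a y (fcell F f \<star>\<^bsub>D\<^esub> id2 D g)) = (f \<star>\<^bsub>C\<^esub> id2 C m) \<cdot>\<^bsub>C\<^esub> transposition X"
proof -
  have X: "X \<in> OneM C" "X' \<in> OneM C" "src C X' = a" "trg C X' = b" "a \<in> Ob C"
    using C.dom_cod[OF f(1)] C.src_trg f by (simp_all, blast)
  note T = f X b
  let ?q = "P1 a y (fcell F f \<star>\<^bsub>D\<^esub> id2 D g)"
  have q: "?q \<in> TwoM C" "dom2 C ?q = P0 a y (fmor F X \<otimes>\<^bsub>D\<^esub> g)" "cod2 C ?q = P0 a y (fmor F X' \<otimes>\<^bsub>D\<^esub> g)"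
    using P1_typing[of a y "fcell F f \<star>\<^bsub>D\<^esub> id2 D g"] T by (simp_all add: typing)
  have gid: "P1 b y (id2 D g) = id2 C (P0 b y g)"
    using cat_functorD(3)[OF ff_ess_surjD(1)[OF P_ff_ess_surj[OF b pair_typing(4)]], of g] g
    unfolding C.hom_cat_sel D.hom_cat_sel by blast
  have n: "nx X' g \<cdot>\<^bsub>C\<^esub> ?q = (f \<star>\<^bsub>C\<^esub> id2 C (P0 b y g)) \<cdot>\<^bsub>C\<^esub> nx X g"
    using H.nx_nat[of X a b g y f X' "id2 D g" g] T g pair_typing gid
    unfolding C.hom1_iff D.hom1_iff C.hom2_iff D.hom2_iff by (simp add: typing)
  have "transposition X' \<cdot>\<^bsub>C\<^esub> ?q = (id2 C X' \<star>\<^bsub>C\<^esub> \<theta>) \<cdot>\<^bsub>C\<^esub> nx X' g \<cdot>\<^bsub>C\<^esub> ?q"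
    unfolding transposition_def using T q nx_typing[OF X(2,4)] by (simp add: typing C.vcomp_assoc)
  also have "\<dots> = (f \<star>\<^bsub>C\<^esub> id2 C m) \<cdot>\<^bsub>C\<^esub> transposition X"
    unfolding n transposition_def
    by (rule C.vcomp_square[OF C.whisker_swap[symmetric]]) (use T nx_typing[OF X(1) f(5)] in \<open>simp_all add: typing\<close>)
  finally show ?thesis .
qed

text \<open>The natural isomorphism \<open>transposition\<close> identifies \<open>P\<close> composed with the functor on the right with the functor on the
  left, and \<open>P\<close> can be cancelled.\<close>

lemma ff_ess_surj_transfer:
  assumes a: "a \<in> Ob C"
  shows "ff_ess_surj (hom_cat C a b) (hom_cat C a (fob G y)) (\<lambda>Z. Z \<otimes>\<^bsub>C\<^esub> m) (\<lambda>f. f \<star>\<^bsub>C\<^esub> id2 C m) \<longleftrightarrow>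
    ff_ess_surj (hom_cat C a b) (hom_cat D (fob F a) y) ((\<lambda>Z. Z \<otimes>\<^bsub>D\<^esub> g) \<circ> fmor F) ((\<lambda>f. f \<star>\<^bsub>D\<^esub> id2 D g) \<circ> fcell F)"
    (is "ff_ess_surj ?K ?L ?M0 ?M1 \<longleftrightarrow> ff_ess_surj ?K ?N ?Q0 ?Q1")
proof -
  have cats: "dagger_category ?K" "dagger_category ?L" "dagger_category ?N"
    using a b pair_typing C.hom_cat D.hom_cat fob_typing by blast+
  have M: "cat_functor ?K ?L ?M0 ?M1" by (rule C.rtensor_functor[OF m])
  have Q: "cat_functor ?K ?N ?Q0 ?Q1" by (rule cat_functor_comp[OF F_hom[OF a b] D.rtensor_functor[OF g]])
  have P: "ff_ess_surj ?N ?L (P0 a y) (P1 a y)" by (rule P_ff_ess_surj[OF a pair_typing(4)])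
  have PQ: "cat_functor ?K ?L (P0 a y \<circ> ?Q0) (P1 a y \<circ> ?Q1)"
    by (rule cat_functor_comp[OF Q ff_ess_surjD(1)[OF P]])
  have nat: "nat_family ?K ?L (P0 a y \<circ> ?Q0) (P1 a y \<circ> ?Q1) ?M0 ?M1 transposition"
    unfolding nat_family_def C.hom_cat_sel
    using transposition_typing transposition_natural by (auto simp: C.chom_iff C.hom1_iff typing P0_typing D.hom1_iff a)
  have iso: "ciso ?L (transposition X)" "transposition X \<in> chom ?L ((P0 a y \<circ> ?Q0) X) (?M0 X)" if "X \<in> cob ?K" for X
  proof -
    have X: "X \<in> OneM C" "src C X = a" "trg C X = b" using that unfolding C.hom_cat_sel C.hom1_iff by blast+
    show c: "transposition X \<in> chom ?L ((P0 a y \<circ> ?Q0) X) (?M0 X)"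
      using nat that unfolding nat_family_def by blast
    show "ciso ?L (transposition X)" by (rule C.iso2_ciso[OF c C.unitary_iso2]) (use transposition_typing[OF X(1,3)] in blast)+
  qed
  have dnat: "nat_family ?K ?L ?M0 ?M1 (P0 a y \<circ> ?Q0) (P1 a y \<circ> ?Q1) (\<lambda>X. (transposition X)\<dagger>\<^bsub>C\<^esub>)"
    unfolding nat_family_def C.hom_cat_sel
  proof (intro conjI ballI allI)
    fix X assume X: "X \<in> hom1 C a b"
    then show "(transposition X)\<dagger>\<^bsub>C\<^esub> \<in> chom ?L (?M0 X) ((P0 a y \<circ> ?Q0) X)"
      using iso(2)[of X] unfolding C.hom_cat_sel C.chom_iff by (auto simp: typing C.hom1_iff)
  next
    fix X X' f assume f: "f \<in> chom ?K X X'"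
    then have X: "X \<in> OneM C" "X' \<in> OneM C" "src C X = a" "trg C X = b" "src C X' = a" "trg C X' = b"
      and f': "f \<in> TwoM C" "dom2 C f = X" "cod2 C f = X'"
      using C.chomD by blast+
    note t = transposition_typing[OF X(1,4)] transposition_typing[OF X(2,6)]
    let ?p = "P1 a y (fcell F f \<star>\<^bsub>D\<^esub> id2 D g)"
    have p: "?p \<in> TwoM C" "dom2 C ?p = P0 a y (fmor F X \<otimes>\<^bsub>D\<^esub> g)" "cod2 C ?p = P0 a y (fmor F X' \<otimes>\<^bsub>D\<^esub> g)"
      using P1_typing[of a y "fcell F f \<star>\<^bsub>D\<^esub> id2 D g"] f' X a b by (simp_all add: typing)
    have "((transposition X')\<dagger>\<^bsub>C\<^esub> \<cdot>\<^bsub>C\<^esub> (f \<star>\<^bsub>C\<^esub> id2 C m)) \<cdot>\<^bsub>C\<^esub> transposition X = (?p \<cdot>\<^bsub>C\<^esub> (transposition X)\<dagger>\<^bsub>C\<^esub>) \<cdot>\<^bsub>C\<^esub> transposition X"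
    proof -
      have "((transposition X')\<dagger>\<^bsub>C\<^esub> \<cdot>\<^bsub>C\<^esub> (f \<star>\<^bsub>C\<^esub> id2 C m)) \<cdot>\<^bsub>C\<^esub> transposition X =
         (transposition X')\<dagger>\<^bsub>C\<^esub> \<cdot>\<^bsub>C\<^esub> transposition X' \<cdot>\<^bsub>C\<^esub> ?p"
        using t f' X by (simp add: typing C.vcomp_assoc transposition_natural[OF f' X(3,4)])
      also have "\<dots> = ?p"
        using C.vcomp_extend[OF C.unitary2D(1)[OF t(8)], of ?p] t p X by (simp add: typing C.vcomp_id)
      finally show ?thesis using C.unitary2D(1)[OF t(4)] t p X by (simp add: typing C.vcomp_assoc C.vcomp_id)
    qed
    then have "(transposition X')\<dagger>\<^bsub>C\<^esub> \<cdot>\<^bsub>C\<^esub> (f \<star>\<^bsub>C\<^esub> id2 C m) = ?p \<cdot>\<^bsub>C\<^esub> (transposition X)\<dagger>\<^bsub>C\<^esub>"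
      by (rule C.vcomp_cancel_right[where k = "(transposition X)\<dagger>\<^bsub>C\<^esub>" and X = "X \<otimes>\<^bsub>C\<^esub> m"])
        (use t p f' X C.unitary2D(2)[OF t(4)] in \<open>simp_all add: typing\<close>)
    then show "(transposition X')\<dagger>\<^bsub>C\<^esub> \<cdot>\<^bsub>C\<^esub> ?M1 f = ((P1 a y \<circ> ?Q1) f) \<cdot>\<^bsub>C\<^esub> (transposition X)\<dagger>\<^bsub>C\<^esub>" by simp
  qed
  have diso: "ciso ?L ((transposition X)\<dagger>\<^bsub>C\<^esub>)" if "X \<in> cob ?K" for X
  proof -
    have X: "X \<in> OneM C" "src C X = a" "trg C X = b" using that unfolding C.hom_cat_sel C.hom1_iff by blast+
    have "(transposition X)\<dagger>\<^bsub>C\<^esub> \<in> chom ?L (?M0 X) ((P0 a y \<circ> ?Q0) X)" using dnat that unfolding nat_family_def by blast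
    then show ?thesis
      by (rule C.iso2_ciso[OF _ C.unitary_iso2]) (use transposition_typing[OF X(1,3)] C.unitary_dagger C.dagger_typing in blast)+
  qed
  show ?thesis
  proof
    assume "ff_ess_surj ?K ?L ?M0 ?M1"
    then have "ff_ess_surj ?K ?L (P0 a y \<circ> ?Q0) (P1 a y \<circ> ?Q1)"
      by (rule ff_ess_surj_nat_iso[OF cats(1,2) _ PQ dnat diso])
    then show "ff_ess_surj ?K ?N ?Q0 ?Q1" by (rule ff_ess_surj_cancel_left[OF cats(1,3,2) Q P])
  next
    assume "ff_ess_surj ?K ?N ?Q0 ?Q1"
    then have "ff_ess_surj ?K ?L (P0 a y \<circ> ?Q0) (P1 a y \<circ> ?Q1)" using P by (rule ff_ess_surj_comp[OF cats(3,2)])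
    then show "ff_ess_surj ?K ?L ?M0 ?M1" by (rule ff_ess_surj_nat_iso[OF cats(1,2) _ M nat iso(1)])
  qed
qed

text \<open>Both sides are traces of \<open>f\<close> whiskered by \<open>m\<close> respectively \<open>g\<close> (\<open>Tr_unit_whisker\<close>); \<open>transposition\<close> at the unit
  1-morphism intertwines the two, and \<open>P\<close> preserves traces.\<close>

lemma weight_transfer:
  assumes f: "f \<in> hom2 C (unit1 C b) (unit1 C b)"
  shows "weight C b (((coev C m)\<dagger>\<^bsub>C\<^esub> \<cdot>\<^bsub>C\<^esub> coev C m) \<cdot>\<^bsub>C\<^esub> f) =
    weight D (fob F b) (((coev D g)\<dagger>\<^bsub>D\<^esub> \<cdot>\<^bsub>D\<^esub> coev D g) \<cdot>\<^bsub>D\<^esub> (funit F b)\<dagger>\<^bsub>D\<^esub> \<cdot>\<^bsub>D\<^esub> fcell F f \<cdot>\<^bsub>D\<^esub> funit F b)"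
proof -
  let ?I = "unit1 C b" let ?f' = "(funit F b)\<dagger>\<^bsub>D\<^esub> \<cdot>\<^bsub>D\<^esub> fcell F f \<cdot>\<^bsub>D\<^esub> funit F b"
  have f: "f \<in> TwoM C" "dom2 C f = ?I" "cod2 C f = ?I" using f unfolding C.hom2_iff by blast+
  have I: "?I \<in> OneM C" "src C ?I = b" "trg C ?I = b" "fob F b \<in> Ob D" using b by (simp_all add: typing)
  note u = funit_facts[OF b]
  let ?u = "funit F b" let ?Ff = "fcell F f" let ?ig = "id2 D g"
  have Ff: "?Ff \<in> TwoM D" "dom2 D ?Ff = fmor F ?I" "cod2 D ?Ff = fmor F ?I" using f by (simp_all add: typing)
  have f': "?f' \<in> TwoM D" "dom2 D ?f' = unit1 D (fob F b)" "cod2 D ?f' = unit1 D (fob F b)"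
    using u Ff by (simp_all add: typing)
  note t = transposition_typing[OF I(1,3)]
  let ?q = "?Ff \<star>\<^bsub>D\<^esub> ?ig"
  have q: "?q \<in> TwoM D" "dom2 D ?q = fmor F ?I \<otimes>\<^bsub>D\<^esub> g" "cod2 D ?q = fmor F ?I \<otimes>\<^bsub>D\<^esub> g"
    "src D (fmor F ?I \<otimes>\<^bsub>D\<^esub> g) = fob F b" "trg D (fmor F ?I \<otimes>\<^bsub>D\<^esub> g) = y"
    using Ff I by (simp_all add: typing)
  have "weight C b (((coev C m)\<dagger>\<^bsub>C\<^esub> \<cdot>\<^bsub>C\<^esub> coev C m) \<cdot>\<^bsub>C\<^esub> f) = Tr C (?I \<otimes>\<^bsub>C\<^esub> m) (f \<star>\<^bsub>C\<^esub> id2 C m)"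
    by (rule C.Tr_unit_whisker[symmetric]) (use f in \<open>simp_all add: typing\<close>)
  also have "\<dots> = Tr C (P0 b y (fmor F ?I \<otimes>\<^bsub>D\<^esub> g)) (P1 b y ?q)"
    by (rule C.Tr_intertwine[symmetric, where k = "transposition ?I"])
      (use t f I transposition_natural[OF f I(2,3)] P1_typing[OF b pair_typing(4) q] in \<open>simp_all add: typing\<close>)
  also have "\<dots> = Tr D (fmor F ?I \<otimes>\<^bsub>D\<^esub> g) ?q"
    by (rule P1_Tr[OF b pair_typing(4) q])
  also have "\<dots> = Tr D (unit1 D (fob F b) \<otimes>\<^bsub>D\<^esub> g) (?f' \<star>\<^bsub>D\<^esub> ?ig)"
  proof (rule D.Tr_intertwine[symmetric, where k = "?u \<star>\<^bsub>D\<^esub> ?ig"])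
    have "?u \<cdot>\<^bsub>D\<^esub> ?f' = ?Ff \<cdot>\<^bsub>D\<^esub> ?u"
      using D.vcomp_extend[OF D.unitary2D(2)[OF u(4)], of "?Ff \<cdot>\<^bsub>D\<^esub> ?u"] u Ff by (simp add: typing D.vcomp_id)
    then show "(?u \<star>\<^bsub>D\<^esub> ?ig) \<cdot>\<^bsub>D\<^esub> (?f' \<star>\<^bsub>D\<^esub> ?ig) = ?q \<cdot>\<^bsub>D\<^esub> (?u \<star>\<^bsub>D\<^esub> ?ig)"
      using u Ff f' I D.hcomp_rwhisker[of g ?f' ?u] D.hcomp_rwhisker[of g ?u ?Ff] by (simp add: typing)
    show "unitary2 D (?u \<star>\<^bsub>D\<^esub> ?ig)" by (rule D.unitary_hcomp) (use u I in \<open>simp_all add: typing D.unitary_id\<close>)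
  qed (use u Ff f' I in \<open>simp_all add: typing\<close>)
  also have "\<dots> = weight D (fob F b) (((coev D g)\<dagger>\<^bsub>D\<^esub> \<cdot>\<^bsub>D\<^esub> coev D g) \<cdot>\<^bsub>D\<^esub> ?f')"
    by (rule D.Tr_unit_whisker) (use f' in \<open>simp_all add: typing\<close>)
  finally show ?thesis .
qed

end

section \<open>Unit and counit of an isometry\<close>

lemma (in dagger_2category) ff_ess_surj_rtensor_bij:
  assumes "ff_ess_surj (hom_cat C a b) (hom_cat C a c) (\<lambda>Z. Z \<otimes> X) (\<lambda>f. f \<star> id2 C X)"
    "X \<in> hom1 C b c" "Z \<in> hom1 C a b" "W \<in> hom1 C a b"
  shows "bij_betw (\<lambda>f. f \<star> id2 C X) (hom2 C Z W) (hom2 C (Z \<otimes> X) (W \<otimes> X))"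
proof -
  have o: "a \<in> Ob C" "b \<in> Ob C" "c \<in> Ob C" using assms(2,3) src_trg unfolding hom1_iff by blast+
  have "Z \<otimes> X \<in> hom1 C a c" using assms(2,3) tensor_hom by blast
  then show ?thesis
    using ff_ess_surjD(2)[OF assms(1), of Z W] assms(3,4) chom_hom_cat[OF o(1,2) assms(3)] chom_hom_cat[OF o(1,3)]
    unfolding hom_cat_sel by simp
qed

context hom_adjunction
begin

context
  fixes \<eta> \<theta>
  assumes \<eta>: "\<And>x. x \<in> Ob C \<Longrightarrow> \<eta> x \<in> hom1 C x (fob G (fob F x))"
    and \<theta>: "\<And>x. x \<in> Ob C \<Longrightarrow> \<theta> x \<in> hom2 C (P0 x (fob F x) (unit1 D (fob F x))) (\<eta> x)"
      "\<And>x. x \<in> Ob C \<Longrightarrow> unitary2 C (\<theta> x)"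
begin

lemma unit_transposed: "x \<in> Ob C \<Longrightarrow> transposed_pair C D F G P0 P1 nx ny x (fob F x) (unit1 D (fob F x)) (\<eta> x) (\<theta> x)"
  using \<eta> \<theta> D.unit1_hom fob_typing by unfold_locales blast+

lemma unit_weight:
  assumes x: "x \<in> Ob C" and f: "f \<in> hom2 C (unit1 C x) (unit1 C x)"
  shows "weight C x (((coev C (\<eta> x))\<dagger>\<^bsub>C\<^esub> \<cdot>\<^bsub>C\<^esub> coev C (\<eta> x)) \<cdot>\<^bsub>C\<^esub> f) =
    weight D (fob F x) ((funit F x)\<dagger>\<^bsub>D\<^esub> \<cdot>\<^bsub>D\<^esub> fcell F f \<cdot>\<^bsub>D\<^esub> funit F x)"
proof -
  interpret transposed_pair C D F G P0 P1 nx ny x "fob F x" "unit1 D (fob F x)" "\<eta> x" "\<theta> x"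
    by (rule unit_transposed[OF x])
  show ?thesis
    using weight_transfer[OF f] D.coev_unit_isometric[OF fob_typing(1)[OF x]] f x funit_facts[OF x]
    by (simp add: typing C.hom2_iff D.vcomp_id)
qed

lemma unit_ff_ess_surj:
  assumes a: "a \<in> Ob C" and b: "b \<in> Ob C"
  shows "ff_ess_surj (hom_cat C a b) (hom_cat C a (fob G (fob F b))) (\<lambda>Z. Z \<otimes>\<^bsub>C\<^esub> \<eta> b) (\<lambda>f. f \<star>\<^bsub>C\<^esub> id2 C (\<eta> b)) \<longleftrightarrow>
    ff_ess_surj (hom_cat C a b) (hom_cat D (fob F a) (fob F b)) (fmor F) (fcell F)"
proof -
  interpret transposed_pair C D F G P0 P1 nx ny b "fob F b" "unit1 D (fob F b)" "\<eta> b" "\<theta> b"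
    by (rule unit_transposed[OF b])
  have cats: "dagger_category (hom_cat C a b)" "dagger_category (hom_cat D (fob F a) (fob F b))"
    using a b C.hom_cat D.hom_cat fob_typing by blast+
  have u: "ff_ess_surj (hom_cat D (fob F a) (fob F b)) (hom_cat D (fob F a) (fob F b))
      (\<lambda>Z. Z \<otimes>\<^bsub>D\<^esub> unit1 D (fob F b)) (\<lambda>f. f \<star>\<^bsub>D\<^esub> id2 D (unit1 D (fob F b)))"
    by (rule D.ff_ess_surj_rtensor_unit) (use a b fob_typing in blast)+
  show ?thesis
    unfolding ff_ess_surj_transfer[OF a]
    using ff_ess_surj_cancel_left[OF cats(1,2,2) F_hom[OF a b] u] ff_ess_surj_comp[OF cats(2,2) _ u] by blast
qed

text \<open>If \<open>F\<close> is an isometry, \<open>- \<otimes> \<eta>\<^sub>x\<close> is an equivalence, so that \<open>coev\<close> is invertible and \<open>\<eta>\<^sub>x\<close> has a left inverse \<open>Y\<close>. In the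
  other direction \<open>- \<otimes> \<eta>\<^sub>b\<close> is an equivalence and \<open>unit_weight\<close> specialises to preservation of weights.\<close>

lemma isometry_iff_unit:
  "isometry_3Hilb C D F \<longleftrightarrow> (\<forall>x\<in>Ob C. unitary2 C (coev C (\<eta> x)) \<and> unitary2 C (ev C (\<eta> x)))"
proof
  assume iso: "isometry_3Hilb C D F"
  show "\<forall>x\<in>Ob C. unitary2 C (coev C (\<eta> x)) \<and> unitary2 C (ev C (\<eta> x))"
  proof
    fix x assume x: "x \<in> Ob C"
    let ?e = "\<eta> x" let ?y = "fob G (fob F x)"
    have e: "?e \<in> OneM C" "src C ?e = x" "trg C ?e = ?y" using \<eta>[OF x] unfolding C.hom1_iff by blast+
    have y: "?y \<in> Ob C" using x by (simp add: typing)
    interpret A: adjoint_pair C ?e "dual C ?e" "ev C ?e" "coev C ?e" by (rule C.adjoint_dual[OF e(1)])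
    have ff: "ff_ess_surj (hom_cat C a x) (hom_cat C a ?y) (\<lambda>Z. Z \<otimes>\<^bsub>C\<^esub> ?e) (\<lambda>f. f \<star>\<^bsub>C\<^esub> id2 C ?e)" if "a \<in> Ob C" for a
      unfolding unit_ff_ess_surj[OF that x]
      by (rule cat_equivalence_imp_ff_ess_surj[OF C.hom_cat D.hom_cat])
        (use iso that x in \<open>auto simp: typing isometry_3Hilb_def\<close>)
    have cc: "(coev C ?e)\<dagger>\<^bsub>C\<^esub> \<cdot>\<^bsub>C\<^esub> coev C ?e = id2 C (unit1 C x)"
    proof (rule C.weight_faithful[OF x])
      show "(coev C ?e)\<dagger>\<^bsub>C\<^esub> \<cdot>\<^bsub>C\<^esub> coev C ?e \<in> hom2 C (unit1 C x) (unit1 C x)"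
        unfolding C.hom2_iff using e by (simp add: typing)
      show "((coev C ?e)\<dagger>\<^bsub>C\<^esub> \<cdot>\<^bsub>C\<^esub> coev C ?e)\<dagger>\<^bsub>C\<^esub> = (coev C ?e)\<dagger>\<^bsub>C\<^esub> \<cdot>\<^bsub>C\<^esub> coev C ?e"
        using e by (simp add: typing C.dagger_vcomp C.dagger_dagger)
      show "weight C x (((coev C ?e)\<dagger>\<^bsub>C\<^esub> \<cdot>\<^bsub>C\<^esub> coev C ?e) \<cdot>\<^bsub>C\<^esub> f) = weight C x f"
        if "f \<in> hom2 C (unit1 C x) (unit1 C x)" for f
        unfolding unit_weight[OF x that]
        using iso that x unfolding isometry_3Hilb_def preserves_weights_def by blast
    qed
    have c: "unitary2 C (coev C ?e)"
      by (rule A.fully_faithful_imp_coev_unitary)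
        (use cc e C.ff_ess_surj_rtensor_bij[OF ff[OF x] \<eta>[OF x]] in simp_all)
    obtain Y where Y: "Y \<in> hom1 C ?y x" "isomorphic (hom_cat C ?y ?y) (Y \<otimes>\<^bsub>C\<^esub> ?e) (unit1 C ?y)"
      using ff_ess_surjD(3)[OF ff[OF y], of "unit1 C ?y"] C.unit1_hom[OF y] unfolding C.hom_cat_sel by blast
    obtain t where t: "t \<in> chom (hom_cat C ?y ?y) (Y \<otimes>\<^bsub>C\<^esub> ?e) (unit1 C ?y)" "ciso (hom_cat C ?y ?y) t"
      using Y(2) unfolding isomorphic_def by blast
    have "unitary2 C (ev C ?e)"
      by (rule A.coev_unitary_imp_ev_unitary[OF c, of Y t])
        (use Y(1) t(1) e C.ciso_iso2[OF t] in \<open>simp_all add: C.hom1_iff C.chom_iff\<close>)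
    then show "unitary2 C (coev C ?e) \<and> unitary2 C (ev C ?e)" using c by blast
  qed
next
  assume u: "\<forall>x\<in>Ob C. unitary2 C (coev C (\<eta> x)) \<and> unitary2 C (ev C (\<eta> x))"
  have e: "\<eta> x \<in> OneM C" "src C (\<eta> x) = x" "trg C (\<eta> x) = fob G (fob F x)" if "x \<in> Ob C" for x
    using \<eta>[OF that] unfolding C.hom1_iff by blast+
  have "cat_equivalence (hom_cat C a b) (hom_cat D (fob F a) (fob F b)) (fmor F) (fcell F)"
    if ab: "a \<in> Ob C" "b \<in> Ob C" for a b
  proof (rule ff_ess_surj_imp_cat_equivalence[OF C.hom_cat D.hom_cat])
    show "ff_ess_surj (hom_cat C a b) (hom_cat D (fob F a) (fob F b)) (fmor F) (fcell F)"
      using adjoint_pair.unitary_imp_ff_ess_surj_rtensor[OF C.adjoint_dual[OF e(1)[OF ab(2)]], of a] u ab e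
      unfolding unit_ff_ess_surj[OF ab, symmetric] by simp
  qed (use ab in \<open>simp_all add: typing\<close>)
  moreover have "preserves_weights C D F"
    unfolding preserves_weights_def
  proof (intro ballI)
    fix a f assume a: "a \<in> Ob C" and f: "f \<in> hom2 C (unit1 C a) (unit1 C a)"
    have "(coev C (\<eta> a))\<dagger>\<^bsub>C\<^esub> \<cdot>\<^bsub>C\<^esub> coev C (\<eta> a) = id2 C (unit1 C a)"
      using C.unitary2D(1) u a e[OF a] by (simp add: typing)
    then show "weight D (fob F a) ((funit F a)\<dagger>\<^bsub>D\<^esub> \<cdot>\<^bsub>D\<^esub> fcell F f \<cdot>\<^bsub>D\<^esub> funit F a) = weight C a f"
      using unit_weight[OF a f] f by (simp add: C.hom2_iff C.vcomp_id)
  qed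
  ultimately show "isometry_3Hilb C D F"
    unfolding isometry_3Hilb_def using F by (simp add: Hom3_def)
qed

end

context
  fixes \<epsilon> \<theta>
  assumes \<epsilon>: "\<And>y. y \<in> Ob D \<Longrightarrow> \<epsilon> y \<in> hom1 D (fob F (fob G y)) y"
    and \<theta>: "\<And>y. y \<in> Ob D \<Longrightarrow> \<theta> y \<in> hom2 C (P0 (fob G y) y (\<epsilon> y)) (unit1 C (fob G y))"
      "\<And>y. y \<in> Ob D \<Longrightarrow> unitary2 C (\<theta> y)"
begin

lemma counit_transposed: "y \<in> Ob D \<Longrightarrow> transposed_pair C D F G P0 P1 nx ny (fob G y) y (\<epsilon> y) (unit1 C (fob G y)) (\<theta> y)"
  using \<epsilon> \<theta> C.unit1_hom fob_typing by unfold_locales blast+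

lemma counit_weight:
  assumes y: "y \<in> Ob D" and f: "f \<in> hom2 C (unit1 C (fob G y)) (unit1 C (fob G y))"
  shows "weight D (fob F (fob G y)) (((coev D (\<epsilon> y))\<dagger>\<^bsub>D\<^esub> \<cdot>\<^bsub>D\<^esub> coev D (\<epsilon> y)) \<cdot>\<^bsub>D\<^esub> (funit F (fob G y))\<dagger>\<^bsub>D\<^esub> \<cdot>\<^bsub>D\<^esub> fcell F f \<cdot>\<^bsub>D\<^esub> funit F (fob G y)) = weight C (fob G y) f"
proof -
  interpret transposed_pair C D F G P0 P1 nx ny "fob G y" y "\<epsilon> y" "unit1 C (fob G y)" "\<theta> y"
    by (rule counit_transposed[OF y])
  show ?thesis
    using weight_transfer[OF f] C.coev_unit_isometric[OF fob_typing(2)[OF y]] f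
    by (simp add: C.hom2_iff C.vcomp_id)
qed

lemma counit_ff_ess_surj:
  assumes a: "a \<in> Ob C" and y: "y \<in> Ob D"
  shows "ff_ess_surj (hom_cat C a (fob G y)) (hom_cat D (fob F a) y)
    ((\<lambda>Z. Z \<otimes>\<^bsub>D\<^esub> \<epsilon> y) \<circ> fmor F) ((\<lambda>f. f \<star>\<^bsub>D\<^esub> id2 D (\<epsilon> y)) \<circ> fcell F)"
proof -
  interpret transposed_pair C D F G P0 P1 nx ny "fob G y" y "\<epsilon> y" "unit1 C (fob G y)" "\<theta> y"
    by (rule counit_transposed[OF y])
  show ?thesis
    using C.ff_ess_surj_rtensor_unit[OF a fob_typing(2)[OF y]] unfolding ff_ess_surj_transfer[OF a] .
qed

text \<open>Here \<open>- \<otimes> \<epsilon>\<^sub>y\<close> is an equivalence because both \<open>F\<close> and \<open>F(-) \<otimes> \<epsilon>\<^sub>y\<close> are, and every endomorphism \<open>f'\<close> of the unit at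
  \<open>FG(y)\<close> comes from some \<open>f\<close> at \<open>G(y)\<close>, where \<open>counit_weight\<close> compares the weights.\<close>

lemma isometry_imp_counit:
  assumes iso: "isometry_3Hilb C D F" and y: "y \<in> Ob D"
  shows "unitary2 D (coev D (\<epsilon> y))"
proof -
  let ?b = "fob G y" let ?B = "fob F (fob G y)" let ?e = "\<epsilon> y" let ?u = "funit F (fob G y)"
  have e: "?e \<in> OneM D" "src D ?e = ?B" "trg D ?e = y" using \<epsilon>[OF y] unfolding D.hom1_iff by blast+
  have b: "?b \<in> Ob C" "?B \<in> Ob D" using y by (simp_all add: typing)
  interpret A: adjoint_pair D ?e "dual D ?e" "ev D ?e" "coev D ?e" by (rule D.adjoint_dual[OF e(1)])
  have F: "ff_ess_surj (hom_cat C ?b ?b) (hom_cat D ?B ?B) (fmor F) (fcell F)"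
    by (rule cat_equivalence_imp_ff_ess_surj[OF C.hom_cat D.hom_cat])
      (use iso b in \<open>auto simp: isometry_3Hilb_def\<close>)
  have ff: "ff_ess_surj (hom_cat D ?B ?B) (hom_cat D ?B y) (\<lambda>Z. Z \<otimes>\<^bsub>D\<^esub> ?e) (\<lambda>f. f \<star>\<^bsub>D\<^esub> id2 D ?e)"
    by (rule ff_ess_surj_cancel_right[OF C.hom_cat D.hom_cat D.hom_cat F D.rtensor_functor[OF \<epsilon>[OF y]] counit_ff_ess_surj[OF b(1) y]])
      (use b y in simp_all)
  have cc: "(coev D ?e)\<dagger>\<^bsub>D\<^esub> \<cdot>\<^bsub>D\<^esub> coev D ?e = id2 D (unit1 D ?B)"
  proof (rule D.weight_faithful[OF b(2)])
    show "(coev D ?e)\<dagger>\<^bsub>D\<^esub> \<cdot>\<^bsub>D\<^esub> coev D ?e \<in> hom2 D (unit1 D ?B) (unit1 D ?B)"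
      unfolding D.hom2_iff using e by (simp add: typing)
    show "((coev D ?e)\<dagger>\<^bsub>D\<^esub> \<cdot>\<^bsub>D\<^esub> coev D ?e)\<dagger>\<^bsub>D\<^esub> = (coev D ?e)\<dagger>\<^bsub>D\<^esub> \<cdot>\<^bsub>D\<^esub> coev D ?e"
      using e by (simp add: typing D.dagger_vcomp D.dagger_dagger)
    fix f' assume "f' \<in> hom2 D (unit1 D ?B) (unit1 D ?B)"
    then have f': "f' \<in> TwoM D" "dom2 D f' = unit1 D ?B" "cod2 D f' = unit1 D ?B" unfolding D.hom2_iff by blast+
    note u = funit_facts[OF b(1)]
    let ?k = "?u \<cdot>\<^bsub>D\<^esub> f' \<cdot>\<^bsub>D\<^esub> ?u\<dagger>\<^bsub>D\<^esub>"
    have I: "unit1 C ?b \<in> hom1 C ?b ?b" using C.unit1_hom b by blast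
    have k: "?k \<in> chom (hom_cat D ?B ?B) (fmor F (unit1 C ?b)) (fmor F (unit1 C ?b))"
      unfolding D.chom_iff using f' u b by (simp add: typing)
    obtain f where f: "f \<in> chom (hom_cat C ?b ?b) (unit1 C ?b) (unit1 C ?b)" "fcell F f = ?k"
      using bij_betw_hit[OF ff_ess_surjD(2)[OF F], OF _ _ k] I unfolding C.hom_cat_sel by blast
    have f2: "f \<in> hom2 C (unit1 C ?b) (unit1 C ?b)" using f(1) unfolding C.chom_iff C.hom2_iff by blast
    have "?u\<dagger>\<^bsub>D\<^esub> \<cdot>\<^bsub>D\<^esub> ?k \<cdot>\<^bsub>D\<^esub> ?u = (?u\<dagger>\<^bsub>D\<^esub> \<cdot>\<^bsub>D\<^esub> ?u) \<cdot>\<^bsub>D\<^esub> f' \<cdot>\<^bsub>D\<^esub> ?u\<dagger>\<^bsub>D\<^esub> \<cdot>\<^bsub>D\<^esub> ?u"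
      using f' u b by (simp add: typing D.vcomp_assoc)
    also have "\<dots> = f'" using D.unitary2D(1)[OF u(4)] u f' by (simp add: D.vcomp_id)
    finally have "?u\<dagger>\<^bsub>D\<^esub> \<cdot>\<^bsub>D\<^esub> fcell F f \<cdot>\<^bsub>D\<^esub> ?u = f'" unfolding f(2) .
    then show "weight D ?B (((coev D ?e)\<dagger>\<^bsub>D\<^esub> \<cdot>\<^bsub>D\<^esub> coev D ?e) \<cdot>\<^bsub>D\<^esub> f') = weight D ?B f'"
      using counit_weight[OF y f2] iso b(1) f2 unfolding isometry_3Hilb_def preserves_weights_def by metis
  qed
  show ?thesis
    by (rule A.fully_faithful_imp_coev_unitary)
      (use cc e D.ff_ess_surj_rtensor_bij[OF ff \<epsilon>[OF y]] in simp_all)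
qed

text \<open>A left inverse of \<open>\<epsilon>\<^sub>y\<close>: the object \<open>y\<close> is equivalent to some \<open>F(a)\<close>, the equivalence \<open>c\<^sub>y : F(a) \<rightarrow> y\<close> is isomorphic to
  \<open>F(Z) \<otimes> \<epsilon>\<^sub>y\<close> for some \<open>Z\<close>, and it has an inverse \<open>Y\<close>; so \<open>(Y \<otimes> F(Z)) \<otimes> \<epsilon>\<^sub>y \<cong> 1\<close>.\<close>

lemma equivalence_imp_counit:
  assumes iso: "isometry_3Hilb C D F" and eq: "equivalence_2cat C D F" and y: "y \<in> Ob D"
  shows "unitary2 D (ev D (\<epsilon> y))"
proof -
  let ?b = "fob G y" let ?e = "\<epsilon> y"
  have e: "?e \<in> OneM D" "src D ?e = fob F ?b" "trg D ?e = y" using \<epsilon>[OF y] unfolding D.hom1_iff by blast+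
  interpret A: adjoint_pair D ?e "dual D ?e" "ev D ?e" "coev D ?e" by (rule D.adjoint_dual[OF e(1)])
  obtain G' c \<alpha> where G': "two_functor D C G'" "two_transformation D D (comp_fun D D F G') (id_fun D) c \<alpha>"
    "\<forall>y\<in>Ob D. equivalence1 D (c y)"
    using eq unfolding equivalence_2cat_def by blast
  define a where "a = fob G' y"
  have a: "a \<in> Ob C" unfolding a_def by (rule two_functor.fob_in[OF G'(1) y])
  have cy: "c y \<in> hom1 D (fob F a) y"
    using two_transformation.comp_hom[OF G'(2) y] y unfolding comp_fun_def id_fun_def a_def by simp
  then have c: "c y \<in> OneM D" "src D (c y) = fob F a" "trg D (c y) = y" unfolding D.hom1_iff by blast+
  obtain Y t where Y: "Y \<in> OneM D" "src D Y = y" "trg D Y = fob F a"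
    and t: "t \<in> TwoM D" "dom2 D t = Y \<otimes>\<^bsub>D\<^esub> c y" "cod2 D t = unit1 D y" "iso2 D t"
  proof -
    have "equivalence1 D (c y)" using G'(3) y by blast
    then obtain Y t where "Y \<in> hom1 D y (fob F a)" "t \<in> hom2 D (Y \<otimes>\<^bsub>D\<^esub> c y) (unit1 D y)" "iso2 D t"
      unfolding equivalence1_def c(2,3) by blast
    then show thesis using that unfolding D.hom1_iff D.hom2_iff by blast
  qed
  obtain Z s where Z: "Z \<in> hom1 C a ?b" and s: "s \<in> chom (hom_cat D (fob F a) y) (fmor F Z \<otimes>\<^bsub>D\<^esub> ?e) (c y)"
      "ciso (hom_cat D (fob F a) y) s"
    using ff_ess_surjD(3)[OF counit_ff_ess_surj[OF a y], of "c y"] cy unfolding isomorphic_def C.hom_cat_sel D.hom_cat_sel by auto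
  have Z: "Z \<in> OneM C" "src C Z = a" "trg C Z = ?b" using Z unfolding C.hom1_iff by blast+
  have s': "s \<in> TwoM D" "dom2 D s = fmor F Z \<otimes>\<^bsub>D\<^esub> ?e" "cod2 D s = c y" using s(1) unfolding D.chom_iff by blast+
  let ?K = "hom_cat D y y"
  interpret K: dagger_category ?K using D.hom_cat y by blast
  let ?A = "assoc D Y (fmor F Z) ?e" and ?w = "id2 D Y \<star>\<^bsub>D\<^esub> s"
  note T = Y Z a s' e t c y
  have k1: "?A \<in> chom ?K ((Y \<otimes>\<^bsub>D\<^esub> fmor F Z) \<otimes>\<^bsub>D\<^esub> ?e) (Y \<otimes>\<^bsub>D\<^esub> fmor F Z \<otimes>\<^bsub>D\<^esub> ?e)"
    unfolding D.chom_iff using T by (simp add: typing)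
  have k2: "?w \<in> chom ?K (Y \<otimes>\<^bsub>D\<^esub> fmor F Z \<otimes>\<^bsub>D\<^esub> ?e) (Y \<otimes>\<^bsub>D\<^esub> c y)"
    unfolding D.chom_iff using T by (simp add: typing)
  have k3: "t \<in> chom ?K (Y \<otimes>\<^bsub>D\<^esub> c y) (unit1 D y)"
    unfolding D.chom_iff using T by (simp add: typing)
  have i1: "ciso ?K ?A" by (rule D.iso2_ciso[OF k1 D.unitary_iso2]) (use T in \<open>simp_all add: typing D.unitary_struct\<close>)
  have i2: "ciso ?K ?w"
  proof -
    obtain r where r: "r \<in> TwoM D" "dom2 D r = c y" "cod2 D r = fmor F Z \<otimes>\<^bsub>D\<^esub> ?e"
      "r \<cdot>\<^bsub>D\<^esub> s = id2 D (fmor F Z \<otimes>\<^bsub>D\<^esub> ?e)" "s \<cdot>\<^bsub>D\<^esub> r = id2 D (c y)"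
      using D.iso2E[OF D.ciso_iso2[OF s] s'(1)] s' by metis
    have "id2 D Y \<star>\<^bsub>D\<^esub> r \<in> chom ?K (Y \<otimes>\<^bsub>D\<^esub> c y) (Y \<otimes>\<^bsub>D\<^esub> fmor F Z \<otimes>\<^bsub>D\<^esub> ?e)"
      unfolding D.chom_iff using T r by (simp add: typing)
    then show ?thesis
      by (rule K.cisoI[OF k2])
        (use T r in \<open>simp_all add: D.hom_cat_sel typing D.interchange' D.vcomp_id D.hcomp_id'\<close>)
  qed
  have i3: "ciso ?K t" by (rule D.iso2_ciso[OF k3 t(4)])
  have k: "t \<odot>\<^bsub>?K\<^esub> (?w \<odot>\<^bsub>?K\<^esub> ?A) \<in> chom ?K ((Y \<otimes>\<^bsub>D\<^esub> fmor F Z) \<otimes>\<^bsub>D\<^esub> ?e) (unit1 D y)"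
    using K.comp_hom k1 k2 k3 by blast
  have "ciso ?K (t \<odot>\<^bsub>?K\<^esub> (?w \<odot>\<^bsub>?K\<^esub> ?A))"
    by (rule K.ciso_comp[OF K.ciso_comp[OF i1 i2 k1 k2] i3 K.comp_hom[OF k1 k2] k3])
  then have "iso2 D (t \<odot>\<^bsub>?K\<^esub> (?w \<odot>\<^bsub>?K\<^esub> ?A))" by (rule D.ciso_iso2[OF k])
  with k show ?thesis
    by (intro A.coev_unitary_imp_ev_unitary[OF isometry_imp_counit[OF iso y],
          of "Y \<otimes>\<^bsub>D\<^esub> fmor F Z" "t \<odot>\<^bsub>?K\<^esub> (?w \<odot>\<^bsub>?K\<^esub> ?A)"])
      (use T in \<open>simp_all add: typing D.chom_iff\<close>)
qed

end

end

theorem mainTheorem13: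
  fixes \<XX> :: "('o, 'm, 'c) pre3"
    and \<YY> :: "('p, 'n, 'd) pre3"
    and F :: "('o, 'm, 'c, 'p, 'n, 'd) two_fun"
    and Fs :: "('p, 'n, 'd, 'o, 'm, 'c) two_fun"
    and coevF :: "('o, 'm, 'c, 'o, 'm, 'c) two_nat"
    and evF :: "('p, 'n, 'd, 'p, 'n, 'd) two_nat"
  assumes "three_hilbert \<XX>"
    and "three_hilbert \<YY>"
    and "F \<in> Ob (Hom3 \<XX> \<YY>)"
    and "unitary_2adjoint \<XX> \<YY> F Fs coevF evF"
  shows "(isometry_3Hilb \<XX> \<YY> F \<longleftrightarrow>
            isometric_equivalence1 (End3 \<XX>) coevF \<and> isometry1 (End3 \<YY>) evF) \<and>
         (isometric_equivalence_3Hilb \<XX> \<YY> F \<longleftrightarrow>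
            isometric_equivalence1 (End3 \<XX>) coevF \<and> isometric_equivalence1 (End3 \<YY>) evF)"
proof -
  interpret X: weighted_2category \<XX> by (rule three_hilbert_weighted[OF assms(1)])
  interpret Y: weighted_2category \<YY> by (rule three_hilbert_weighted[OF assms(2)])
  obtain P0 P1 nx ny where nat: "natural_hom_isometries \<XX> \<YY> F Fs P0 P1 nx ny"
    and un: "is_unit \<XX> \<YY> F Fs P0 P1 nx ny coevF" and co: "is_counit \<XX> \<YY> F Fs P0 P1 nx ny evF"
    and Fs: "Fs \<in> Ob (Hom3 \<YY> \<XX>)"
    using assms(4) unfolding unitary_2adjoint_def by blast
  interpret A: hom_adjunction \<XX> \<YY> F Fs P0 P1 nx ny
    using nat assms(3) Fs unfolding hom_adjunction_def hom_adjunction_axioms_def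
    by (simp add: Hom3_def X.weighted_2category_axioms Y.weighted_2category_axioms)
  have coevF: "coevF \<in> Hom_OneM \<XX> \<XX>" "nsrc coevF = id_fun \<XX>" "ntrg coevF = comp_fun \<XX> \<XX> Fs F"
    using un unfolding is_unit_def hom1_def by (simp_all add: Hom3_def)
  have evF: "evF \<in> Hom_OneM \<YY> \<YY>" "nsrc evF = comp_fun \<YY> \<YY> F Fs" "ntrg evF = id_fun \<YY>"
    using co unfolding is_counit_def hom1_def by (simp_all add: Hom3_def)
  have \<eta>: "ncomp coevF x \<in> hom1 \<XX> x (fob Fs (fob F x))" if "x \<in> Ob \<XX>" for x
    using Hom_OneM_comp[OF coevF(1) that] that unfolding coevF(2,3) by (simp add: id_fun_def comp_fun_def)
  have \<epsilon>: "ncomp evF y \<in> hom1 \<YY> (fob F (fob Fs y)) y" if "y \<in> Ob \<YY>" for y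
    using Hom_OneM_comp[OF evF(1) that] that unfolding evF(2,3) by (simp add: id_fun_def comp_fun_def)
  obtain \<theta> where \<theta>: "\<And>x. x \<in> Ob \<XX> \<Longrightarrow> \<theta> x \<in> hom2 \<XX> (P0 x (fob F x) (unit1 \<YY> (fob F x))) (ncomp coevF x)"
      "\<And>x. x \<in> Ob \<XX> \<Longrightarrow> unitary2 \<XX> (\<theta> x)"
    using un unfolding is_unit_def by blast
  obtain \<theta>' where \<theta>': "\<And>y. y \<in> Ob \<YY> \<Longrightarrow> \<theta>' y \<in> hom2 \<XX> (P0 (fob Fs y) y (ncomp evF y)) (unit1 \<XX> (fob Fs y))"
      "\<And>y. y \<in> Ob \<YY> \<Longrightarrow> unitary2 \<XX> (\<theta>' y)"
    using co unfolding is_counit_def by blast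
  have isometry_iff: "isometry_3Hilb \<XX> \<YY> F \<longleftrightarrow>
      (\<forall>x\<in>Ob \<XX>. unitary2 \<XX> (coev \<XX> (ncomp coevF x)) \<and> unitary2 \<XX> (ev \<XX> (ncomp coevF x)))"
    by (rule A.isometry_iff_unit[OF \<eta> \<theta>])
  have unit: "isometric_equivalence1 (End3 \<XX>) coevF \<longleftrightarrow> isometry_3Hilb \<XX> \<YY> F"
    unfolding isometry_iff isometric_equivalence1_def
      X.Hom3_ev_coev_iff[OF coevF(1)] using coevF(1) by (auto simp: Hom3_def)
  have counit: "isometry1 (End3 \<YY>) evF" if "isometry_3Hilb \<XX> \<YY> F"
  proof -
    have c: "unitary2 \<YY> (coev \<YY> (ncomp evF y))" if y: "y \<in> Ob \<YY>" for y
      by (rule A.isometry_imp_counit[of "ncomp evF" \<theta>', OF \<epsilon> \<theta>' \<open>isometry_3Hilb \<XX> \<YY> F\<close> y])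
    have "isometric2 \<YY> (ev \<YY> (ncomp evF y))" if y: "y \<in> Ob \<YY>" for y
    proof -
      have "ncomp evF y \<in> OneM \<YY>" using \<epsilon>[OF y] unfolding Y.hom1_iff by blast
      then show ?thesis
        using adjoint_pair.coev_unitary_imp_ev_isometric[OF Y.adjoint_dual c[OF y]]
        unfolding isometric2_def by (simp add: typing)
    qed
    then show ?thesis
      unfolding isometry1_def Y.Hom3_ev_coev_iff[OF evF(1)] using evF(1) c by (auto simp: Hom3_def)
  qed
  have equivalence: "isometric_equivalence1 (End3 \<YY>) evF \<longleftrightarrow> equivalence_2cat \<XX> \<YY> F"
    if iso: "isometry_3Hilb \<XX> \<YY> F"
  proof
    assume "isometric_equivalence1 (End3 \<YY>) evF"
    then have e: "unitary2 \<YY> (coev \<YY> (ncomp evF y)) \<and> unitary2 \<YY> (ev \<YY> (ncomp evF y))" if "y \<in> Ob \<YY>" for y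
      unfolding isometric_equivalence1_def Y.Hom3_ev_coev_iff[OF evF(1)] using that by blast
    have "equivalence1 \<XX> (ncomp coevF x)" if x: "x \<in> Ob \<XX>" for x
      using iso x \<eta>[OF x] unfolding isometry_iff X.hom1_iff
      by (intro adjoint_pair.unitary_imp_equivalence1[OF X.adjoint_dual]) auto
    moreover have "equivalence1 \<YY> (ncomp evF y)" if y: "y \<in> Ob \<YY>" for y
      using e[OF y] \<epsilon>[OF y] unfolding Y.hom1_iff
      by (intro adjoint_pair.unitary_imp_equivalence1[OF Y.adjoint_dual]) auto
    moreover have "two_transformation \<XX> \<XX> (id_fun \<XX>) (comp_fun \<XX> \<XX> Fs F) (ncomp coevF) (nnat coevF)"
      using coevF unfolding Hom_OneM_def by auto
    moreover have "two_transformation \<YY> \<YY> (comp_fun \<YY> \<YY> F Fs) (id_fun \<YY>) (ncomp evF) (nnat evF)"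
      using evF unfolding Hom_OneM_def by auto
    ultimately show "equivalence_2cat \<XX> \<YY> F"
      unfolding equivalence_2cat_def using A.F_functor A.G_functor by blast
  next
    assume eq: "equivalence_2cat \<XX> \<YY> F"
    have "unitary2 \<YY> (ev \<YY> (ncomp evF y))" if y: "y \<in> Ob \<YY>" for y
      by (rule A.equivalence_imp_counit[of "ncomp evF" \<theta>', OF \<epsilon> \<theta>' iso eq y])
    then show "isometric_equivalence1 (End3 \<YY>) evF"
      using counit[OF iso] unfolding isometric_equivalence1_def isometry1_def Y.Hom3_ev_coev_iff[OF evF(1)] by blast
  qed
  show ?thesis
    unfolding isometric_equivalence_3Hilb_def using unit counit equivalence by blast
qed

end
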